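(* Let $(P,r)$ be a finite graded poset such that $\varDelta(P)$ is a homology $n$-manifold. Then the magnitude homology of $P$ is diagonal and torsion-free. In particular, $$\mathrm{MH}^k_i(P)\cong\begin{cases}\mathbb{Z}^{\#\{(x,y)\in P\times P\,\mid\, x\le y,\ r(y)-r(x)=k\}} & (i=k),\\ 0 & (i\ne k).\end{cases}$$
   Context: A topological space $X$ is a homology $n$-manifold (without boundary) if for every $x\in X$ the local homology $H_i(X,X\setminus\{x\};\mathbb{Z})$ is $0$ for $i\ne n$ and is isomorphic to $\mathbb{Z}$ for $i=n$. A finite poset $P$ is graded of rank $m\ge 0$ if every maximal chain of $P$ has length $m$ (i.e. $m+1$ elements); its rank function $r$ satisfies $r(x)=0$ for $x$ minimal and $r(y)=r(x)+1$ if $y$ covers $x$. The order complex $\varDelta(P)$ is the abstract simplicial complex whose simplices are the chains of $P$ (the manifold condition refers to its geometric realization). Magnitude homology of $(P,r)$: set $d(x,y)=r(y)-r(x)$ if $x\le y$ and $d(x,y)=\infty$ otherwise, and $L(x_0,\dots,x_m)=\sum_{i=0}^{m-1}d(x_i,x_{i+1})$. Let $\mathrm{MC}^k_m(P)$ be the free abelian group on tuples $(x_0,\dots,x_m)\in P^{m+1}$ with $x_i\ne x_{i+1}$ for all $i$ and $L(x_0,\dots,x_m)=k$. The boundary $\partial:\mathrm{MC}^k_m(P)\to \mathrm{MC}^k_{m-1}(P)$ is $\partial=\sum_{i=0}^m(-1)^i\partial_i$, where $\partial_i$ deletes $x_i$ if the resulting tuple still has length $k$ and is $0$ otherwise. Then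 $\mathrm{MH}^k_m(P)=H_m(\mathrm{MC}^k_*(P),\partial)$, for integers $k,m\ge 0$. The magnitude homology is diagonal if $\mathrm{MH}^k_m(P)=0$ whenever $m\ne k$. *)

theory Defs
  imports "HOL-Homology.Homology" "HOL-Library.Extended_Nat"
begin

text \<open>
  A poset is a subset \<open>P\<close> of a type of class \<open>order\<close>, with the induced order.
  Its chains and maximal chains are \<open>pred_on.chain P (<)\<close> and \<open>pred_on.maxchain P (<)\<close>.
\<close>

section \<open>Graded posets\<close>

definition graded_poset :: "'a::order set \<Rightarrow> nat \<Rightarrow> bool" where
  "graded_poset P m \<longleftrightarrow>
     finite P \<and> (\<forall>C. pred_on.maxchain P (<) C \<longrightarrow> card C = m + 1)"

definition covered_by :: "'a::order set \<Rightarrow> 'a \<Rightarrow> 'a \<Rightarrow> bool" where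
  "covered_by P x y \<longleftrightarrow> x \<in> P \<and> y \<in> P \<and> x < y \<and> \<not> (\<exists>z\<in>P. x < z \<and> z < y)"

definition rank_function :: "'a::order set \<Rightarrow> ('a \<Rightarrow> nat) \<Rightarrow> bool" where
  "rank_function P r \<longleftrightarrow>
     (\<forall>x\<in>P. \<not> (\<exists>y\<in>P. y < x) \<longrightarrow> r x = 0) \<and>
     (\<forall>x y. covered_by P x y \<longrightarrow> r y = r x + 1)"

section \<open>Order complex and homology manifolds\<close>

definition order_complex :: "'a::order set \<Rightarrow> 'a set set" where
  "order_complex P = {C. pred_on.chain P (<) C}"

text \<open>
  The points of the realization are given by barycentric coordinates. An empty member of \<open>K\<close>
  contributes no point. The subspace topology used here is the usual (coherent) topology of the
  realization when \<open>K\<close> is a finite complex, the only case in which it is used.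
\<close>

definition geometric_realization :: "'a set set \<Rightarrow> ('a \<Rightarrow> real) topology" where
  "geometric_realization K =
     subtopology (powertop_real UNIV)
       {f. (\<forall>v. 0 \<le> f v) \<and> {v. f v \<noteq> 0} \<in> K \<and> (\<Sum>v | f v \<noteq> 0. f v) = 1}"

definition homology_manifold :: "nat \<Rightarrow> 'b topology \<Rightarrow> bool" where
  "homology_manifold n X \<longleftrightarrow>
     (\<forall>x\<in>topspace X.
        (\<forall>i. i \<noteq> int n \<longrightarrow> trivial_group (relative_homology_group i X (topspace X - {x}))) \<and>
        relative_homology_group (int n) X (topspace X - {x}) \<cong> integer_group)"

section \<open>Magnitude homology\<close>

text \<open>
  A rank function is monotone on \<open>P\<close>, so the subtraction below does not truncate there.
\<close>

definition mag_dist :: "('a::order \<Rightarrow> nat) \<Rightarrow> 'a \<Rightarrow> 'a \<Rightarrow> enat" where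
  "mag_dist r x y = (if x \<le> y then enat (r y - r x) else \<infinity>)"

definition mag_length :: "('a::order \<Rightarrow> nat) \<Rightarrow> 'a list \<Rightarrow> enat" where
  "mag_length r xs = (\<Sum>i<length xs - 1. mag_dist r (xs ! i) (xs ! Suc i))"

definition mag_tuples :: "'a::order set \<Rightarrow> ('a \<Rightarrow> nat) \<Rightarrow> nat \<Rightarrow> nat \<Rightarrow> 'a list set" where
  "mag_tuples P r k m =
     {xs. length xs = m + 1 \<and> set xs \<subseteq> P \<and> (\<forall>i<m. xs ! i \<noteq> xs ! Suc i) \<and>
          mag_length r xs = enat k}"

definition mag_chain_group ::
    "'a::order set \<Rightarrow> ('a \<Rightarrow> nat) \<Rightarrow> nat \<Rightarrow> nat \<Rightarrow> ('a list \<Rightarrow>\<^sub>0 int) monoid" where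
  "mag_chain_group P r k m = free_Abelian_group (mag_tuples P r k m)"

definition delete_nth :: "nat \<Rightarrow> 'a list \<Rightarrow> 'a list" where
  "delete_nth i xs = take i xs @ drop (Suc i) xs"

text \<open>
  The condition \<open>delete_nth i xs \<noteq> []\<close> makes the boundary vanish in degree \<open>0\<close>.
\<close>

definition mag_face :: "('a::order \<Rightarrow> nat) \<Rightarrow> nat \<Rightarrow> nat \<Rightarrow> 'a list \<Rightarrow> ('a list \<Rightarrow>\<^sub>0 int)" where
  "mag_face r k i xs =
     (if delete_nth i xs \<noteq> [] \<and> mag_length r (delete_nth i xs) = enat k
      then frag_of (delete_nth i xs) else 0)"

definition mag_boundary ::
    "('a::order \<Rightarrow> nat) \<Rightarrow> nat \<Rightarrow> ('a list \<Rightarrow>\<^sub>0 int) \<Rightarrow> ('a list \<Rightarrow>\<^sub>0 int)" where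
  "mag_boundary r k =
     frag_extend (\<lambda>xs. \<Sum>i<length xs. frag_cmul ((-1) ^ i) (mag_face r k i xs))"

definition mag_cycles ::
    "'a::order set \<Rightarrow> ('a \<Rightarrow> nat) \<Rightarrow> nat \<Rightarrow> nat \<Rightarrow> ('a list \<Rightarrow>\<^sub>0 int) set" where
  "mag_cycles P r k m = {c \<in> carrier (mag_chain_group P r k m). mag_boundary r k c = 0}"

definition mag_boundaries ::
    "'a::order set \<Rightarrow> ('a \<Rightarrow> nat) \<Rightarrow> nat \<Rightarrow> nat \<Rightarrow> ('a list \<Rightarrow>\<^sub>0 int) set" where
  "mag_boundaries P r k m = mag_boundary r k ` carrier (mag_chain_group P r k (m + 1))"

definition magnitude_homology ::
    "'a::order set \<Rightarrow> ('a \<Rightarrow> nat) \<Rightarrow> nat \<Rightarrow> nat \<Rightarrow> ('a list \<Rightarrow>\<^sub>0 int) set monoid" where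
  "magnitude_homology P r k m =
     subgroup_generated (mag_chain_group P r k m) (mag_cycles P r k m) Mod mag_boundaries P r k m"

definition diagonal_magnitude_homology :: "'a::order set \<Rightarrow> ('a \<Rightarrow> nat) \<Rightarrow> bool" where
  "diagonal_magnitude_homology P r \<longleftrightarrow>
     (\<forall>k m. m \<noteq> k \<longrightarrow> trivial_group (magnitude_homology P r k m))"

definition torsion_free_group :: "('a, 'b) monoid_scheme \<Rightarrow> bool" where
  "torsion_free_group G \<longleftrightarrow>
     (\<forall>x\<in>carrier G. \<forall>j::nat. 0 < j \<longrightarrow> x [^]\<^bsub>G\<^esub> j = \<one>\<^bsub>G\<^esub> \<longrightarrow> x = \<one>\<^bsub>G\<^esub>)"

end

theory Submission
  imports Defs
begin

text \<open>
  The faces of a magnitude chain never delete an end point without losing length, so the magnitude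
  complex splits over pairs \<open>a \<le> b\<close>, and the summand of \<open>(a, b)\<close> is, up to a shift by two, the
  augmented simplicial chain complex of the order complex of the open interval from \<open>a\<close> to \<open>b\<close>.
  Complete \<open>{a, b}\<close> to a chain \<open>\<sigma>\<close> that is maximal outside this interval. The order complex of the
  interval is then the link of \<open>\<sigma>\<close>, so its reduced homology is, up to a shift by \<open>card \<sigma>\<close>, the
  homology of the simplicial chains on all simplices relative to those not containing \<open>\<sigma>\<close>. For a
  point \<open>x\<close> in the interior of \<open>\<sigma>\<close> the latter simplices span a deformation retract of the complement
  of \<open>x\<close>, hence this is the local homology at \<open>x\<close>, which is \<open>\<int>\<close> in a single degree. Simplicial and
  singular homology are compared by removing maximal simplices one at a time: by excision and
  Mayer-Vietoris the mapping cone of the comparison map stays acyclic.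
\<close>

section \<open>Relative exactness in graded differential groups\<close>

text \<open>That the single degree is the diagonal one depends on gradedness. With
  \<open>q = length lo + length hi\<close>, a tuple with \<open>m + 1\<close> entries from
  \<open>a\<close> to \<open>b\<close> becomes a simplex of dimension \<open>m + q\<close>. A
  saturated tuple completes \<open>\<sigma>\<close> to a maximal chain, so
  \<open>r b - r a + q = rk\<close> by counting vertices. On the other side \<open>n = rk\<close>,
  because at an interior point of a maximal simplex the local homology in degree \<open>rk\<close>
  is nonzero. Hence only \<open>m = r b - r a\<close> survives. No tuple of magnitude length
  \<open>k\<close> has more than \<open>k + 1\<close> entries, so the diagonal group is a group of
  cycles, infinite cyclic for each pair. Chains relative to those avoiding \<open>\<sigma>\<close>
  also treat \<open>a = b\<close> and covering pairs uniformly, where the open interval is empty and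
  its reduced homology sits in degree -1. Complexes are families of subsets of one ambient group and
  quotients never appear as groups, so that every exact sequence becomes a chase with
  representatives.\<close>

definition plus_family :: "(nat \<Rightarrow> 'c::ab_group_add set) \<Rightarrow> (nat \<Rightarrow> 'c set) \<Rightarrow> nat \<Rightarrow> 'c set" where
  "plus_family A B p = {a + b |a b. a \<in> A p \<and> b \<in> B p}"

definition inter_family :: "(nat \<Rightarrow> 'c set) \<Rightarrow> (nat \<Rightarrow> 'c set) \<Rightarrow> nat \<Rightarrow> 'c set" where
  "inter_family A B p = A p \<inter> B p"

text \<open>\<open>D p\<close> acts on the whole type. That consecutive maps compose to zero is
  asked of a \<open>subcomplex\<close> only, since for the complexes below it is established on
  genuine chains.\<close>

locale graded_differential =
  fixes D :: "nat \<Rightarrow> 'c::ab_group_add \<Rightarrow> 'c"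
  assumes D_diff: "D p (x - y) = D p x - D p y"
    and D_degree_0: "D 0 x = 0"
begin

lemma D_0 [simp]: "D p 0 = 0"
  using D_diff[of p 0 0] by simp

lemma D_minus: "D p (- x) = - D p x"
  using D_diff[of p 0 x] by simp

lemma D_add: "D p (x + y) = D p x + D p y"
  using D_diff[of p x "- y"] by (simp add: D_minus)

definition subcomplex :: "(nat \<Rightarrow> 'c set) \<Rightarrow> bool" where
  "subcomplex A \<longleftrightarrow>
     (\<forall>p. 0 \<in> A p \<and> (\<forall>x\<in>A p. \<forall>y\<in>A p. x - y \<in> A p) \<and>
          (\<forall>x\<in>A p. D p x \<in> A (p - 1) \<and> D (p - 1) (D p x) = 0))"

definition exact :: "(nat \<Rightarrow> 'c set) \<Rightarrow> bool" where
  "exact A \<longleftrightarrow> (\<forall>p. \<forall>x\<in>A p. D p x = 0 \<longrightarrow> (\<exists>y\<in>A (Suc p). D (Suc p) y = x))"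

text \<open>For a subcomplex \<open>A\<close> of \<open>B\<close> this is acyclicity of the quotient
  complex B/A, phrased with representatives.\<close>

definition rel_exact :: "(nat \<Rightarrow> 'c set) \<Rightarrow> (nat \<Rightarrow> 'c set) \<Rightarrow> bool" where
  "rel_exact B A \<longleftrightarrow>
     (\<forall>p. \<forall>x\<in>B p. D p x \<in> A (p - 1) \<longrightarrow> (\<exists>y\<in>B (Suc p). x - D (Suc p) y \<in> A p))"

lemma
  assumes "subcomplex A"
  shows subcomplex_0: "0 \<in> A p"
    and subcomplex_diff: "x \<in> A p \<Longrightarrow> y \<in> A p \<Longrightarrow> x - y \<in> A p"
    and subcomplex_D: "x \<in> A p \<Longrightarrow> D p x \<in> A (p - 1)"
    and subcomplex_D_Suc: "x \<in> A (Suc p) \<Longrightarrow> D (Suc p) x \<in> A p"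
    and subcomplex_DD: "x \<in> A (Suc p) \<Longrightarrow> D p (D (Suc p) x) = 0"
  using assms unfolding subcomplex_def by (blast, blast, blast, force, force)

lemma subcomplex_minus: "subcomplex A \<Longrightarrow> x \<in> A p \<Longrightarrow> - x \<in> A p"
  using subcomplex_diff[of A 0 p x] subcomplex_0[of A p] by simp

lemma subcomplex_add: "subcomplex A \<Longrightarrow> x \<in> A p \<Longrightarrow> y \<in> A p \<Longrightarrow> x + y \<in> A p"
  using subcomplex_diff[of A x p "- y"] subcomplex_minus[of A y p] by simp

text \<open>Mayer-Vietoris. For a cycle \<open>a + b\<close> the boundary of \<open>a\<close> is
  also that of \<open>- b\<close>, hence a cycle of the intersection; if \<open>n\<close> in the
  intersection has this boundary, \<open>a - n\<close> and \<open>b + n\<close> are cycles of the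
  summands.\<close>

lemma exact_plus_family:
  assumes A: "subcomplex A" and B: "subcomplex B"
    and ex: "exact A" "exact B" "exact (inter_family A B)"
  shows "exact (plus_family A B)"
  unfolding exact_def
proof (intro allI ballI impI)
  fix p x assume x: "x \<in> plus_family A B p" "D p x = 0"
  then obtain a b where ab: "x = a + b" "a \<in> A p" "b \<in> B p"
    by (auto simp: plus_family_def)
  obtain n where n: "n \<in> A p" "n \<in> B p" "D p n = D p a"
  proof (cases p)
    case 0
    then show ?thesis using that[of 0] A B by (simp add: D_degree_0 subcomplex_0)
  next
    case (Suc q)
    have "D p a = D p (- b)"
      using x ab by (simp add: D_add D_minus eq_neg_iff_add_eq_0)
    then have "D p a \<in> inter_family A B q"
      using ab A B Suc unfolding inter_family_def
      by (metis IntI subcomplex_D_Suc subcomplex_minus)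
    moreover have "D q (D p a) = 0"
      using ab A Suc subcomplex_DD by blast
    ultimately show ?thesis
      using ex(3) that Suc unfolding exact_def inter_family_def by blast
  qed
  have "a - n \<in> A p" "D p (a - n) = 0"
    using A ab n by (auto simp: D_diff subcomplex_diff)
  then obtain a' where a': "a' \<in> A (Suc p)" "D (Suc p) a' = a - n"
    using ex(1) unfolding exact_def by blast
  have "b + n \<in> B p" "D p (b + n) = 0"
    using B ab n x by (auto simp: D_add subcomplex_add add.commute)
  then obtain b' where b': "b' \<in> B (Suc p)" "D (Suc p) b' = b + n"
    using ex(2) unfolding exact_def by blast
  have "a' + b' \<in> plus_family A B (Suc p)" "D (Suc p) (a' + b') = x"
    using a' b' ab by (auto simp: plus_family_def D_add)
  then show "\<exists>y\<in>plus_family A B (Suc p). D (Suc p) y = x"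
    by blast
qed

text \<open>Part of the long exact sequence of the pair: the acyclic quotient moves a cycle into
  \<open>A\<close>, where it bounds.\<close>

lemma exact_extend:
  assumes B: "subcomplex B" and sub: "\<And>p. A p \<subseteq> B p" and A: "subcomplex A"
    and "exact A" "rel_exact B A"
  shows "exact B"
  unfolding exact_def
proof (intro allI ballI impI)
  fix p x assume x: "x \<in> B p" "D p x = 0"
  then obtain y where y: "y \<in> B (Suc p)" "x - D (Suc p) y \<in> A p"
    using assms(5) subcomplex_0[OF A] unfolding rel_exact_def by metis
  moreover have "D p (x - D (Suc p) y) = 0"
    using x y B by (simp add: D_diff subcomplex_DD)
  ultimately obtain z where z: "z \<in> A (Suc p)" "D (Suc p) z = x - D (Suc p) y"
    using assms(4) unfolding exact_def by blast
  have "z + y \<in> B (Suc p)" "D (Suc p) (z + y) = x"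
    using z y sub[of "Suc p"] B by (auto simp: D_add subcomplex_add)
  then show "\<exists>y\<in>B (Suc p). D (Suc p) y = x" by blast
qed

text \<open>Another part of the long exact sequence of the pair: the boundary of a relative cycle
  bounds in \<open>A\<close>, and subtracting leaves an absolute cycle of \<open>B\<close>.\<close>

lemma rel_exact_of_exact:
  assumes B: "subcomplex B" and A: "subcomplex A" and sub: "\<And>p. A p \<subseteq> B p"
    and "exact A" "exact B"
  shows "rel_exact B A"
  unfolding rel_exact_def
proof (intro allI ballI impI)
  fix p x assume x: "x \<in> B p" "D p x \<in> A (p - 1)"
  obtain a where a: "a \<in> A p" "D p a = D p x" if "p > 0"
  proof (cases p)
    case (Suc q)
    then have "D q (D p x) = 0" using x B subcomplex_DD by blast
    moreover have "D p x \<in> A q" using x Suc by simp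
    ultimately obtain a where "a \<in> A (Suc q)" "D (Suc q) a = D p x"
      using assms(4) unfolding exact_def by blast
    then show ?thesis using that Suc by blast
  qed blast
  show "\<exists>y\<in>B (Suc p). x - D (Suc p) y \<in> A p"
  proof (cases "p = 0")
    case True
    have "D p x = 0" using True D_degree_0 by auto
    then obtain y where y: "y \<in> B (Suc p)" "D (Suc p) y = x"
      using x assms(5) unfolding exact_def by blast
    then show ?thesis using A subcomplex_0 by force
  next
    case False
    then have a: "a \<in> A p" "D p (x - a) = 0" "x - a \<in> B p"
      using a x sub B by (auto simp: D_diff intro: subcomplex_diff)
    then obtain y where "y \<in> B (Suc p)" "D (Suc p) y = x - a"
      using assms(5) unfolding exact_def by blast
    with a show ?thesis by force
  qed
qed

text \<open>Long exact sequence of the triple: push from \<open>C\<close> into \<open>B\<close>,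
  then from \<open>B\<close> into \<open>A\<close>.\<close>

lemma rel_exact_trans:
  assumes C: "subcomplex C" and "\<And>p. A p \<subseteq> B p" "\<And>p. B p \<subseteq> C p"
    and "rel_exact C B" "rel_exact B A"
  shows "rel_exact C A"
  unfolding rel_exact_def
proof (intro allI ballI impI)
  fix p x assume x: "x \<in> C p" "D p x \<in> A (p - 1)"
  then obtain y where y: "y \<in> C (Suc p)" "x - D (Suc p) y \<in> B p"
    using assms unfolding rel_exact_def by blast
  have "D p (x - D (Suc p) y) \<in> A (p - 1)"
    using x y C by (simp add: D_diff subcomplex_DD)
  with y obtain z where z: "z \<in> B (Suc p)" "x - D (Suc p) y - D (Suc p) z \<in> A p"
    using assms(5) unfolding rel_exact_def by blast
  have "y + z \<in> C (Suc p)" "x - D (Suc p) (y + z) \<in> A p"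
    using y z assms(3) C by (auto simp: D_add algebra_simps intro: subcomplex_add)
  then show "\<exists>y\<in>C (Suc p). x - D (Suc p) y \<in> A p" by blast
qed

text \<open>By the modular law (U + V)/(K + V) is U/(K + (U \<inter> V)), which is the quotient of
  U/K by (U \<inter> V)/(K \<inter> V); both are acyclic.\<close>

lemma rel_exact_plus_family:
  assumes U: "subcomplex U" and V: "subcomplex V" and K: "subcomplex K" and KU: "\<And>p. K p \<subseteq> U p"
    and ex: "rel_exact U K" "rel_exact (inter_family U V) (inter_family K V)"
  shows "rel_exact (plus_family U V) (plus_family K V)"
  unfolding rel_exact_def
proof (intro allI ballI impI)
  fix p x assume x: "x \<in> plus_family U V p" "D p x \<in> plus_family K V (p - 1)"
  then obtain u v where uv: "x = u + v" "u \<in> U p" "v \<in> V p"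
    by (auto simp: plus_family_def)
  obtain t where t: "t \<in> U p" "t \<in> V p" "D p (u - t) \<in> K (p - 1)"
  proof (cases p)
    case 0
    then show ?thesis using that[of 0] U V K by (simp add: D_degree_0 subcomplex_0)
  next
    case (Suc q)
    obtain k w where kw: "D p x = k + w" "k \<in> K q" "w \<in> V q"
      using x Suc by (auto simp: plus_family_def)
    \<comment> \<open>\<open>s\<close> is a relative cycle of the pair of intersections: this
      formula puts it in \<open>U\<close>, the next one in \<open>V\<close>. Removing its bounding
      chain \<open>t\<close> from \<open>u\<close> leaves a boundary in \<open>K\<close>.\<close>
    define s where "s = D p u - k"
    have s_alt: "s = w - D p v"
      using kw uv by (simp add: s_def D_add algebra_simps)
    have "s \<in> U q"
      unfolding s_def using U uv KU kw Suc by (blast intro: subcomplex_diff subcomplex_D_Suc)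
    moreover have sV: "s \<in> V q"
      unfolding s_alt using V uv kw Suc by (blast intro: subcomplex_diff subcomplex_D_Suc)
    moreover have "D q s = - D q k"
      using subcomplex_DD[OF U] uv Suc by (simp add: s_def D_diff)
    then have "D q s \<in> inter_family K V (q - 1)"
      using subcomplex_D[OF K kw(2)] subcomplex_D[OF V sV] subcomplex_minus[OF K]
      by (simp add: inter_family_def)
    ultimately obtain t where t: "t \<in> inter_family U V p" "s - D p t \<in> inter_family K V q"
      using ex(2) Suc unfolding rel_exact_def by (metis IntI inter_family_def)
    have "D p (u - t) = k + (s - D p t)"
      by (simp add: s_def D_diff)
    then show ?thesis
      using that[of t] t Suc K kw by (auto simp: inter_family_def intro: subcomplex_add)
  qed
  have "u - t \<in> U p" using U uv t by (blast intro: subcomplex_diff)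
  then obtain y where y: "y \<in> U (Suc p)" "u - t - D (Suc p) y \<in> K p"
    using ex(1) t unfolding rel_exact_def by blast
  have "x - D (Suc p) y = (u - t - D (Suc p) y) + (t + v)"
    using uv by simp
  moreover have "t + v \<in> V p" using V t uv by (blast intro: subcomplex_add)
  ultimately have "x - D (Suc p) y \<in> plus_family K V p"
    using y(2) unfolding plus_family_def by blast
  moreover have "y \<in> plus_family U V (Suc p)"
    using y subcomplex_0[OF V] by (force simp: plus_family_def)
  ultimately show "\<exists>y\<in>plus_family U V (Suc p). x - D (Suc p) y \<in> plus_family K V p"
    by blast
qed

lemma plus_family_least:
  assumes "subcomplex C" "\<And>p. A p \<subseteq> C p" "\<And>p. B p \<subseteq> C p"
  shows "plus_family A B p \<subseteq> C p"
  using assms by (force simp: plus_family_def intro: subcomplex_add)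

lemma subcomplex_plus_family:
  assumes A: "subcomplex A" and B: "subcomplex B"
  shows "subcomplex (plus_family A B)"
  unfolding subcomplex_def
proof (intro allI conjI ballI)
  fix p
  show "0 \<in> plus_family A B p"
    using subcomplex_0[OF A] subcomplex_0[OF B] by (force simp: plus_family_def)
  fix x assume "x \<in> plus_family A B p"
  then obtain a b where ab: "x = a + b" "a \<in> A p" "b \<in> B p" by (auto simp: plus_family_def)
  show "x - y \<in> plus_family A B p" if "y \<in> plus_family A B p" for y
  proof -
    obtain a' b' where "y = a' + b'" "a' \<in> A p" "b' \<in> B p"
      using \<open>y \<in> plus_family A B p\<close> by (auto simp: plus_family_def)
    then have "x - y = (a - a') + (b - b')" "a - a' \<in> A p" "b - b' \<in> B p"
      using ab A B by (auto intro: subcomplex_diff)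
    then show ?thesis by (auto simp: plus_family_def)
  qed
  show "D p x \<in> plus_family A B (p - 1)"
    using subcomplex_D[OF A ab(2)] subcomplex_D[OF B ab(3)]
    unfolding ab(1) plus_family_def D_add by blast
  show "D (p - 1) (D p x) = 0"
    using ab A B unfolding subcomplex_def by (simp add: D_add)
qed

end

section \<open>Mapping cones\<close>

text \<open>
  In a cone chain of degree \<open>p\<close> the second component has degree \<open>p - 1\<close>; it is \<open>0\<close> if \<open>p = 0\<close>.
  Exactness of the cone says that \<open>\<phi>\<close> is a quasi-isomorphism.
\<close>

definition cone_boundary ::
    "(nat \<Rightarrow> 'c::ab_group_add \<Rightarrow> 'c) \<Rightarrow> (nat \<Rightarrow> 'd::ab_group_add \<Rightarrow> 'd) \<Rightarrow> (nat \<Rightarrow> 'd \<Rightarrow> 'c) \<Rightarrow>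
      nat \<Rightarrow> 'c \<times> 'd \<Rightarrow> 'c \<times> 'd" where
  "cone_boundary D E \<phi> p zc =
     (if p = 0 then 0 else (D p (fst zc) - \<phi> (p - 1) (snd zc), - E (p - 1) (snd zc)))"

definition cone_family ::
    "(nat \<Rightarrow> 'c set) \<Rightarrow> (nat \<Rightarrow> 'd::zero set) \<Rightarrow> nat \<Rightarrow> ('c \<times> 'd) set" where
  "cone_family S C p = S p \<times> (case p of 0 \<Rightarrow> {0} | Suc q \<Rightarrow> C q)"

locale mapping_cone =
  D: graded_differential D + E: graded_differential E
  for D :: "nat \<Rightarrow> 'c::ab_group_add \<Rightarrow> 'c" and E :: "nat \<Rightarrow> 'd::ab_group_add \<Rightarrow> 'd" +
  fixes \<phi> :: "nat \<Rightarrow> 'd \<Rightarrow> 'c"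
  assumes \<phi>_diff: "\<phi> p (c - d) = \<phi> p c - \<phi> p d"
begin

abbreviation "\<Delta> \<equiv> cone_boundary D E \<phi>"

lemma \<phi>_0 [simp]: "\<phi> p 0 = 0"
  using \<phi>_diff[of p 0 0] by simp

lemma \<phi>_minus: "\<phi> p (- c) = - \<phi> p c"
  using \<phi>_diff[of p 0 c] by simp

lemma \<phi>_add: "\<phi> p (c + d) = \<phi> p c + \<phi> p d"
  using \<phi>_diff[of p c "- d"] by (simp add: \<phi>_minus)

sublocale cone: graded_differential \<Delta>
  by unfold_locales
    (auto simp: cone_boundary_def D.D_diff E.D_diff \<phi>_diff algebra_simps zero_prod_def)

lemma cone_boundary_Suc: "\<Delta> (Suc p) (z, c) = (D (Suc p) z - \<phi> p c, - E p c)"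
  by (simp add: cone_boundary_def)

definition maps_to :: "(nat \<Rightarrow> 'd set) \<Rightarrow> (nat \<Rightarrow> 'c set) \<Rightarrow> bool" where
  "maps_to C S \<longleftrightarrow> (\<forall>p. \<forall>c\<in>C p. \<phi> p c \<in> S p \<and> D p (\<phi> p c) = \<phi> (p - 1) (E p c))"

lemma cone_subcomplex:
  assumes S: "D.subcomplex S" and C: "E.subcomplex C" and "maps_to C S"
  shows "cone.subcomplex (cone_family S C)"
  unfolding cone.subcomplex_def
proof (intro allI conjI ballI)
  fix p
  show "0 \<in> cone_family S C p"
    using S C by (auto simp: cone_family_def zero_prod_def D.subcomplex_0 E.subcomplex_0 split: nat.splits)
  show "x - y \<in> cone_family S C p" if "x \<in> cone_family S C p" "y \<in> cone_family S C p" for x y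
    using S C that by (cases x, cases y)
      (auto simp: cone_family_def intro: D.subcomplex_diff E.subcomplex_diff split: nat.splits)
  fix x assume x: "x \<in> cone_family S C p"
  obtain z c where zc: "x = (z, c)" by force
  have "\<Delta> p x \<in> cone_family S C (p - 1) \<and> \<Delta> (p - 1) (\<Delta> p x) = 0"
  proof (cases p)
    case 0
    then show ?thesis
      using \<open>0 \<in> cone_family S C p\<close> by (simp add: cone_boundary_def)
  next
    case (Suc q)
    have zS: "z \<in> S (Suc q)" and cC: "c \<in> C q"
      using x zc Suc by (auto simp: cone_family_def)
    have \<phi>: "\<phi> q c \<in> S q" "D q (\<phi> q c) = \<phi> (q - 1) (E q c)"
      using assms(3) cC unfolding maps_to_def by auto
    have 1: "D (Suc q) z - \<phi> q c \<in> S q"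
      using S zS \<phi> by (intro D.subcomplex_diff D.subcomplex_D_Suc) auto
    have 2: "- E q c \<in> (case q of 0 \<Rightarrow> {0} | Suc q \<Rightarrow> C q)"
      using C cC by (auto simp: E.D_degree_0 intro: E.subcomplex_minus E.subcomplex_D_Suc split: nat.splits)
    have 3: "\<Delta> q (\<Delta> (Suc q) (z, c)) = 0"
    proof (cases q)
      case (Suc s)
      have "D q (D (Suc q) z) = 0" using S zS D.subcomplex_DD by blast
      moreover have "E s (E (Suc s) c) = 0" using C cC E.subcomplex_DD Suc by blast
      ultimately show ?thesis
        using \<phi> Suc by (simp add: cone_boundary_def D.D_diff E.D_minus \<phi>_minus zero_prod_def)
    qed (simp add: cone_boundary_def)
    show ?thesis
      using 1 2 3 zc Suc by (simp add: cone_boundary_Suc cone_family_def)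
  qed
  then show "\<Delta> p x \<in> cone_family S C (p - 1)" "\<Delta> (p - 1) (\<Delta> p x) = 0" by auto
qed

text \<open>The quotient cone is an extension of the shifted C/C' by S/S', so the second component
  is corrected before the first.\<close>

lemma cone_rel_exact:
  assumes S: "D.subcomplex S" and C: "E.subcomplex C" and \<phi>: "maps_to C S"
    and S': "D.subcomplex S'" and C': "E.subcomplex C'" and \<phi>': "maps_to C' S'"
    and "D.rel_exact S S'" "E.rel_exact C C'"
  shows "cone.rel_exact (cone_family S C) (cone_family S' C')"
  unfolding cone.rel_exact_def
proof (intro allI ballI impI)
  fix p x assume x: "x \<in> cone_family S C p" "\<Delta> p x \<in> cone_family S' C' (p - 1)"
  obtain z c where zc: "x = (z, c)" by force
  show "\<exists>y\<in>cone_family S C (Suc p). x - \<Delta> (Suc p) y \<in> cone_family S' C' p"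
  proof (cases p)
    case 0
    have z: "z \<in> S 0" "c = 0" using x zc 0 by (auto simp: cone_family_def)
    then obtain w where w: "w \<in> S (Suc 0)" "z - D (Suc 0) w \<in> S' 0"
      using assms(7) D.subcomplex_0[OF S', of 0] unfolding D.rel_exact_def
      by (metis D.D_degree_0 diff_0_eq_0)
    show ?thesis
      using w z zc 0 C by (intro bexI[of _ "(w, 0)"])
        (auto simp: cone_family_def cone_boundary_Suc E.subcomplex_0)
  next
    case (Suc q)
    have z: "z \<in> S (Suc q)" and c: "c \<in> C q"
      using x zc Suc by (auto simp: cone_family_def)
    have bd: "D (Suc q) z - \<phi> q c \<in> S' q"
      and bc: "E q c \<in> C' (q - 1)"
      using x zc Suc C' E.subcomplex_minus[OF C', of "- E q c"] E.subcomplex_0[OF C', of 0]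
      by (auto simp: cone_family_def cone_boundary_Suc split: nat.splits)
    obtain c' where c': "c' \<in> C (Suc q)" "c - E (Suc q) c' \<in> C' q"
      using assms(8) c bc unfolding E.rel_exact_def by blast
    define c'' where "c'' = c - E (Suc q) c'"
    have "D (Suc q) (\<phi> (Suc q) c') = \<phi> q (E (Suc q) c')" "\<phi> (Suc q) c' \<in> S (Suc q)"
      using \<phi> c' unfolding maps_to_def by fastforce+
    moreover have "\<phi> q c'' \<in> S' q"
      using \<phi>' c' unfolding maps_to_def c''_def by blast
    ultimately have "D (Suc q) (z - \<phi> (Suc q) c') \<in> S' q" "z - \<phi> (Suc q) c' \<in> S (Suc q)"
      using D.subcomplex_add[OF S' bd, of "\<phi> q c''"] z S
      by (auto simp: D.D_diff c''_def \<phi>_diff intro: D.subcomplex_diff)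
    then obtain w where w: "w \<in> S (Suc (Suc q))"
        "z - \<phi> (Suc q) c' - D (Suc (Suc q)) w \<in> S' (Suc q)"
      using assms(7) unfolding D.rel_exact_def by (metis diff_Suc_1)
    \<comment> \<open>The minus sign on \<open>c'\<close> matches the one before \<open>E\<close> in
      the cone boundary.\<close>
    show ?thesis
      using w c' zc Suc C by (intro bexI[of _ "(w, - c')"])
        (auto simp: cone_family_def cone_boundary_Suc E.D_minus \<phi>_minus algebra_simps
          intro: E.subcomplex_minus)
  qed
qed

end

lemma cone_family_plus:
  "cone_family (plus_family S S') (plus_family C C') =
     plus_family (cone_family S C) (cone_family S' C')"
  by (rule ext) (force simp: cone_family_def plus_family_def split: nat.splits)

lemma cone_family_inter:
  "cone_family (inter_family S S') (inter_family C C') =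
     inter_family (cone_family S C) (cone_family S' C')"
  by (rule ext) (auto simp: cone_family_def inter_family_def split: nat.splits)

section \<open>Singular chains on subsets of the realization\<close>

interpretation sing: graded_differential "chain_boundary :: nat \<Rightarrow> 'a chain \<Rightarrow> 'a chain"
  by unfold_locales (auto simp: chain_boundary_diff, simp add: chain_boundary_def)

text \<open>All subsets of the function space share one chain type, so chains on different subspaces
  can be added and intersected.\<close>

definition sing :: "('a \<Rightarrow> real) set \<Rightarrow> nat \<Rightarrow> ('a \<Rightarrow> real) chain set" where
  "sing U p = {c. singular_chain p (subtopology (powertop_real UNIV) U) c}"

lemma sing_subcomplex: "sing.subcomplex (sing U)"
  unfolding sing.subcomplex_def sing_def
  by (auto simp: singular_chain_diff dest: singular_chain_boundary chain_boundary_boundary)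

lemma sing_mono: "U \<subseteq> V \<Longrightarrow> sing U p \<subseteq> sing V p"
  unfolding sing_def by (auto intro: singular_chain_mono)

lemma sing_inter: "inter_family (sing U) (sing V) = sing (U \<inter> V)"
  by (rule ext) (auto simp: inter_family_def sing_def singular_chain_subtopology image_subset_iff)

text \<open>The homotopy keeps \<open>A\<close> inside \<open>A\<close>, so up to a boundary and a
  chain in \<open>A\<close> it moves a relative cycle to its image under \<open>g\<close>, and that
  image lies in \<open>A\<close>.\<close>

lemma sing_rel_exact_deformation:
  fixes U A :: "('a \<Rightarrow> real) set"
  defines "X \<equiv> powertop_real (UNIV :: 'a set)"
  assumes hom: "homotopic_with (\<lambda>h. h \<in> A \<rightarrow> A) (subtopology X U) (subtopology X U) id g"
    and g: "g \<in> U \<rightarrow> A" and "A \<subseteq> U"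
  shows "sing.rel_exact (sing U) (sing A)"
  unfolding sing.rel_exact_def
proof (intro allI ballI impI)
  fix p x assume x: "x \<in> sing U p" "chain_boundary p x \<in> sing A (p - 1)"
  have sub: "subtopology (subtopology X U) A = subtopology X A"
    using \<open>A \<subseteq> U\<close> by (simp add: subtopology_subtopology inf.absorb2)
  have xU: "singular_chain p (subtopology X U) x"
    using x by (simp add: sing_def X_def)
  have "singular_relcycle p (subtopology X U) A x"
    using x by (simp add: singular_relcycle sub sing_def flip: X_def)
  then have "homologous_rel p (subtopology X U) A (chain_map p id x) (chain_map p g x)"
    by (rule homotopic_imp_homologous_rel_chain_maps[OF hom])
  then obtain d e where d: "singular_chain (Suc p) (subtopology X U) d"
      and e: "singular_chain p (subtopology X A) e"
      and eq: "chain_boundary (Suc p) d + e = x - chain_map p g x"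
    unfolding homologous_rel_def singular_relboundary sub
    using chain_map_ident[OF xU] by auto
  have "continuous_map (subtopology X U) (subtopology X U) g"
    using hom homotopic_with_imp_continuous_maps by blast
  then have "continuous_map (subtopology X U) (subtopology X A) g"
    using g by (auto simp: continuous_map_in_subtopology X_def)
  then have "singular_chain p (subtopology X A) (chain_map p g x)"
    using xU singular_chain_chain_map by blast
  then have "singular_chain p (subtopology X A) (e + chain_map p g x)"
    using e singular_chain_add by blast
  moreover have "x - chain_boundary (Suc p) d = e + chain_map p g x"
    using eq by (simp add: algebra_simps)
  ultimately show "\<exists>y\<in>sing U (Suc p). x - chain_boundary (Suc p) y \<in> sing A p"
    using d by (auto simp: sing_def X_def)
qed

section \<open>Geometric realizations\<close>

definition simplicial_complex :: "'a set set \<Rightarrow> bool" where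
  "simplicial_complex K \<longleftrightarrow> finite K \<and> (\<forall>s\<in>K. finite s \<and> Pow s \<subseteq> K)"

definition realization_points :: "'a set set \<Rightarrow> ('a \<Rightarrow> real) set" where
  "realization_points K =
     {f. (\<forall>v. 0 \<le> f v) \<and> {v. f v \<noteq> 0} \<in> K \<and> (\<Sum>v | f v \<noteq> 0. f v) = 1}"

lemma geometric_realization_eq:
  "geometric_realization K = subtopology (powertop_real UNIV) (realization_points K)"
  by (simp add: geometric_realization_def realization_points_def)

lemma simplicial_complex_vertices:
  assumes "simplicial_complex K"
  shows "finite (\<Union>K)"
  using assms by (auto simp: simplicial_complex_def)

text \<open>Summing over the fixed vertex set instead of the support makes the normalisation linear
  in \<open>f\<close>, which suits the straight-line homotopies.\<close>

lemma realization_points_alt: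
  assumes "simplicial_complex K"
  shows "f \<in> realization_points K \<longleftrightarrow>
     (\<forall>v. 0 \<le> f v) \<and> {v. f v \<noteq> 0} \<in> K \<and> (\<Sum>v\<in>\<Union>K. f v) = 1"
proof -
  have "(\<Sum>v | f v \<noteq> 0. f v) = (\<Sum>v\<in>\<Union>K. f v)" if "{v. f v \<noteq> 0} \<in> K"
    using that by (intro sum.mono_neutral_left simplicial_complex_vertices assms) auto
  then show ?thesis by (auto simp: realization_points_def)
qed

lemma realization_points_mono: "K \<subseteq> L \<Longrightarrow> realization_points K \<subseteq> realization_points L"
  by (auto simp: realization_points_def)

lemma realization_points_barycenter:
  assumes "finite s" "s \<noteq> {}"
  obtains x where "{v. x v \<noteq> 0} = s" "\<And>K. s \<in> K \<Longrightarrow> x \<in> realization_points K"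
proof -
  define x :: "'a \<Rightarrow> real" where "x v = (if v \<in> s then 1 / card s else 0)" for v
  have card: "card s > 0" using assms by (simp add: card_gt_0_iff)
  have supp: "{v. x v \<noteq> 0} = s" using card by (auto simp: x_def)
  have "sum x s = 1" using card by (simp add: x_def)
  then have "x \<in> realization_points K" if "s \<in> K" for K
    using that unfolding realization_points_def mem_Collect_eq supp by (simp add: x_def)
  then show ?thesis using that supp by blast
qed

lemma realization_points_Int:
  "realization_points K \<inter> realization_points L = realization_points (K \<inter> L)"
  by (auto simp: realization_points_def)

lemma continuous_map_Min_real:
  assumes "finite I" "I \<noteq> {}" "\<And>i. i \<in> I \<Longrightarrow> continuous_map X euclideanreal (f i)"
  shows "continuous_map X euclideanreal (\<lambda>x. Min ((\<lambda>i. f i x) ` I))"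
  using assms
proof (induction I rule: finite_ne_induct)
  case (insert i I)
  have "continuous_map X euclideanreal (\<lambda>x. min (f i x) (Min ((\<lambda>i. f i x) ` I)))"
    using insert by (intro continuous_map_real_min) auto
  then show ?case
    using insert.hyps by (simp add: image_image)
qed auto

lemma continuous_map_coordinate:
  "continuous_map (subtopology (powertop_real UNIV) U) euclideanreal (\<lambda>f. f v)"
  by (intro continuous_map_from_subtopology continuous_map_product_projection) auto

text \<open>
  With \<open>t f\<close> the largest \<open>t\<close> such that \<open>f - t x \<ge> 0\<close>, moving \<open>f\<close> along the ray from \<open>x\<close> until
  a coordinate in the support of \<open>x\<close> vanishes is a deformation retraction.
\<close>

lemma sing_rel_exact_punctured:
  assumes K: "simplicial_complex K" and x: "x \<in> realization_points K"
  defines "L \<equiv> {s \<in> K. \<not> {v. x v \<noteq> 0} \<subseteq> s}"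
  shows "sing.rel_exact (sing (realization_points K - {x})) (sing (realization_points L))"
proof -
  define X :: "('a \<Rightarrow> real) topology" where "X = powertop_real UNIV"
  define U where "U = realization_points K - {x}"
  define A where "A = realization_points L"
  define S where "S = {v. x v \<noteq> 0}"
  define t where "t f = Min ((\<lambda>v. f v / x v) ` S)" for f :: "'a \<Rightarrow> real"
  \<comment> \<open>The division by \<open>1 - s * t f\<close> restores the coordinate sum
    1.\<close>
  define h where "h = (\<lambda>(s, f) v. (f v - s * t f * x v) / (1 - s * t f))"
  have "S \<in> K" "sum x S = 1"
    using x by (auto simp: S_def realization_points_def)
  then have S: "finite S" "S \<noteq> {}" "S \<in> K"
    using K by (auto simp: simplicial_complex_def)
  have xpos: "x v > 0" if "v \<in> S" for v
    using x that by (auto simp: S_def realization_points_def less_le)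
  have xK: "(\<Sum>v\<in>\<Union>K. x v) = 1"
    using x realization_points_alt[OF K] by blast
  have t_le: "t f * x v \<le> f v" if f: "f \<in> realization_points K" for f v
  proof (cases "v \<in> S")
    case True
    then have "t f \<le> f v / x v" using S unfolding t_def by (intro Min_le) auto
    then show ?thesis using xpos[OF True] by (simp add: pos_le_divide_eq)
  next
    case False
    then show ?thesis using f by (simp add: S_def realization_points_def)
  qed
  have t_ex: "\<exists>v\<in>S. t f = f v / x v" for f
  proof -
    have "t f \<in> (\<lambda>v. f v / x v) ` S" unfolding t_def using S by (intro Min_in) auto
    then show ?thesis by (rule imageE) (rule bexI)
  qed
  have t_ge0: "t f \<ge> 0" if "f \<in> realization_points K" for f
    using t_ex[of f] that x by (auto simp: realization_points_def)
  \<comment> \<open>The vector \<open>f - t f x\<close> is nonnegative with sum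
    \<open>1 - t f\<close>; for \<open>t f = 1\<close> it vanishes, that is \<open>f = x\<close>,
    which is excluded.\<close>
  have t_less1: "t f < 1" if f: "f \<in> U" for f
  proof -
    have fK: "f \<in> realization_points K" "f \<noteq> x" using f by (auto simp: U_def)
    have sf: "(\<Sum>v\<in>\<Union>K. f v) = 1"
      using fK realization_points_alt[OF K] by blast
    have nn: "f v - t f * x v \<ge> 0" for v using t_le[OF fK(1), of v] by simp
    have sum: "(\<Sum>v\<in>\<Union>K. f v - t f * x v) = 1 - t f"
      using sf xK by (simp add: sum_subtractf flip: sum_distrib_left)
    have "t f \<le> 1"
      using sum sum_nonneg[of "\<Union>K" "\<lambda>v. f v - t f * x v"] nn by simp
    moreover have "t f \<noteq> 1"
    proof
      assume 1: "t f = 1"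
      have "f v = x v" for v
      proof (cases "v \<in> \<Union>K")
        case True
        then show ?thesis
          using sum nn sum_nonneg_eq_0_iff[of "\<Union>K" "\<lambda>v. f v - t f * x v"]
            simplicial_complex_vertices[OF K] 1 by auto
      next
        case False
        then have "v \<notin> {v. f v \<noteq> 0}" "v \<notin> {v. x v \<noteq> 0}"
          using fK x by (auto simp: realization_points_def)
        then show ?thesis by simp
      qed
      then show False using fK by auto
    qed
    ultimately show ?thesis by simp
  qed
  have den: "1 - s * t f > 0" if "0 \<le> s" "s \<le> 1" "f \<in> U" for s f
  proof -
    have "s * t f \<le> 1 * t f"
      using that t_ge0[of f] by (intro mult_right_mono) (auto simp: U_def)
    then show ?thesis using t_less1[OF that(3)] by simp
  qed
  have h_nonneg: "h (s, f) v \<ge> 0" if "0 \<le> s" "s \<le> 1" "f \<in> U" for s f v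
  proof -
    have "s * (t f * x v) \<le> 1 * (t f * x v)"
      using that t_ge0[of f] x by (intro mult_right_mono) (auto simp: U_def realization_points_def)
    also have "\<dots> \<le> f v" using that t_le by (simp add: U_def)
    finally show ?thesis using den[OF that] by (simp add: h_def mult.assoc)
  qed
  have h_supp: "{v. h (s, f) v \<noteq> 0} \<subseteq> {v. f v \<noteq> 0}" if "0 \<le> s" "s \<le> 1" "f \<in> U" for s f
  proof -
    have "h (s, f) v = 0" if "f v = 0" for v
    proof -
      have "t f * x v \<le> 0" using t_le[of f v] \<open>f \<in> U\<close> that by (simp add: U_def)
      moreover have "t f * x v \<ge> 0"
        using t_ge0[of f] x \<open>f \<in> U\<close> by (auto simp: U_def realization_points_def)
      ultimately have "t f * x v = 0" by linarith
      then show ?thesis using that by (simp add: h_def)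
    qed
    then show ?thesis by blast
  qed
  have h_K: "h (s, f) \<in> realization_points K" if "0 \<le> s" "s \<le> 1" "f \<in> U" for s f
  proof -
    have fK: "f \<in> realization_points K" using that by (auto simp: U_def)
    have sf: "(\<Sum>v\<in>\<Union>K. f v) = 1" "{v. f v \<noteq> 0} \<in> K"
      using fK realization_points_alt[OF K] by blast+
    have "(\<Sum>v\<in>\<Union>K. h (s, f) v) = (\<Sum>v\<in>\<Union>K. f v - s * t f * x v) / (1 - s * t f)"
      by (simp add: h_def sum_divide_distrib)
    also have "\<dots> = 1"
      using sf xK den[OF that] by (simp add: sum_subtractf flip: sum_distrib_left)
    finally have "(\<Sum>v\<in>\<Union>K. h (s, f) v) = 1" .
    moreover have "{v. h (s, f) v \<noteq> 0} \<in> K"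
      using h_supp[OF that] sf(2) K unfolding simplicial_complex_def by blast
    ultimately show ?thesis
      using h_nonneg[OF that] realization_points_alt[OF K] by blast
  qed
  \<comment> \<open>Solving \<open>h (s, f) = x\<close> for \<open>f\<close> gives
    \<open>f = x\<close>: the ray never returns to \<open>x\<close>.\<close>
  have h_neq: "h (s, f) \<noteq> x" if "0 \<le> s" "s \<le> 1" "f \<in> U" for s f
  proof
    assume "h (s, f) = x"
    then have "f v = x v" for v
      using den[OF that] by (auto simp: h_def fun_eq_iff field_simps split: if_splits)
    then show False using that by (auto simp: U_def)
  qed
  have h_U: "h (s, f) \<in> U" if "0 \<le> s" "s \<le> 1" "f \<in> U" for s f
    using h_K[OF that] h_neq[OF that] by (simp add: U_def)
  \<comment> \<open>The minimum defining \<open>t f\<close> is attained at some \<open>v\<close>,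
    and this coordinate has become zero at time 1.\<close>
  have h_1: "h (1, f) \<in> A" if f: "f \<in> U" for f
  proof -
    obtain v where v: "v \<in> S" "t f = f v / x v" using t_ex by blast
    have "h (1, f) v = 0" using v xpos[OF v(1)] by (simp add: h_def)
    moreover have "h (1, f) \<in> realization_points K" using h_K f by simp
    ultimately show ?thesis
      using v by (auto simp: A_def L_def realization_points_def S_def)
  qed
  have A_U: "A \<subseteq> U"
    by (auto simp: A_def U_def L_def realization_points_def)
  \<comment> \<open>On \<open>A\<close> a coordinate in the support of \<open>x\<close> already
    vanishes, so \<open>t f = 0\<close> and nothing moves.\<close>
  have h_A: "h (s, f) = f" if f: "f \<in> A" for s f
  proof -
    obtain v where v: "v \<in> S" "f v = 0"
      using f by (auto simp: A_def L_def realization_points_def S_def)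
    have "t f \<le> f v / x v" using S v unfolding t_def by (intro Min_le) auto
    moreover have "t f \<ge> 0" using f A_U by (intro t_ge0) (auto simp: U_def)
    ultimately have "t f = 0" using v by simp
    then show ?thesis by (simp add: h_def)
  qed
  have cont_t: "continuous_map (prod_topology (top_of_set {0..1::real}) (subtopology X U)) euclideanreal (\<lambda>z. t (snd z))"
  proof -
    have "continuous_map (subtopology X U) euclideanreal t"
      unfolding t_def[abs_def] X_def
    proof (rule continuous_map_Min_real)
      fix v assume "v \<in> S"
      then show "continuous_map (subtopology (powertop_real UNIV) U) euclideanreal (\<lambda>f. f v / x v)"
        by (intro continuous_map_real_divide continuous_map_coordinate) (auto dest: xpos)
    qed (use S in auto)
    then show ?thesis
      using continuous_map_compose[OF continuous_map_snd, of "subtopology X U" euclideanreal t]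
      unfolding o_def by blast
  qed
  have "continuous_map (prod_topology (top_of_set {0..1::real}) (subtopology X U)) (subtopology X U) h"
    unfolding continuous_map_in_subtopology
  proof
    show "continuous_map (prod_topology (top_of_set {0..1::real}) (subtopology X U)) X h"
      unfolding X_def continuous_map_componentwise_UNIV
    proof
      fix v
      have 1: "continuous_map (prod_topology (top_of_set {0..1::real}) (subtopology X U)) euclideanreal (\<lambda>z. (snd z) v)"
        using continuous_map_compose[OF continuous_map_snd continuous_map_coordinate[of U v]]
        unfolding o_def X_def .
      have 2: "continuous_map (prod_topology (top_of_set {0..1::real}) (subtopology X U)) euclideanreal fst"
        using continuous_map_fst continuous_map_into_fulltopology by blast
      have "continuous_map (prod_topology (top_of_set {0..1::real}) (subtopology X U)) euclideanreal
          (\<lambda>z. ((snd z) v - fst z * t (snd z) * x v) / (1 - fst z * t (snd z)))"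
      proof (intro continuous_map_real_divide continuous_map_diff continuous_map_real_mult 1 2 cont_t)
        fix z assume "z \<in> topspace (prod_topology (top_of_set {0..1::real}) (subtopology X U))"
        then show "1 - fst z * t (snd z) \<noteq> 0"
          using den[of "fst z" "snd z"] by (auto simp: X_def)
      qed auto
      then show "continuous_map (prod_topology (top_of_set {0..1::real}) (subtopology (powertop_real UNIV) U)) euclideanreal (\<lambda>z. h z v)"
        by (simp add: h_def case_prod_unfold X_def)
    qed
    show "h \<in> topspace (prod_topology (top_of_set {0..1::real}) (subtopology X U)) \<rightarrow> U"
      using h_U by (auto simp: X_def)
  qed
  then have "homotopic_with (\<lambda>h. h \<in> A \<rightarrow> A) (subtopology X U) (subtopology X U) id (\<lambda>f. h (1, f))"
    unfolding homotopic_with_def using h_A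
    by (intro exI[of _ h]) (auto simp: h_def)
  then show ?thesis
    unfolding A_def[symmetric] U_def[symmetric] X_def
    by (rule sing_rel_exact_deformation) (use h_1 A_U in auto)
qed

lemma realization_points_vertex:
  "realization_points (Pow {v}) = {\<lambda>w. if w = v then 1 else 0}"
proof -
  have sc: "simplicial_complex (Pow {v})"
    by (auto simp: simplicial_complex_def finite_subset)
  have "f = (\<lambda>w. if w = v then 1 else 0)" if f: "f \<in> realization_points (Pow {v})" for f
  proof
    fix w
    have "f v = 1"
      using f realization_points_alt[OF sc] by auto
    moreover have "f w = 0" if "w \<noteq> v"
      using f that by (auto simp: realization_points_def)
    ultimately show "f w = (if w = v then 1 else 0)" by simp
  qed
  moreover have "(\<lambda>w. if w = v then 1 else 0) \<in> realization_points (Pow {v})"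
    using realization_points_alt[OF sc] by auto
  ultimately show ?thesis by blast
qed

text \<open>Straight-line contraction of the simplex onto its vertex \<open>v\<close>.\<close>

lemma sing_rel_exact_vertex:
  assumes s: "finite s" "v \<in> s"
  shows "sing.rel_exact (sing (realization_points (Pow s))) (sing (realization_points (Pow {v})))"
proof -
  define X :: "('a \<Rightarrow> real) topology" where "X = powertop_real UNIV"
  define U where "U = realization_points (Pow s)"
  define A where "A = realization_points (Pow {v})"
  define e :: "'a \<Rightarrow> real" where "e = (\<lambda>w. if w = v then 1 else 0)"
  define h where "h = (\<lambda>(r, f) w. (1 - r) * f w + r * e w)"
  have cs: "simplicial_complex (Pow s)"
    using s by (auto simp: simplicial_complex_def finite_subset)
  have A: "A = {e}"
    by (simp add: A_def e_def realization_points_vertex)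
  have eU: "e \<in> U" using A realization_points_mono[of "Pow {v}" "Pow s"] s
    unfolding A_def U_def by auto
  have hU: "h (r, f) \<in> U" if "0 \<le> r" "r \<le> 1" "f \<in> U" for r f
  proof -
    have f: "\<And>w. 0 \<le> f w" "{w. f w \<noteq> 0} \<subseteq> s" "sum f s = 1"
      using that realization_points_alt[OF cs] by (auto simp: U_def)
    have e: "\<And>w. 0 \<le> e w" "{w. e w \<noteq> 0} \<subseteq> s" "sum e s = 1"
      using eU realization_points_alt[OF cs] by (auto simp: U_def)
    have "sum (h (r, f)) s = 1"
      using f e by (simp add: h_def sum.distrib flip: sum_distrib_left)
    moreover have "{w. h (r, f) w \<noteq> 0} \<subseteq> s"
    proof -
      have "h (r, f) w = 0" if "w \<notin> s" for w
      proof -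
        have "f w = 0" "e w = 0" using that f(2) e(2) by blast+
        then show ?thesis by (simp add: h_def)
      qed
      then show ?thesis by blast
    qed
    moreover have "0 \<le> h (r, f) w" for w
      using f(1) e(1) that by (simp add: h_def)
    ultimately show ?thesis
      using realization_points_alt[OF cs] by (simp add: U_def)
  qed
  have "continuous_map (prod_topology (top_of_set {0..1::real}) (subtopology X U)) (subtopology X U) h"
    unfolding continuous_map_in_subtopology
  proof
    show "continuous_map (prod_topology (top_of_set {0..1::real}) (subtopology X U)) X h"
      unfolding X_def continuous_map_componentwise_UNIV
    proof
      fix w
      have 1: "continuous_map (prod_topology (top_of_set {0..1::real}) (subtopology X U)) euclideanreal (\<lambda>z. (snd z) w)"
        using continuous_map_compose[OF continuous_map_snd continuous_map_coordinate[of U w]]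
        unfolding o_def X_def .
      have 2: "continuous_map (prod_topology (top_of_set {0..1::real}) (subtopology X U)) euclideanreal fst"
        using continuous_map_fst continuous_map_into_fulltopology by blast
      have "continuous_map (prod_topology (top_of_set {0..1::real}) (subtopology X U)) euclideanreal
          (\<lambda>z. (1 - fst z) * (snd z) w + fst z * e w)"
        by (intro continuous_map_add continuous_map_diff continuous_map_real_mult 1 2) auto
      then show "continuous_map (prod_topology (top_of_set {0..1::real}) (subtopology (powertop_real UNIV) U)) euclideanreal (\<lambda>z. h z w)"
        by (simp add: h_def case_prod_unfold X_def)
    qed
    show "h \<in> topspace (prod_topology (top_of_set {0..1::real}) (subtopology X U)) \<rightarrow> U"
      using hU by (auto simp: X_def)
  qed
  then have "homotopic_with (\<lambda>h. h \<in> A \<rightarrow> A) (subtopology X U) (subtopology X U) id (\<lambda>f. h (1, f))"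
    unfolding homotopic_with_def A
    by (intro exI[of _ h]) (auto simp: h_def algebra_simps)
  then show ?thesis
    unfolding A_def[symmetric] U_def[symmetric] X_def
    by (rule sing_rel_exact_deformation) (use eU in \<open>auto simp: A h_def\<close>)
qed

text \<open>Missing a vertex of \<open>S\<close> means that a coordinate in \<open>S\<close>
  vanishes, so the set is a finite union of zero sets of coordinates.\<close>

lemma closedin_realization_avoiding:
  assumes "finite S"
  shows "closedin (subtopology (powertop_real UNIV) (realization_points K))
           (realization_points {s \<in> K. \<not> S \<subseteq> s})"
proof -
  let ?X = "subtopology (powertop_real UNIV) (realization_points K)"
  have "closedin ?X {f \<in> topspace ?X. f v \<in> {0}}" for v
    by (rule closedin_continuous_map_preimage[OF continuous_map_coordinate]) auto
  then have "closedin ?X (\<Union>v\<in>S. {f \<in> topspace ?X. f v \<in> {0}})"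
    using assms by (intro closedin_Union) auto
  also have "(\<Union>v\<in>S. {f \<in> topspace ?X. f v \<in> {0}}) = realization_points {s \<in> K. \<not> S \<subseteq> s}"
    by (auto simp: realization_points_def)
  finally show ?thesis .
qed

section \<open>Formal sums\<close>

lemma frag_cmul_diff_distrib2: "frag_cmul k (c - d) = frag_cmul k c - frag_cmul k d"
  by (rule poly_mapping_eqI) (simp add: lookup_minus right_diff_distrib)

lemma lookup_frag_extend_inj:
  assumes "inj_on f A" "Poly_Mapping.keys c \<subseteq> A" "x \<in> A"
  shows "Poly_Mapping.lookup (frag_extend (frag_of \<circ> f) c) (f x) = Poly_Mapping.lookup c x"
  using assms(2)
proof (induction c rule: frag_induction)
  case (one y)
  then show ?case using assms(1,3) by (auto simp: inj_on_def)
qed (auto simp: frag_extend_diff lookup_minus)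

definition frag_filter :: "('a \<Rightarrow> bool) \<Rightarrow> ('a \<Rightarrow>\<^sub>0 int) \<Rightarrow> ('a \<Rightarrow>\<^sub>0 int)" where
  "frag_filter Q = frag_extend (\<lambda>x. if Q x then frag_of x else 0)"

lemma frag_filter_diff: "frag_filter Q (c - d) = frag_filter Q c - frag_filter Q d"
  by (simp add: frag_filter_def frag_extend_diff)

lemma frag_filter_0 [simp]: "frag_filter Q 0 = 0"
  by (simp add: frag_filter_def)

lemma frag_filter_cmul: "frag_filter Q (frag_cmul j c) = frag_cmul j (frag_filter Q c)"
  by (simp add: frag_filter_def frag_extend_cmul)

lemma frag_filter_of: "frag_filter Q (frag_of x) = (if Q x then frag_of x else 0)"
  by (simp add: frag_filter_def)

lemma frag_filter_sum: "finite I \<Longrightarrow> frag_filter Q (sum f I) = (\<Sum>i\<in>I. frag_filter Q (f i))"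
  by (simp add: frag_filter_def frag_extend_sum o_def)

lemma lookup_frag_filter:
  "Poly_Mapping.lookup (frag_filter Q c) x = (if Q x then Poly_Mapping.lookup c x else 0)"
proof -
  have "Poly_Mapping.keys c \<subseteq> UNIV" by simp
  then show ?thesis
    by (induction c rule: frag_induction)
      (auto simp: frag_filter_of frag_filter_diff lookup_minus)
qed

lemma keys_frag_filter: "Poly_Mapping.keys (frag_filter Q c) = {x \<in> Poly_Mapping.keys c. Q x}"
  by (auto simp: in_keys_iff lookup_frag_filter split: if_splits)

lemma keys_sum_cmul_frag_of:
  assumes "\<And>i. i \<in> I \<Longrightarrow> g i \<in> T"
  shows "Poly_Mapping.keys (\<Sum>i\<in>I. frag_cmul (k i) (frag_of (g i))) \<subseteq> T"
proof -
  have "Poly_Mapping.keys (frag_cmul (k i) (frag_of (g i))) \<subseteq> T" if "i \<in> I" for i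
    using assms[OF that] keys_cmul[of "k i" "frag_of (g i)"] by (auto simp: keys_frag_of)
  then show ?thesis using keys_sum[of "\<lambda>i. frag_cmul (k i) (frag_of (g i))" I] by blast
qed

section \<open>Ordered simplicial chains\<close>

text \<open>The degree is an argument and degree 0 is cut off, as for \<open>chain_boundary\<close>,
  so that \<open>realize\<close> becomes a chain map; there is no augmentation.\<close>

definition delete_boundary :: "nat \<Rightarrow> ('a list \<Rightarrow>\<^sub>0 int) \<Rightarrow> ('a list \<Rightarrow>\<^sub>0 int)" where
  "delete_boundary p c =
     (if p = 0 then 0
      else frag_extend (\<lambda>xs. \<Sum>i\<le>p. frag_cmul ((-1) ^ i) (frag_of (delete_nth i xs))) c)"

text \<open>Sorted lists enumerate each totally ordered simplex exactly once, so the resulting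
  chains are the oriented ones.\<close>

definition ordered_simplices :: "'a::order set set \<Rightarrow> nat \<Rightarrow> 'a list set" where
  "ordered_simplices K p = {xs. sorted_wrt (<) xs \<and> length xs = Suc p \<and> set xs \<in> K}"

definition simp :: "'a::order set set \<Rightarrow> nat \<Rightarrow> ('a list \<Rightarrow>\<^sub>0 int) set" where
  "simp K p = {c. Poly_Mapping.keys c \<subseteq> ordered_simplices K p}"

definition vertex_simplex :: "nat \<Rightarrow> 'a list \<Rightarrow> (nat \<Rightarrow> real) \<Rightarrow> 'a \<Rightarrow> real" where
  "vertex_simplex p xs = oriented_simplex p (\<lambda>j v. if xs ! j = v then 1 else 0)"

definition realize :: "nat \<Rightarrow> ('a list \<Rightarrow>\<^sub>0 int) \<Rightarrow> ('a \<Rightarrow> real) chain" where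
  "realize p = frag_extend (frag_of \<circ> vertex_simplex p)"

interpretation simp: graded_differential "delete_boundary :: nat \<Rightarrow> ('a list \<Rightarrow>\<^sub>0 int) \<Rightarrow> _"
  by unfold_locales (auto simp: delete_boundary_def frag_extend_diff)

interpretation cone: mapping_cone "chain_boundary :: nat \<Rightarrow> ('a \<Rightarrow> real) chain \<Rightarrow> _"
    "delete_boundary :: nat \<Rightarrow> ('a list \<Rightarrow>\<^sub>0 int) \<Rightarrow> _" realize
  by unfold_locales (auto simp: realize_def frag_extend_diff)

lemma length_delete_nth [simp]: "i < length xs \<Longrightarrow> length (delete_nth i xs) = length xs - 1"
  by (simp add: delete_nth_def)

lemma nth_delete_nth:
  "i < length xs \<Longrightarrow> j < length xs - 1 \<Longrightarrow> delete_nth i xs ! j = xs ! (if j < i then j else Suc j)"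
  by (auto simp: delete_nth_def nth_append min_def)

lemma set_delete_nth: "set (delete_nth i xs) \<subseteq> set xs"
  unfolding delete_nth_def using set_take_subset set_drop_subset by fastforce

lemma sorted_wrt_delete_nth:
  assumes "sorted_wrt R xs"
  shows "sorted_wrt R (delete_nth i xs)"
proof -
  have "sorted_wrt R (take i xs @ drop i xs)" using assms by simp
  then have "\<forall>x\<in>set (take i xs). \<forall>y\<in>set (drop (Suc i) xs). R x y"
    using set_drop_subset_set_drop[of i "Suc i" xs] unfolding sorted_wrt_append by force
  then show ?thesis
    using assms by (simp add: delete_nth_def sorted_wrt_append sorted_wrt_take sorted_wrt_drop)
qed

lemma ordered_simplices_delete_nth:
  assumes "simplicial_complex K" "xs \<in> ordered_simplices K (Suc p)" "i \<le> Suc p"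
  shows "delete_nth i xs \<in> ordered_simplices K p"
proof -
  have "set (delete_nth i xs) \<in> K"
    using assms set_delete_nth[of i xs] by (auto simp: ordered_simplices_def simplicial_complex_def)
  then show ?thesis
    using assms by (auto simp: ordered_simplices_def sorted_wrt_delete_nth)
qed

lemma simp_mono: "K \<subseteq> L \<Longrightarrow> simp K p \<subseteq> simp L p"
  by (auto simp: simp_def ordered_simplices_def)

lemma simp_inter: "inter_family (simp K) (simp L) = simp (K \<inter> L)"
  by (rule ext) (auto simp: inter_family_def simp_def ordered_simplices_def)

lemma delete_boundary_simp:
  assumes K: "simplicial_complex K" and c: "c \<in> simp K p"
  shows "delete_boundary p c \<in> simp K (p - 1)"
proof (cases p)
  case (Suc q)
  define F :: "'a list \<Rightarrow> 'a list \<Rightarrow>\<^sub>0 int"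
    where "F xs = (\<Sum>i\<le>p. frag_cmul ((-1) ^ i) (frag_of (delete_nth i xs)))" for xs
  have "Poly_Mapping.keys (F xs) \<subseteq> ordered_simplices K q" if "xs \<in> Poly_Mapping.keys c" for xs
    unfolding F_def
  proof (rule keys_sum_cmul_frag_of)
    fix i assume "i \<in> {..p}"
    then show "delete_nth i xs \<in> ordered_simplices K q"
      using c that Suc by (intro ordered_simplices_delete_nth[OF K]) (auto simp: simp_def)
  qed
  then have "Poly_Mapping.keys (frag_extend F c) \<subseteq> ordered_simplices K q"
    using keys_frag_extend[of F c] by (meson UN_least order_trans)
  moreover have "delete_boundary p c = frag_extend F c"
    using Suc by (simp add: delete_boundary_def F_def[abs_def])
  ultimately show ?thesis
    using Suc by (simp add: simp_def)
qed (simp add: delete_boundary_def simp_def)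

lemma singular_simplex_vertex_simplex:
  assumes K: "simplicial_complex K" and xs: "xs \<in> ordered_simplices K p"
  shows "singular_simplex p (subtopology (powertop_real UNIV) (realization_points K)) (vertex_simplex p xs)"
proof -
  let ?l = "\<lambda>j v. if xs ! j = v then 1 else (0::real)"
  have "(\<lambda>v. \<Sum>j\<le>p. ?l j v * t j) \<in> realization_points K" if t: "t \<in> standard_simplex p" for t
  proof -
    have t': "\<And>j. 0 \<le> t j" "(\<Sum>j\<le>p. t j) = 1"
      using t by (auto simp: standard_simplex_def)
    have sub: "set xs \<subseteq> \<Union>K" and len: "length xs = Suc p" and K': "set xs \<in> K"
      using xs by (auto simp: ordered_simplices_def)
    have "(\<Sum>v\<in>\<Union>K. \<Sum>j\<le>p. ?l j v * t j) = (\<Sum>j\<le>p. \<Sum>v\<in>\<Union>K. ?l j v * t j)"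
      by (rule sum.swap)
    also have "\<dots> = (\<Sum>j\<le>p. t j)"
    proof (rule sum.cong)
      fix j assume "j \<in> {..p}"
      then have "xs ! j \<in> set xs" using len by simp
      then have "xs ! j \<in> \<Union>K" using sub by blast
      moreover have "(\<Sum>v\<in>\<Union>K. ?l j v * t j) = (\<Sum>v\<in>\<Union>K. if xs ! j = v then t j else 0)"
        by (intro sum.cong) auto
      ultimately show "(\<Sum>v\<in>\<Union>K. ?l j v * t j) = t j"
        using simplicial_complex_vertices[OF K] by (simp add: sum.delta')
    qed simp
    finally have 1: "(\<Sum>v\<in>\<Union>K. \<Sum>j\<le>p. ?l j v * t j) = 1" using t' by simp
    have "v \<in> set xs" if "(\<Sum>j\<le>p. ?l j v * t j) \<noteq> 0" for v
    proof (rule ccontr)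
      assume "v \<notin> set xs"
      then have "(\<Sum>j\<le>p. ?l j v * t j) = 0"
        using len by (intro sum.neutral) (auto simp: le_imp_less_Suc)
      with that show False by simp
    qed
    then have "{v. (\<Sum>j\<le>p. ?l j v * t j) \<noteq> 0} \<in> Pow (set xs)" by blast
    moreover have "Pow (set xs) \<subseteq> K"
      using K K' by (simp add: simplicial_complex_def)
    ultimately have 2: "{v. (\<Sum>j\<le>p. ?l j v * t j) \<noteq> 0} \<in> K" by (rule rev_subsetD)
    have 3: "0 \<le> (\<Sum>j\<le>p. ?l j v * t j)" for v
      by (rule sum_nonneg) (simp add: t'(1))
    show ?thesis
      unfolding realization_points_alt[OF K] using 1 2 3 by (intro conjI allI)
  qed
  then show ?thesis
    unfolding vertex_simplex_def
    by (intro simplicial_imp_singular_simplex)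
      (simp only: simplicial_simplex_oriented_simplex image_subset_iff, blast)
qed

lemma singular_face_vertex_simplex:
  assumes "length xs = Suc (Suc p)" "i \<le> Suc p"
  shows "singular_face (Suc p) i (vertex_simplex (Suc p) xs) = vertex_simplex p (delete_nth i xs)"
  using assms unfolding vertex_simplex_def
  by (subst singular_face_oriented_simplex) (simp_all add: oriented_simplex_eq nth_delete_nth)

lemma vertex_simplex_inj:
  assumes "length xs = Suc p" "length ys = Suc p" "vertex_simplex p xs = vertex_simplex p ys"
  shows "xs = ys"
proof (rule nth_equalityI)
  fix i assume "i < length xs"
  then have "(\<lambda>v. if xs ! i = v then 1 else (0::real)) = (\<lambda>v. if ys ! i = v then 1 else 0)"
    using assms by (simp add: vertex_simplex_def oriented_simplex_eq)
  from fun_cong[OF this, of "xs ! i"] show "xs ! i = ys ! i" by (auto split: if_splits)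
qed (use assms in simp)

lemma realize_sing:
  assumes K: "simplicial_complex K" and c: "c \<in> simp K p"
  shows "realize p c \<in> sing (realization_points K) p"
  using c singular_simplex_vertex_simplex[OF K]
  unfolding sing_def realize_def simp_def
  by (auto intro!: singular_chain_extend simp: singular_chain_of)

lemma chain_boundary_realize:
  assumes K: "simplicial_complex K" and c: "c \<in> simp K p"
  shows "chain_boundary p (realize p c) = realize (p - 1) (delete_boundary p c)"
proof (cases p)
  case (Suc q)
  have "Poly_Mapping.keys c \<subseteq> ordered_simplices K p" using c by (simp add: simp_def)
  then show ?thesis
  proof (induction c rule: frag_induction)
    case (one xs)
    then have len: "length xs = Suc (Suc q)" by (simp add: ordered_simplices_def Suc)
    have "realize q (\<Sum>i\<le>Suc q. frag_cmul ((-1) ^ i) (frag_of (delete_nth i xs))) =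
        (\<Sum>i\<le>Suc q. frag_cmul ((-1) ^ i) (frag_of (vertex_simplex q (delete_nth i xs))))"
      unfolding realize_def by (subst frag_extend_sum) (simp_all add: frag_extend_cmul o_def)
    also have "\<dots> = (\<Sum>i\<le>Suc q. frag_cmul ((-1) ^ i) (frag_of (singular_face (Suc q) i (vertex_simplex (Suc q) xs))))"
      using len by (intro sum.cong) (auto simp: singular_face_vertex_simplex)
    finally show ?case
      by (simp add: Suc delete_boundary_def chain_boundary_of realize_def)
  qed (auto simp: cone.\<phi>_diff simp.D_diff sing.D_diff)
qed (simp add: delete_boundary_def chain_boundary_def)

text \<open>The vertices of an affine simplex, and with them the list, can be read off from the map,
  so distinct simplices have distinct realizations.\<close>

lemma realize_inj:
  assumes "c \<in> simp K p" "realize p c = 0"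
  shows "c = 0"
proof (rule poly_mapping_eqI)
  have keys: "Poly_Mapping.keys c \<subseteq> ordered_simplices K p" using assms by (simp add: simp_def)
  have inj: "inj_on (vertex_simplex p) (ordered_simplices K p)"
    by (rule inj_onI) (auto simp: ordered_simplices_def intro: vertex_simplex_inj)
  fix xs
  show "Poly_Mapping.lookup c xs = Poly_Mapping.lookup 0 xs"
  proof (cases "xs \<in> Poly_Mapping.keys c")
    case True
    then show ?thesis
      using lookup_frag_extend_inj[OF inj keys, of xs] keys assms(2) by (auto simp: realize_def)
  qed (simp add: in_keys_iff)
qed

text \<open>The realization is injective on chains, so it inherits \<open>\<partial>\<partial> = 0\<close> from singular chains.\<close>

lemma simp_subcomplex:
  assumes K: "simplicial_complex K"
  shows "simp.subcomplex (simp K)"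
  unfolding simp.subcomplex_def
proof (intro allI conjI ballI)
  fix p
  show "0 \<in> simp K p" by (simp add: simp_def)
  show "x - y \<in> simp K p" if "x \<in> simp K p" "y \<in> simp K p" for x y
    using that keys_diff[of x y] by (auto simp: simp_def)
  fix x assume x: "x \<in> simp K p"
  show bx: "delete_boundary p x \<in> simp K (p - 1)" by (rule delete_boundary_simp[OF K x])
  have "realize (p - 1 - 1) (delete_boundary (p - 1) (delete_boundary p x)) =
      chain_boundary (p - 1) (chain_boundary p (realize p x))"
    using chain_boundary_realize[OF K bx] chain_boundary_realize[OF K x] by simp
  also have "\<dots> = 0"
    using realize_sing[OF K x] chain_boundary_boundary unfolding sing_def by auto
  finally show "delete_boundary (p - 1) (delete_boundary p x) = 0"
    using realize_inj delete_boundary_simp[OF K bx] by blast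
qed

lemma realize_maps_to:
  "simplicial_complex K \<Longrightarrow> cone.maps_to (simp K) (sing (realization_points K))"
  by (simp add: cone.maps_to_def realize_sing chain_boundary_realize)

section \<open>Simplicial and singular chains are quasi-isomorphic\<close>

text \<open>Small simplices theorem for chains whose boundary is already small. An iterated
  subdivision of \<open>z\<close> splits, and the homotopy \<open>h\<close> from subdivision to the
  identity preserves chains on every subspace, so its error on the boundary splits as well.\<close>

lemma sing_rel_exact_cover:
  fixes W :: "('a \<Rightarrow> real) set"
  defines "X \<equiv> subtopology (powertop_real UNIV) W"
  assumes Z: "X closure_of Z \<subseteq> X interior_of T" and "T \<subseteq> W" and V: "W - Z \<subseteq> V"
  shows "sing.rel_exact (sing W) (plus_family (sing T) (sing V))"
  unfolding sing.rel_exact_def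
proof (intro allI ballI impI)
  fix p z assume z: "z \<in> sing W p" "chain_boundary p z \<in> plus_family (sing T) (sing V) (p - 1)"
  have sub: "subtopology X S = subtopology (powertop_real UNIV) S" if "S \<subseteq> W" for S
    using that by (simp add: X_def subtopology_subtopology inf.absorb2)
  have "singular_chain p (subtopology X W) z"
    using z(1) by (simp add: sub sing_def)
  then obtain n d e where d: "singular_chain p (subtopology X (W - Z)) d"
      and e: "singular_chain p (subtopology X T) e"
      and de: "(singular_subdivision p ^^ n) z = d + e"
    by (rule excised_chain_exists[OF Z \<open>T \<subseteq> W\<close>])
  obtain h where h0: "\<And>p. h p 0 = (0 :: ('a \<Rightarrow> real) chain)"
      and hdiff: "\<And>p c1 c2. h p (c1 - c2) = h p c1 - h p c2"
      and hc: "\<And>p X c. singular_chain p X c \<Longrightarrow> singular_chain (Suc p) X (h p c)"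
      and hb: "\<And>p X c. singular_chain p X c \<Longrightarrow>
         chain_boundary (Suc p) (h p c) + h (p - Suc 0) (chain_boundary p c) = (singular_subdivision p ^^ n) c - c"
    by (rule chain_homotopic_iterated_singular_subdivision[where n = n and ?'a = "'a \<Rightarrow> real"])
      (rule that, assumption+)
  have "d \<in> sing (W - Z) p" "e \<in> sing T p"
    using d e sub[of "W - Z"] sub[OF \<open>T \<subseteq> W\<close>] by (auto simp: sing_def)
  then have dV: "d \<in> sing V p" and eT: "e \<in> sing T p"
    using sing_mono[OF V] by blast+
  obtain u v where uv: "u \<in> sing T p" "v \<in> sing V p" "h (p - 1) (chain_boundary p z) = u + v"
  proof (cases p)
    case 0
    then show ?thesis
      using that[of 0 0] h0 by (simp add: chain_boundary_def sing_def)
  next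
    case (Suc q)
    \<comment> \<open>Written as a difference because \<open>h\<close> comes with a rule for
      differences.\<close>
    obtain u v where uv: "u \<in> sing T q" "v \<in> sing V q" "chain_boundary p z = u - (- v)"
      using z(2) Suc by (auto simp: plus_family_def)
    have "h q u \<in> sing T p"
      using hc[of q _ u] uv(1) Suc by (simp add: sing_def)
    moreover have "- h q (- v) \<in> sing V p"
      using hc[of q _ "- v"] uv(2) Suc by (simp add: sing_def singular_chain_minus)
    moreover have "h (p - 1) (chain_boundary p z) = h q u + (- h q (- v))"
    proof -
      have "h (p - 1) (chain_boundary p z) = h q (u - (- v))" using Suc uv(3) by simp
      also have "\<dots> = h q u - h q (- v)" by (rule hdiff)
      finally show ?thesis by simp
    qed
    ultimately show ?thesis by (rule that)
  qed
  have zW: "singular_chain p X z" using z(1) by (simp add: sing_def X_def)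
  have "- h p z \<in> sing W (Suc p)"
    using hc[OF zW] by (simp add: sing_def X_def singular_chain_minus)
  moreover have "z - chain_boundary (Suc p) (- h p z) = (e - u) + (d - v)"
  proof -
    have "chain_boundary (Suc p) (h p z) + (u + v) = d + e - z"
      using hb[OF zW] uv(3) de by simp
    then show ?thesis by (simp add: chain_boundary_minus algebra_simps)
  qed
  moreover have "(e - u) + (d - v) \<in> plus_family (sing T) (sing V) p"
    using sing.subcomplex_diff[OF sing_subcomplex eT uv(1)] sing.subcomplex_diff[OF sing_subcomplex dV uv(2)]
    unfolding plus_family_def by blast
  ultimately show "\<exists>y\<in>sing W (Suc p). z - chain_boundary (Suc p) y \<in> plus_family (sing T) (sing V) p"
    by metis
qed

text \<open>With \<open>x\<close> the barycenter of \<open>s\<close>, the punctured realization and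
  the closed simplex \<open>s\<close> form an excisive cover. The radial retractions then replace
  the punctured space by \<open>K - {s}\<close> and, on the intersection, the punctured simplex by
  its boundary.\<close>

lemma sing_rel_exact_facet:
  fixes K :: "'a set set"
  assumes K: "simplicial_complex K" and s: "s \<in> K" "s \<noteq> {}" "\<And>t. t \<in> K \<Longrightarrow> s \<subseteq> t \<Longrightarrow> t = s"
  shows "sing.rel_exact (sing (realization_points K))
    (plus_family (sing (realization_points (K - {s}))) (sing (realization_points (Pow s))))"
proof -
  define X :: "('a \<Rightarrow> real) topology" where "X = subtopology (powertop_real UNIV) (realization_points K)"
  have fin: "finite s"
    using K s by (simp add: simplicial_complex_def)
  obtain x where supp: "{v. x v \<noteq> 0} = s" and x: "\<And>L. s \<in> L \<Longrightarrow> x \<in> realization_points L"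
    by (rule realization_points_barycenter[OF fin s(2)]) (rule that, assumption, blast)
  have Ps: "simplicial_complex (Pow s)" using fin by (auto simp: simplicial_complex_def finite_subset)
  have PK: "Pow s \<subseteq> K" using K s by (auto simp: simplicial_complex_def)
  have avoid: "{t \<in> K. \<not> s \<subseteq> t} = K - {s}" "{t \<in> Pow s. \<not> s \<subseteq> t} = (K - {s}) \<inter> Pow s"
    using s PK by auto
  have r1: "sing.rel_exact (sing (realization_points K - {x})) (sing (realization_points (K - {s})))"
    using sing_rel_exact_punctured[OF K x] s avoid by (simp add: supp)
  have r2: "sing.rel_exact (sing (realization_points (Pow s) - {x}))
      (sing (realization_points ((K - {s}) \<inter> Pow s)))"
    using sing_rel_exact_punctured[OF Ps x] avoid by (simp add: supp)
  have sub: "realization_points (K - {s}) \<subseteq> realization_points K - {x}"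
    using supp by (auto simp: realization_points_def)
  have sub': "realization_points (Pow s) \<subseteq> realization_points K"
    using PK by (rule realization_points_mono)
  have ts: "topspace X = realization_points K" by (simp add: X_def)
  have hs: "Hausdorff_space X"
    unfolding X_def by (rule Hausdorff_space_subtopology) (simp add: Hausdorff_space_product_topology)
  have "openin X (realization_points K - {x})"
    using openin_diff[OF openin_topspace closedin_Hausdorff_singleton[OF hs]] x[OF s(1)] ts by simp
  moreover have "closedin X (realization_points (K - {s}))"
    using closedin_realization_avoiding[OF fin, of K] avoid by (simp add: X_def)
  ultimately have "X closure_of realization_points (K - {s}) \<subseteq> X interior_of (realization_points K - {x})"
    using sub by (simp add: closure_of_closedin interior_of_openin)
  \<comment> \<open>Excision of the realization of \<open>K - {s}\<close>: what remains lies in the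
    closed simplex \<open>s\<close>.\<close>
  then have 1: "sing.rel_exact (sing (realization_points K))
      (plus_family (sing (realization_points K - {x})) (sing (realization_points (Pow s))))"
    unfolding X_def using s(1) PK
    by (intro sing_rel_exact_cover) (auto simp: realization_points_def)
  have int: "(realization_points K - {x}) \<inter> realization_points (Pow s) = realization_points (Pow s) - {x}"
    using sub' by blast
  have 2: "sing.rel_exact (plus_family (sing (realization_points K - {x})) (sing (realization_points (Pow s))))
     (plus_family (sing (realization_points (K - {s}))) (sing (realization_points (Pow s))))"
    by (rule sing.rel_exact_plus_family)
      (simp_all add: sing_subcomplex sing_mono sub sing_inter int realization_points_Int r1 r2)
  have sub1: "plus_family (sing (realization_points (K - {s}))) (sing (realization_points (Pow s))) p
      \<subseteq> plus_family (sing (realization_points K - {x})) (sing (realization_points (Pow s))) p" for p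
    using sing_mono[OF sub, of p] unfolding plus_family_def by blast
  have sub2: "plus_family (sing (realization_points K - {x})) (sing (realization_points (Pow s))) p
      \<subseteq> sing (realization_points K) p" for p
    by (intro sing.plus_family_least sing_subcomplex sing_mono sub' Diff_subset)
  show ?thesis
    by (rule sing.rel_exact_trans[OF sing_subcomplex sub1 sub2 1 2])
qed

text \<open>Simplicial chains split without subdivision: each simplex lies in \<open>K - {s}\<close>
  or in \<open>Pow s\<close>, so the correcting chain is 0.\<close>

lemma simp_rel_exact_facet:
  assumes K: "simplicial_complex K" and s: "s \<in> K"
  shows "simp.rel_exact (simp K) (plus_family (simp (K - {s})) (simp (Pow s)))"
proof -
  have "c \<in> plus_family (simp (K - {s})) (simp (Pow s)) p" if "c \<in> simp K p" for c p
  proof -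
    have "Poly_Mapping.keys c \<subseteq> ordered_simplices (K - {s}) p \<union> ordered_simplices (Pow s) p"
      using that by (auto simp: simp_def ordered_simplices_def)
    then obtain d e where "Poly_Mapping.keys d \<subseteq> ordered_simplices (K - {s}) p"
        "Poly_Mapping.keys e \<subseteq> ordered_simplices (Pow s) p" "d + e = c"
      using frag_split by metis
    then show ?thesis by (auto simp: plus_family_def simp_def)
  qed
  then show ?thesis
    unfolding simp.rel_exact_def using simp.subcomplex_0[OF simp_subcomplex[OF K]]
    by (metis diff_zero simp.D_0)
qed

text \<open>The cone operator with apex \<open>v\<close>. Lists that already begin with
  \<open>v\<close> go to 0, since their cone would be degenerate.\<close>

definition cons_chain :: "'a \<Rightarrow> ('a list \<Rightarrow>\<^sub>0 int) \<Rightarrow> ('a list \<Rightarrow>\<^sub>0 int)" where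
  "cons_chain v = frag_extend (\<lambda>xs. if hd xs = v then 0 else frag_of (v # xs))"

lemma cons_chain_diff: "cons_chain v (a - b) = cons_chain v a - cons_chain v b"
  by (simp add: cons_chain_def frag_extend_diff)

lemma cons_chain_boundary_frag_of:
  "cons_chain v (delete_boundary (Suc q) (frag_of xs)) =
     (\<Sum>i\<le>Suc q. frag_cmul ((-1) ^ i)
        (if hd (delete_nth i xs) = v then 0 else frag_of (v # delete_nth i xs)))"
  unfolding cons_chain_def delete_boundary_def
  by (simp only: nat.simps if_False frag_extend_of frag_extend_sum[OF finite_atMost] o_def frag_extend_cmul)

text \<open>The usual rule for the boundary of a cone. For \<open>p = 0\<close> and a one-element
  \<open>xs\<close> the sum is the apex term \<open>[v]\<close>.\<close>

lemma delete_boundary_Cons: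
  "delete_boundary (Suc p) (frag_of (v # xs)) =
     frag_of xs - (\<Sum>i\<le>p. frag_cmul ((-1) ^ i) (frag_of (v # delete_nth i xs)))"
proof -
  have "delete_boundary (Suc p) (frag_of (v # xs)) =
      (\<Sum>i\<le>Suc p. frag_cmul ((-1) ^ i) (frag_of (delete_nth i (v # xs))))"
    by (simp only: delete_boundary_def nat.simps if_False frag_extend_of)
  also have "\<dots> = frag_of xs + (\<Sum>i\<le>p. frag_cmul ((-1) ^ Suc i) (frag_of (v # delete_nth i xs)))"
    by (simp only: sum.atMost_Suc_shift) (simp add: delete_nth_def)
  also have "(\<Sum>i\<le>p. frag_cmul ((-1) ^ Suc i) (frag_of (v # delete_nth i xs))) =
      - (\<Sum>i\<le>p. frag_cmul ((-1) ^ i) (frag_of (v # delete_nth i xs)))"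
    unfolding sum_negf[symmetric] by (intro sum.cong) auto
  finally show ?thesis by simp
qed

lemma cons_ordered_simplices:
  assumes v: "v \<in> s" "\<And>w. w \<in> s \<Longrightarrow> v \<le> w"
    and xs: "xs \<in> ordered_simplices (Pow s) p" "hd xs \<noteq> v"
  shows "v # xs \<in> ordered_simplices (Pow s) (Suc p)"
proof -
  have "length xs = Suc p" using xs by (simp add: ordered_simplices_def)
  then obtain y ys where ys: "xs = y # ys" by (metis length_Suc_conv)
  have "v < y" using xs v(2)[of y] ys by (auto simp: ordered_simplices_def)
  moreover have "y < z" if "z \<in> set ys" for z
    using xs ys that by (auto simp: ordered_simplices_def)
  ultimately have "\<forall>z\<in>set xs. v < z"
    unfolding ys by (auto intro: less_trans)
  then show ?thesis using xs v(1) by (auto simp: ordered_simplices_def)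
qed

lemma cons_chain_simp:
  assumes v: "v \<in> s" "\<And>w. w \<in> s \<Longrightarrow> v \<le> w" and c: "c \<in> simp (Pow s) p"
  shows "cons_chain v c \<in> simp (Pow s) (Suc p)"
proof -
  define G where "G xs = (if hd xs = v then 0 else frag_of (v # xs))" for xs
  have "Poly_Mapping.keys (G xs) \<subseteq> ordered_simplices (Pow s) (Suc p)"
    if "xs \<in> Poly_Mapping.keys c" for xs
  proof -
    have "xs \<in> ordered_simplices (Pow s) p" using c that by (auto simp: simp_def)
    then show ?thesis using cons_ordered_simplices[OF v, of xs p] by (simp add: G_def keys_frag_of)
  qed
  then have "Poly_Mapping.keys (frag_extend G c) \<subseteq> ordered_simplices (Pow s) (Suc p)"
    using keys_frag_extend[of G c] by (meson UN_least order_trans)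
  then show ?thesis by (simp add: simp_def cons_chain_def G_def[abs_def])
qed

text \<open>The cone operator contracts the simplex to its least vertex \<open>v\<close>; the error
  is supported on that vertex and comes from degree 0 alone.\<close>

lemma cons_chain_homotopy:
  assumes v: "v \<in> s" "\<And>w. w \<in> s \<Longrightarrow> v \<le> w" and c: "c \<in> simp (Pow s) p"
  shows "c - delete_boundary (Suc p) (cons_chain v c) - cons_chain v (delete_boundary p c)
     \<in> simp (Pow {v}) p"
proof -
  have sc: "simplicial_complex (Pow {v})"
    by (auto simp: simplicial_complex_def finite_subset)
  have "Poly_Mapping.keys c \<subseteq> ordered_simplices (Pow s) p" using c by (simp add: simp_def)
  then show ?thesis
  proof (induction c rule: frag_induction)
    case zero
    then show ?case by (simp add: cons_chain_def simp_def)
  next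
    case (one xs)
    have len: "length xs = Suc p" using one by (simp add: ordered_simplices_def)
    show ?case
    proof (cases p)
      case 0
      then obtain y where y: "xs = [y]" using len by (metis length_0_conv length_Suc_conv)
      have "delete_boundary (Suc 0) (frag_of [v, y]) = frag_of [y] - frag_of [v]"
        by (simp add: delete_boundary_Cons delete_nth_def)
      moreover have "frag_of [v] \<in> simp (Pow {v}) 0"
        by (simp add: ordered_simplices_def simp_def keys_frag_of)
      ultimately show ?thesis
        using 0 y by (auto simp: cons_chain_def simp.D_degree_0)
    next
      case (Suc q)
      show ?thesis
      proof (cases "hd xs = v")
        case True
        obtain y zs where xs: "xs = v # y # zs"
          using True len Suc by (metis length_Suc_conv list.sel(1))
        have "y \<noteq> v" using one xs by (auto simp: ordered_simplices_def)
        \<comment> \<open>Only the face deleting \<open>v\<close> survives, since every other face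
          still begins with \<open>v\<close>.\<close>
        have "(\<Sum>i\<le>q. frag_cmul ((-1) ^ Suc i) (if hd (delete_nth (Suc i) xs) = v then 0
            else frag_of (v # delete_nth (Suc i) xs))) = 0"
          by (rule sum.neutral) (simp add: xs delete_nth_def)
        then have "cons_chain v (delete_boundary p (frag_of xs)) = frag_of xs"
          unfolding Suc cons_chain_boundary_frag_of sum.atMost_Suc_shift
          using \<open>y \<noteq> v\<close> by (simp add: delete_nth_def xs)
        moreover have "cons_chain v (frag_of xs) = 0" using True by (simp add: cons_chain_def)
        ultimately show ?thesis by (simp add: simp_def)
      next
        case False
        have v_notin: "v \<notin> set xs"
          using cons_ordered_simplices[OF v _ False, of p] one by (auto simp: ordered_simplices_def)
        have "hd (delete_nth i xs) \<noteq> v" if "i \<le> p" for i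
        proof -
          have "length (delete_nth i xs) = Suc q" using len Suc that by simp
          then have "delete_nth i xs \<noteq> []" by force
          then have "hd (delete_nth i xs) \<in> set xs"
            using set_delete_nth[of i xs] hd_in_set by blast
          then show ?thesis using v_notin by auto
        qed
        then have "cons_chain v (delete_boundary p (frag_of xs)) =
            (\<Sum>i\<le>p. frag_cmul ((-1) ^ i) (frag_of (v # delete_nth i xs)))"
          unfolding Suc cons_chain_boundary_frag_of by (intro sum.cong) auto
        moreover have "cons_chain v (frag_of xs) = frag_of (v # xs)"
          using False by (simp add: cons_chain_def)
        ultimately show ?thesis by (simp add: delete_boundary_Cons simp_def)
      qed
    qed
  next
    case (diff a b)
    have "(a - b) - delete_boundary (Suc p) (cons_chain v (a - b)) - cons_chain v (delete_boundary p (a - b)) =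
       (a - delete_boundary (Suc p) (cons_chain v a) - cons_chain v (delete_boundary p a)) -
       (b - delete_boundary (Suc p) (cons_chain v b) - cons_chain v (delete_boundary p b))"
      by (simp add: cons_chain_diff simp.D_diff)
    then show ?case
      using diff.IH simp.subcomplex_diff[OF simp_subcomplex[OF sc]] by metis
  qed
qed

text \<open>The boundary of a relative cycle consists of lists beginning with \<open>v\<close>,
  which the cone operator kills, so the homotopy formula exhibits the correcting chain.\<close>

lemma simp_rel_exact_vertex:
  fixes s :: "'a::order set"
  assumes v: "v \<in> s" "\<And>w. w \<in> s \<Longrightarrow> v \<le> w"
  shows "simp.rel_exact (simp (Pow s)) (simp (Pow {v}))"
  unfolding simp.rel_exact_def
proof (intro allI ballI impI)
  fix p x assume x: "x \<in> simp (Pow s) p" "delete_boundary p x \<in> simp (Pow {v}) (p - 1)"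
  have "hd xs = v" if "xs \<in> Poly_Mapping.keys (delete_boundary p x)" for xs
  proof -
    have "xs \<in> ordered_simplices (Pow {v}) (p - 1)" using x(2) that by (auto simp: simp_def)
    then show ?thesis by (cases xs) (auto simp: ordered_simplices_def)
  qed
  then have "cons_chain v (delete_boundary p x) = 0"
    unfolding cons_chain_def by (intro frag_extend_eq_0) simp
  then have "x - delete_boundary (Suc p) (cons_chain v x) \<in> simp (Pow {v}) p"
    using cons_chain_homotopy[OF v x(1)] by simp
  then show "\<exists>y\<in>simp (Pow s) (Suc p). x - delete_boundary (Suc p) y \<in> simp (Pow {v}) p"
    using cons_chain_simp[OF v x(1)] by blast
qed

section \<open>Acyclicity of the comparison cone\<close>

abbreviation comparison_cone where
  "comparison_cone K \<equiv> cone_family (sing (realization_points K)) (simp K)"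

lemma comparison_cone_subcomplex:
  "simplicial_complex K \<Longrightarrow> cone.cone.subcomplex (comparison_cone K)"
  by (intro cone.cone_subcomplex sing_subcomplex simp_subcomplex realize_maps_to)

text \<open>Over a point there is one singular simplex in each degree. In degree 0 it is the
  realization of \<open>[v]\<close>, and in positive degrees singular cycles bound.\<close>

lemma comparison_cone_exact_vertex:
  "cone.cone.exact (comparison_cone (Pow {v}))"
  unfolding cone.cone.exact_def
proof (intro allI ballI impI)
  fix p zc assume zc: "zc \<in> comparison_cone (Pow {v}) p" "cone.\<Delta> p zc = 0"
  obtain z c where eq: "zc = (z, c)" by force
  let ?X = "subtopology (powertop_real UNIV) (realization_points (Pow {v}))"
  have sc: "simplicial_complex (Pow {v})" by (auto simp: simplicial_complex_def finite_subset)
  have "realization_points (Pow {v}) = {\<lambda>w. if w = v then 1 else 0}"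
    by (rule realization_points_vertex)
  then have ts: "topspace ?X = {\<lambda>w. if w = v then 1 else 0}" by simp
  have z: "singular_chain p ?X z" using zc(1) eq by (simp add: cone_family_def sing_def)
  show "\<exists>y\<in>comparison_cone (Pow {v}) (Suc p). cone.\<Delta> (Suc p) y = zc"
  proof (cases p)
    case 0
    have v0: "[v] \<in> ordered_simplices (Pow {v}) 0" by (simp add: ordered_simplices_def)
    obtain b where b: "z = frag_cmul b (frag_of (\<lambda>x\<in>standard_simplex 0. \<lambda>w. if w = v then 1 else 0))"
      using singular_chain_singleton[OF ts] z 0 by auto
    have "vertex_simplex 0 [v] = (\<lambda>x\<in>standard_simplex 0. \<lambda>w. if w = v then 1 else 0)"
      using singular_simplex_singleton[OF ts] singular_simplex_vertex_simplex[OF sc v0] by blast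
    \<comment> \<open>The minus sign cancels the one in front of \<open>realize\<close> in the cone
      boundary.\<close>
    then have "cone.\<Delta> (Suc p) (0, - frag_cmul b (frag_of [v])) = zc"
      using 0 zc(1) eq b
      by (simp add: cone_family_def cone.cone_boundary_Suc realize_def frag_extend_cmul delete_boundary_def
        flip: minus_frag_cmul del: minus_frag_cmul) (simp add: frag_extend_minus frag_extend_cmul)
    moreover have "(0, - frag_cmul b (frag_of [v])) \<in> comparison_cone (Pow {v}) (Suc p)"
      using 0 v0 by (auto simp: cone_family_def simp_def sing_def)
    ultimately show ?thesis by blast
  next
    case (Suc q)
    have c: "c \<in> simp (Pow {v}) q" using zc(1) eq Suc by (simp add: cone_family_def)
    have bz: "chain_boundary (Suc q) z = realize q c"
      using zc(2) eq Suc by (simp add: cone.cone_boundary_Suc zero_prod_def)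
    \<comment> \<open>For \<open>q = 0\<close> the boundary of a 1-chain over a point is zero and
      \<open>realize\<close> is injective; for larger \<open>q\<close> a strictly increasing list
      does not fit into \<open>{v}\<close>.\<close>
    have "c = 0"
    proof (cases q)
      case 0
      then have "realize q c = 0"
        using bz chain_boundary_of_singleton[OF ts z] Suc by simp
      then show ?thesis using c realize_inj by blast
    next
      case (Suc r)
      have False if xs: "xs \<in> ordered_simplices (Pow {v}) q" for xs
      proof -
        have "length xs = Suc (Suc r)" using xs Suc by (simp add: ordered_simplices_def)
        then obtain x y zs where "xs = x # y # zs" by (metis length_Suc_conv)
        then show False using xs by (auto simp: ordered_simplices_def)
      qed
      then have "Poly_Mapping.keys c = {}" using c unfolding simp_def by blast
      then show ?thesis by simp
    qed
    then have "singular_relcycle p ?X {} z"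
      using z bz Suc by (simp add: singular_cycle)
    then have "singular_relboundary p ?X {} z"
      using singular_boundary_eq_cycle_singleton[OF ts, of p] Suc by simp
    then obtain w where "singular_chain (Suc p) ?X w" "chain_boundary (Suc p) w = z"
      by (auto simp: singular_boundary)
    then show ?thesis
      using \<open>c = 0\<close> eq Suc
      by (intro bexI[of _ "(w, 0)"]) (auto simp: cone_family_def cone.cone_boundary_Suc sing_def simp_def)
  qed
qed

lemma simplicial_complex_remove_facet:
  assumes "simplicial_complex K" "\<And>t. t \<in> K \<Longrightarrow> s \<subseteq> t \<Longrightarrow> t = s"
  shows "simplicial_complex (K - {s})"
  using assms unfolding simplicial_complex_def by blast

lemma cone_family_mono:
  "(\<And>p. S p \<subseteq> S' p) \<Longrightarrow> (\<And>p. C p \<subseteq> C' p) \<Longrightarrow> cone_family S C p \<subseteq> cone_family S' C' p"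
  unfolding cone_family_def by (cases p) (simp_all add: Sigma_mono)

lemma comparison_cone_mono:
  "K \<subseteq> L \<Longrightarrow> comparison_cone K p \<subseteq> comparison_cone L p"
  by (intro cone_family_mono sing_mono realization_points_mono simp_mono)

text \<open>Both chain complexes contract to the vertex \<open>v\<close>: singularly by the
  straight-line homotopy, simplicially by the cone operator, whose apex has to be the least
  vertex.\<close>

lemma comparison_cone_exact_simplex:
  assumes s: "finite s" and v: "v \<in> s" "\<And>w. w \<in> s \<Longrightarrow> v \<le> w"
  shows "cone.cone.exact (comparison_cone (Pow s))"
proof -
  have Ps: "simplicial_complex (Pow s)" and Pv: "simplicial_complex (Pow {v})"
    using s by (auto simp: simplicial_complex_def finite_subset)
  have "Pow {v} \<subseteq> Pow s" using v(1) by blast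
  moreover have "cone.cone.rel_exact (comparison_cone (Pow s)) (comparison_cone (Pow {v}))"
    by (rule cone.cone_rel_exact[OF sing_subcomplex simp_subcomplex[OF Ps] realize_maps_to[OF Ps]
          sing_subcomplex simp_subcomplex[OF Pv] realize_maps_to[OF Pv]
          sing_rel_exact_vertex[OF s v(1)] simp_rel_exact_vertex[OF v]])
  ultimately show ?thesis
    by (intro cone.cone.exact_extend[OF comparison_cone_subcomplex[OF Ps] comparison_cone_mono
          comparison_cone_subcomplex[OF Pv] comparison_cone_exact_vertex])
qed

text \<open>The cone over the two sum families is the sum of the two cones, so the singular and the
  simplicial facet lemmas combine.\<close>

lemma comparison_cone_rel_exact_facet:
  assumes K: "simplicial_complex K" and s: "s \<in> K" "s \<noteq> {}" "\<And>t. t \<in> K \<Longrightarrow> s \<subseteq> t \<Longrightarrow> t = s"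
  shows "cone.cone.rel_exact (comparison_cone K)
     (plus_family (comparison_cone (K - {s})) (comparison_cone (Pow s)))"
proof -
  define S where "S = plus_family (sing (realization_points (K - {s}))) (sing (realization_points (Pow s)))"
  define C where "C = plus_family (simp (K - {s})) (simp (Pow s))"
  have PK: "Pow s \<subseteq> K" and Ps: "simplicial_complex (Pow s)"
    using K s(1) by (auto simp: simplicial_complex_def finite_subset)
  have K': "simplicial_complex (K - {s})"
    using K s(3) unfolding simplicial_complex_def by blast
  have C_sub: "C p \<subseteq> simp K p" for p
    unfolding C_def
    by (intro simp.plus_family_least[OF simp_subcomplex[OF K]] simp_mono PK Diff_subset)
  have maps: "cone.maps_to C S"
    unfolding cone.maps_to_def
  proof (intro allI ballI conjI)
    fix p c assume c: "c \<in> C p"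
    then obtain a b where ab: "c = a + b" "a \<in> simp (K - {s}) p" "b \<in> simp (Pow s) p"
      unfolding C_def plus_family_def by blast
    show "realize p c \<in> S p"
      using realize_sing[OF K' ab(2)] realize_sing[OF Ps ab(3)]
      unfolding S_def plus_family_def ab(1) cone.\<phi>_add by blast
    show "chain_boundary p (realize p c) = realize (p - 1) (delete_boundary p c)"
      using chain_boundary_realize[OF K] c C_sub by blast
  qed
  have "cone.cone.rel_exact (comparison_cone K) (cone_family S C)"
  proof (rule cone.cone_rel_exact[OF sing_subcomplex simp_subcomplex[OF K] realize_maps_to[OF K] _ _ maps])
    show "sing.subcomplex S"
      unfolding S_def by (intro sing.subcomplex_plus_family sing_subcomplex)
    show "simp.subcomplex C"
      unfolding C_def by (intro simp.subcomplex_plus_family simp_subcomplex K' Ps)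
    show "sing.rel_exact (sing (realization_points K)) S"
      unfolding S_def using s by (intro sing_rel_exact_facet K)
    show "simp.rel_exact (simp K) C"
      unfolding C_def by (rule simp_rel_exact_facet[OF K s(1)])
  qed
  then show ?thesis by (simp add: S_def C_def cone_family_plus)
qed

text \<open>Simplices being chains, each facet has a least vertex to which it contracts. The
  induction on the number of simplices also covers the boundary of the facet, which is the
  intersection in the Mayer-Vietoris step.\<close>

theorem comparison_cone_exact:
  fixes K :: "'a::order set set"
  assumes "simplicial_complex K" and "\<And>s x y. s \<in> K \<Longrightarrow> x \<in> s \<Longrightarrow> y \<in> s \<Longrightarrow> x \<le> y \<or> y \<le> x"
  shows "cone.cone.exact (comparison_cone K)"
  using assms
proof (induction "card K" arbitrary: K rule: less_induct)
  case less
  note K = less.prems(1) and total = less.prems(2)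
  have finK: "finite K" using K by (simp add: simplicial_complex_def)
  show ?case
  proof (cases "K \<subseteq> {{}}")
    \<comment> \<open>At most the empty simplex is present: there are no points, and all chain
      groups vanish.\<close>
    case True
    have "realization_points K = {}" using True by (auto simp: realization_points_def)
    then have 1: "sing (realization_points K) p = {0}" for p
      by (auto simp: sing_def singular_chain_empty)
    have "ordered_simplices K p = {}" for p using True by (auto simp: ordered_simplices_def)
    then have 2: "simp K p = {0}" for p by (simp add: simp_def)
    have "x = 0" if "x \<in> comparison_cone K p" for x p
      using that unfolding cone_family_def 1 2 by (cases p) (auto simp: zero_prod_def)
    moreover have "0 \<in> comparison_cone K p" for p
      unfolding cone_family_def 1 2 by (cases p) (auto simp: zero_prod_def)
    ultimately show ?thesis
      unfolding cone.cone.exact_def by (metis cone.cone.D_0)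
  next
    case False
    \<comment> \<open>A simplex of largest cardinality is a facet.\<close>
    have "Max (card ` K) \<in> card ` K" using finK False by (intro Max_in) auto
    then obtain s where s: "s \<in> K" "card s = Max (card ` K)" by (metis imageE)
    have card_le: "card t \<le> card s" if "t \<in> K" for t
      using s finK that by simp
    have fin: "finite t" if "t \<in> K" for t using K that by (simp add: simplicial_complex_def)
    obtain t where t: "t \<in> K" "t \<noteq> {}" using False by blast
    have ne: "s \<noteq> {}"
      using card_le[OF t(1)] t fin[OF t(1)] by (auto simp: card_gt_0_iff)
    have max: "t = s" if "t \<in> K" "s \<subseteq> t" for t
      using card_seteq[OF fin[OF that(1)] that(2) card_le[OF that(1)]] by simp
    have PK: "Pow s \<subseteq> K" and Ps: "simplicial_complex (Pow s)"
      using K s(1) by (auto simp: simplicial_complex_def finite_subset)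
    have K': "simplicial_complex (K - {s})"
      by (rule simplicial_complex_remove_facet[OF K max])
    have I: "simplicial_complex ((K - {s}) \<inter> Pow s)"
      using K' Ps by (simp add: simplicial_complex_def)
    obtain v where v: "v \<in> s" "\<And>w. w \<in> s \<Longrightarrow> w \<le> v \<Longrightarrow> v = w"
      using finite_has_minimal[OF fin[OF s(1)] ne] by blast
    have v_le: "v \<le> w" if "w \<in> s" for w
      using total[OF s(1) v(1) that] v(2)[OF that] by auto
    have exP: "cone.cone.exact (comparison_cone (Pow s))"
      by (rule comparison_cone_exact_simplex[OF fin[OF s(1)] v(1) v_le])
    have ex1: "cone.cone.exact (comparison_cone (K - {s}))"
    proof (rule less.hyps[OF _ K'])
      show "card (K - {s}) < card K" using card_Diff1_less[OF finK s(1)] .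
    qed (rule total, auto)
    have ex2: "cone.cone.exact (comparison_cone ((K - {s}) \<inter> Pow s))"
    proof (rule less.hyps[OF _ I])
      show "card ((K - {s}) \<inter> Pow s) < card K"
        using s(1) by (intro psubset_card_mono[OF finK]) blast
    qed (rule total, auto)
    have inter: "inter_family (comparison_cone (K - {s})) (comparison_cone (Pow s)) =
       comparison_cone ((K - {s}) \<inter> Pow s)"
      by (simp only: cone_family_inter[symmetric] sing_inter simp_inter realization_points_Int)
    have ex: "cone.cone.exact (plus_family (comparison_cone (K - {s})) (comparison_cone (Pow s)))"
      by (rule cone.cone.exact_plus_family[OF comparison_cone_subcomplex[OF K']
            comparison_cone_subcomplex[OF Ps] ex1 exP ex2[folded inter]])
    have sub: "plus_family (comparison_cone (K - {s})) (comparison_cone (Pow s)) p \<subseteq> comparison_cone K p" for p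
      by (intro cone.cone.plus_family_least[OF comparison_cone_subcomplex[OF K]] comparison_cone_mono
          PK Diff_subset)
    show ?thesis
      by (rule cone.cone.exact_extend[OF comparison_cone_subcomplex[OF K] sub
            cone.cone.subcomplex_plus_family[OF comparison_cone_subcomplex[OF K'] comparison_cone_subcomplex[OF Ps]]
            ex comparison_cone_rel_exact_facet[OF K s(1) ne max]])
  qed
qed

section \<open>Local homology of a simplicial complex\<close>

locale punctured_complex =
  fixes K :: "'a::order set set" and x :: "'a \<Rightarrow> real" and L :: "'a set set"
  assumes complex: "simplicial_complex K"
    and total: "\<And>s u v. s \<in> K \<Longrightarrow> u \<in> s \<Longrightarrow> v \<in> s \<Longrightarrow> u \<le> v \<or> v \<le> u"
    and point: "x \<in> realization_points K"
    and L_def: "L = {s \<in> K. \<not> {v. x v \<noteq> 0} \<subseteq> s}"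
begin

abbreviation "W \<equiv> realization_points K"

abbreviation "V \<equiv> realization_points K - {x}"

abbreviation "X \<equiv> subtopology (powertop_real UNIV) W"

lemma complex_L: "simplicial_complex L"
  using complex unfolding L_def simplicial_complex_def by (auto; blast)

lemma L_subset: "L \<subseteq> K"
  by (auto simp: L_def)

lemma L_points: "realization_points L \<subseteq> V"
  using realization_points_mono[OF L_subset] by (auto simp: L_def realization_points_def)

lemma rel_exact_L: "sing.rel_exact (sing V) (sing (realization_points L))"
  unfolding L_def by (rule sing_rel_exact_punctured[OF complex point])

text \<open>Acyclicity of both cones makes the quotient cone acyclic: simplicial chains of
  \<open>K\<close> modulo \<open>L\<close> are quasi-isomorphic to singular chains of the
  realizations.\<close>

lemma rel_exact_cone: "cone.cone.rel_exact (comparison_cone K) (comparison_cone L)"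
proof (rule cone.cone.rel_exact_of_exact)
  show "cone.cone.exact (comparison_cone K)"
    by (rule comparison_cone_exact[OF complex total])
  show "cone.cone.exact (comparison_cone L)"
    by (rule comparison_cone_exact[OF complex_L]) (use total L_subset in blast)
qed (intro comparison_cone_subcomplex comparison_cone_mono complex complex_L L_subset)+

lemma subtopology_V: "subtopology X V = subtopology (powertop_real UNIV) V"
  by (simp add: subtopology_subtopology Int_absorb1)

lemma relcycle_iff:
  "singular_relcycle p X V z \<longleftrightarrow> z \<in> sing W p \<and> chain_boundary p z \<in> sing V (p - 1)"
  by (simp add: singular_relcycle sing_def subtopology_V)

lemma relboundary_iff:
  "singular_relboundary p X V z \<longleftrightarrow>
     (\<exists>w\<in>sing W (Suc p). \<exists>u\<in>sing V p. z = chain_boundary (Suc p) w + u)"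
  unfolding singular_relboundary sing_def subtopology_V by blast

lemma realize_relcycle:
  assumes "c \<in> simp K p" "delete_boundary p c \<in> simp L (p - 1)"
  shows "singular_relcycle p X V (realize p c)"
  unfolding relcycle_iff
  using assms realize_sing[OF complex] realize_sing[OF complex_L] chain_boundary_realize[OF complex]
    sing_mono[OF L_points] by (metis subset_iff)

text \<open>Once the summand \<open>u\<close> in \<open>V\<close> is pushed into the realization of
  \<open>L\<close>, the bounding singular chain together with \<open>c\<close> is a relative cycle
  of the cone. The second component of its primitive is, up to sign, the wanted simplicial
  chain.\<close>

lemma comparison_injective:
  assumes c: "c \<in> simp K p" "delete_boundary p c \<in> simp L (p - 1)"
    and b: "singular_relboundary p X V (realize p c)"
  obtains d where "d \<in> simp K (Suc p)" "c - delete_boundary (Suc p) d \<in> simp L p"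
proof -
  obtain w u where w: "w \<in> sing W (Suc p)" and u: "u \<in> sing V p"
    and eq: "realize p c = chain_boundary (Suc p) w + u"
    using b relboundary_iff by blast
  have "chain_boundary p u = chain_boundary p (realize p c)"
    using sing.subcomplex_DD[OF sing_subcomplex w] eq by (simp add: sing.D_add)
  also have "\<dots> = realize (p - 1) (delete_boundary p c)"
    by (rule chain_boundary_realize[OF complex c(1)])
  finally have "chain_boundary p u \<in> sing (realization_points L) (p - 1)"
    using realize_sing[OF complex_L c(2)] by simp
  then obtain u' where u': "u' \<in> sing V (Suc p)"
      "u - chain_boundary (Suc p) u' \<in> sing (realization_points L) p"
    using rel_exact_L u unfolding sing.rel_exact_def by blast
  have "w + u' \<in> sing W (Suc p)"
    using w u' sing_mono[of V W] by (intro sing.subcomplex_add[OF sing_subcomplex]) auto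
  then have 1: "(w + u', c) \<in> comparison_cone K (Suc p)"
    using c by (simp add: cone_family_def)
  have "chain_boundary (Suc p) (w + u') - realize p c = - (u - chain_boundary (Suc p) u')"
    by (simp add: eq sing.D_add)
  then have "chain_boundary (Suc p) (w + u') - realize p c \<in> sing (realization_points L) p"
    using sing.subcomplex_minus[OF sing_subcomplex u'(2)] by simp
  moreover have "- delete_boundary p c \<in> (case p of 0 \<Rightarrow> {0} | Suc q \<Rightarrow> simp L q)"
    using simp.subcomplex_minus[OF simp_subcomplex[OF complex_L] c(2)]
    by (auto simp: simp.D_degree_0 split: nat.splits)
  ultimately have "cone.\<Delta> (Suc p) (w + u', c) \<in> comparison_cone L (Suc p - 1)"
    by (simp add: cone.cone_boundary_Suc cone_family_def)
  then obtain y where y: "y \<in> comparison_cone K (Suc (Suc p))"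
      "(w + u', c) - cone.\<Delta> (Suc (Suc p)) y \<in> comparison_cone L (Suc p)"
    using rel_exact_cone 1 unfolding cone.cone.rel_exact_def by blast
  obtain y1 y2 where [simp]: "y = (y1, y2)" by force
  have "y2 \<in> simp K (Suc p)" "c + delete_boundary (Suc p) y2 \<in> simp L p"
    using y by (auto simp: cone_family_def cone.cone_boundary_Suc)
  then show ?thesis
    using that[of "- y2"] simp.subcomplex_minus[OF simp_subcomplex[OF complex]]
    by (simp add: simp.D_minus)
qed

text \<open>After a correction by \<open>u\<close> the boundary of \<open>y\<close> lies over
  \<open>L\<close>, so \<open>(y - u, 0)\<close> is a relative cycle of the cone. Its primitive
  supplies the simplicial chain, with a sign because the cone boundary subtracts
  \<open>realize\<close>.\<close>

lemma comparison_surjective: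
  assumes y: "singular_relcycle p X V y"
  obtains c where "c \<in> simp K p" "delete_boundary p c \<in> simp L (p - 1)"
    "singular_relboundary p X V (y - realize p c)"
proof -
  have yW: "y \<in> sing W p" and bdy: "chain_boundary p y \<in> sing V (p - 1)"
    using y relcycle_iff by auto
  obtain u where u: "u \<in> sing V p" "chain_boundary p (y - u) \<in> sing (realization_points L) (p - 1)"
  proof (cases p)
    case 0
    show ?thesis
      by (rule that[of 0])
        (simp_all add: 0 sing.D_degree_0 sing.subcomplex_0[OF sing_subcomplex])
  next
    case (Suc q)
    have "chain_boundary q (chain_boundary p y) = 0"
      using sing.subcomplex_DD[OF sing_subcomplex] yW Suc by blast
    then have "chain_boundary q (chain_boundary p y) \<in> sing (realization_points L) (q - 1)"
      using sing.subcomplex_0[OF sing_subcomplex] by simp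
    then obtain u where "u \<in> sing V (Suc q)"
        "chain_boundary p y - chain_boundary (Suc q) u \<in> sing (realization_points L) q"
      using rel_exact_L bdy Suc unfolding sing.rel_exact_def by auto
    then show ?thesis using that Suc by (simp add: sing.D_diff)
  qed
  have "y - u \<in> sing W p"
    using yW u sing_mono[of V W] by (intro sing.subcomplex_diff[OF sing_subcomplex]) auto
  then have 1: "(y - u, 0) \<in> comparison_cone K p"
    by (auto simp: cone_family_def simp_def split: nat.splits)
  have "cone.\<Delta> p (y - u, 0) \<in> comparison_cone L (p - 1)"
    using u(2) sing.subcomplex_0[OF sing_subcomplex]
    by (cases p) (auto simp: cone.cone_boundary_Suc cone_boundary_def cone_family_def simp_def zero_prod_def split: nat.splits)
  then obtain wc where wc: "wc \<in> comparison_cone K (Suc p)"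
      "(y - u, 0) - cone.\<Delta> (Suc p) wc \<in> comparison_cone L p"
    using rel_exact_cone 1 unfolding cone.cone.rel_exact_def by blast
  obtain w c where [simp]: "wc = (w, c)" by force
  have w: "w \<in> sing W (Suc p)" and c: "c \<in> simp K p"
    and r: "y - u - (chain_boundary (Suc p) w - realize p c) \<in> sing (realization_points L) p"
    and bc: "delete_boundary p c \<in> (case p of 0 \<Rightarrow> {0} | Suc q \<Rightarrow> simp L q)"
    using wc by (auto simp: cone_family_def cone.cone_boundary_Suc)
  define e where "e = y - u - (chain_boundary (Suc p) w - realize p c)"
  have "e + u \<in> sing V p"
    using r u(1) sing_mono[OF L_points] unfolding e_def
    by (intro sing.subcomplex_add[OF sing_subcomplex]) auto
  moreover have "y - realize p (- c) = chain_boundary (Suc p) w + (e + u)"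
    by (simp add: e_def cone.\<phi>_minus)
  ultimately have "singular_relboundary p X V (y - realize p (- c))"
    using w relboundary_iff by blast
  moreover have "delete_boundary p (- c) \<in> simp L (p - 1)"
    using bc by (intro simp.subcomplex_minus[OF simp_subcomplex[OF complex_L], of "delete_boundary p c", folded simp.D_minus])
      (auto simp: simp_def split: nat.splits)
  ultimately show ?thesis
    using that simp.subcomplex_minus[OF simp_subcomplex[OF complex] c] by blast
qed

lemma local_homology_trivial:
  assumes "trivial_group (relative_homology_group (int p) X V)"
    and "c \<in> simp K p" "delete_boundary p c \<in> simp L (p - 1)"
  obtains d where "d \<in> simp K (Suc p)" "c - delete_boundary (Suc p) d \<in> simp L p"
proof (rule comparison_injective[OF assms(2,3)])
  have "homologous_rel_set p X V (realize p c) \<in> carrier (relative_homology_group (int p) X V)"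
    using realize_relcycle[OF assms(2,3)] by (simp add: carrier_relative_homology_group)
  then have "homologous_rel_set p X V (realize p c) = singular_relboundary_set p X V"
    using assms(1) by (auto simp: trivial_group_def)
  then show "singular_relboundary p X V (realize p c)"
    by (simp only: homologous_rel_set_eq_relboundary)
qed

text \<open>\<open>\<theta>\<close> is the isomorphism read on relative cycles: additive, and zero
  exactly on relative boundaries. A class of value 1 has a simplicial representative
  \<open>z\<close>, and the value of a cycle is the multiple of \<open>z\<close> to
  subtract.\<close>

lemma local_homology_generator:
  assumes "relative_homology_group (int p) X V \<cong> integer_group"
  obtains z where "z \<in> simp K p" "delete_boundary p z \<in> simp L (p - 1)"
    "\<And>c. c \<in> simp K p \<Longrightarrow> delete_boundary p c \<in> simp L (p - 1) \<Longrightarrow>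
       \<exists>j. \<exists>d\<in>simp K (Suc p). c - frag_cmul j z - delete_boundary (Suc p) d \<in> simp L p"
    "\<And>j d. d \<in> simp K (Suc p) \<Longrightarrow> frag_cmul j z - delete_boundary (Suc p) d \<in> simp L p \<Longrightarrow> j = 0"
proof -
  let ?G = "relcycle_group p X V"
  let ?H = "relative_homology_group (int p) X V"
  obtain h where h: "h \<in> iso ?H integer_group"
    using assms by (auto simp: is_iso_def)
  define \<theta> where "\<theta> c = h (homologous_rel_set p X V c)" for c
  have "(\<lambda>a. {b. homologous_rel p X V a b}) \<in> hom ?G ?H"
    using normal.r_coset_hom_Mod[OF normal_subgroup_singular_relboundary_relcycle, of p X V]
    by (simp add: nontrivial_relative_homology_group flip: right_coset_singular_relboundary)
  then have "h \<circ> (\<lambda>a. {b. homologous_rel p X V a b}) \<in> hom ?G integer_group"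
    using h by (intro hom_compose) (auto simp: iso_def)
  then have hom: "\<theta> \<in> hom ?G integer_group"
    by (simp add: \<theta>_def[abs_def] o_def)
  have add: "\<theta> (a + b) = \<theta> a + \<theta> b"
    if "singular_relcycle p X V a" "singular_relcycle p X V b" for a b
    using hom_mult[OF hom, of a b] that by simp
  have inj: "inj_on h (carrier ?H)" and surj: "h ` carrier ?H = UNIV"
    using h by (auto simp: iso_def bij_betw_def)
  have one: "h (singular_relboundary_set p X V) = 0"
    using hom_one[of h ?H integer_group] h by (simp add: iso_def)
  have zero: "\<theta> a = 0 \<longleftrightarrow> singular_relboundary p X V a" if "singular_relcycle p X V a" for a
  proof -
    have "homologous_rel_set p X V a \<in> carrier ?H" "singular_relboundary_set p X V \<in> carrier ?H"
      using that group.is_monoid[OF group_relative_homology_group, THEN monoid.one_closed, of "int p" X V]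
      by (auto simp: carrier_relative_homology_group)
    then have "\<theta> a = 0 \<longleftrightarrow> homologous_rel_set p X V a = singular_relboundary_set p X V"
      using inj one by (metis \<theta>_def inj_onD)
    then show ?thesis by (simp only: homologous_rel_set_eq_relboundary)
  qed
  have minus: "\<theta> (- a) = - \<theta> a" if "singular_relcycle p X V a" for a
  proof -
    have "\<theta> 0 = 0" using zero[of 0] by simp
    then show ?thesis using add[of a "- a"] that by (simp add: singular_relcycle_minus)
  qed
  have diff: "\<theta> (a - b) = \<theta> a - \<theta> b"
    if "singular_relcycle p X V a" "singular_relcycle p X V b" for a b
    using add[of a "- b"] minus[of b] that by (simp add: singular_relcycle_minus)
  have cmul_nat: "\<theta> (frag_cmul (int m) a) = int m * \<theta> a" if "singular_relcycle p X V a" for a m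
  proof (induction m)
    case 0
    then show ?case using zero[of 0] by simp
  next
    case (Suc m)
    then show ?case
      using add[OF that singular_relcycle_cmul[OF that, of "int m"]]
      by (simp add: frag_cmul_distrib algebra_simps)
  qed
  have cmul: "\<theta> (frag_cmul j a) = j * \<theta> a" if a: "singular_relcycle p X V a" for a j
  proof (cases j)
    case (nonneg m)
    then show ?thesis using cmul_nat[OF a] by simp
  next
    case (neg m)
    have "frag_cmul j a = - frag_cmul (int (Suc m)) a" using neg by simp
    then have eq: "\<theta> (frag_cmul j a) = - (int (Suc m) * \<theta> a)"
      using minus[OF singular_relcycle_cmul[OF a]] cmul_nat[OF a, of "Suc m"] by metis
    show ?thesis unfolding eq unfolding neg by (simp only: mult_minus_left)
  qed
  obtain y where y: "singular_relcycle p X V y" "\<theta> y = 1"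
  proof -
    have "1 \<in> h ` carrier ?H" by (simp add: surj)
    then show ?thesis using that by (auto simp: carrier_relative_homology_group \<theta>_def)
  qed
  obtain z where z: "z \<in> simp K p" "delete_boundary p z \<in> simp L (p - 1)"
      "singular_relboundary p X V (y - realize p z)"
    using comparison_surjective[OF y(1)] by blast
  have rz: "singular_relcycle p X V (realize p z)" by (rule realize_relcycle[OF z(1,2)])
  have \<theta>z: "\<theta> (realize p z) = 1"
    using zero[OF singular_relcycle_diff[OF y(1) rz]] diff[OF y(1) rz] z(3) y(2) by simp
  have cmul_simp: "frag_cmul j c \<in> simp M q" if "c \<in> simp M q" for j c and M :: "'a set set" and q
    using that keys_cmul[of j c] by (auto simp: simp_def)
  have bd_cmul: "delete_boundary q (frag_cmul j c) = frag_cmul j (delete_boundary q c)" for q j and c :: "'a list \<Rightarrow>\<^sub>0 int"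
    by (simp add: delete_boundary_def frag_extend_cmul)
  have re_cmul: "realize q (frag_cmul j c) = frag_cmul j (realize q c)" for q j and c :: "'a list \<Rightarrow>\<^sub>0 int"
    by (simp add: realize_def frag_extend_cmul)
  show ?thesis
  proof (rule that[OF z(1,2)])
    fix c assume c: "c \<in> simp K p" "delete_boundary p c \<in> simp L (p - 1)"
    define j where "j = \<theta> (realize p c)"
    have rc: "singular_relcycle p X V (realize p c)" by (rule realize_relcycle[OF c])
    have 1: "c - frag_cmul j z \<in> simp K p"
      using c z cmul_simp by (intro simp.subcomplex_diff[OF simp_subcomplex[OF complex]]) auto
    have 2: "delete_boundary p (c - frag_cmul j z) \<in> simp L (p - 1)"
      unfolding simp.D_diff bd_cmul
      using c z cmul_simp by (intro simp.subcomplex_diff[OF simp_subcomplex[OF complex_L]]) auto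
    have "\<theta> (realize p (c - frag_cmul j z)) = 0"
      using diff[OF rc singular_relcycle_cmul[OF rz, of j]] cmul[OF rz, of j] \<theta>z
      by (simp add: cone.\<phi>_diff re_cmul j_def)
    then have "singular_relboundary p X V (realize p (c - frag_cmul j z))"
      using zero[OF realize_relcycle[OF 1 2]] by simp
    then obtain d where "d \<in> simp K (Suc p)" "c - frag_cmul j z - delete_boundary (Suc p) d \<in> simp L p"
      using comparison_injective[OF 1 2] by blast
    then show "\<exists>j. \<exists>d\<in>simp K (Suc p). c - frag_cmul j z - delete_boundary (Suc p) d \<in> simp L p" by blast
  next
    fix j d assume d: "d \<in> simp K (Suc p)" "frag_cmul j z - delete_boundary (Suc p) d \<in> simp L p"
    define e where "e = frag_cmul j z - delete_boundary (Suc p) d"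
    have "realize p e \<in> sing V p"
      using realize_sing[OF complex_L d(2)] sing_mono[OF L_points] by (auto simp: e_def)
    moreover have "frag_cmul j (realize p z) = chain_boundary (Suc p) (realize (Suc p) d) + realize p e"
      using chain_boundary_realize[OF complex d(1)] by (simp add: e_def cone.\<phi>_diff re_cmul)
    ultimately have "singular_relboundary p X V (frag_cmul j (realize p z))"
      using relboundary_iff realize_sing[OF complex d(1)] by blast
    then show "j = 0"
      using zero[OF singular_relcycle_cmul[OF rz, of j]] cmul[OF rz, of j] \<theta>z by simp
  qed
qed

end

section \<open>Graded posets and magnitude chains\<close>

lemma pred_on_chain_less_iff:
  "pred_on.chain P (<) C \<longleftrightarrow> C \<subseteq> P \<and> (\<forall>x\<in>C. \<forall>y\<in>C. x \<le> y \<or> y \<le> (x::'a::order))"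
  by (auto simp: pred_on.chain_def le_less)

section \<open>Chains as strictly increasing lists\<close>

lemma sorted_wrt_less_unique:
  fixes xs ys :: "'a::order list"
  assumes "sorted_wrt (<) xs" "sorted_wrt (<) ys" "set xs = set ys"
  shows "xs = ys"
  using assms
proof (induction xs arbitrary: ys)
  case (Cons x xs)
  obtain y ys' where ys: "ys = y # ys'" using Cons.prems(3) by (cases ys) auto
  have "x = y"
  proof (rule ccontr)
    assume "x \<noteq> y"
    then have "x \<in> set ys'" "y \<in> set xs" using Cons.prems(3) ys by auto
    then have "y < x" "x < y" using Cons.prems ys by auto
    then show False by simp
  qed
  moreover have "set xs = set ys'"
    using Cons.prems ys \<open>x = y\<close> by auto
  ultimately show ?case using Cons.IH[of ys'] Cons.prems ys by auto
qed auto

lemma sorted_list_of_chain: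
  fixes C :: "'a::order set"
  assumes "finite C" "\<And>x y. x \<in> C \<Longrightarrow> y \<in> C \<Longrightarrow> x \<le> y \<or> y \<le> x"
  shows "\<exists>xs. sorted_wrt (<) xs \<and> set xs = C"
  using assms
proof (induction "card C" arbitrary: C rule: less_induct)
  case less
  show ?case
  proof (cases "C = {}")
    case False
    obtain v where v: "v \<in> C" "\<And>w. w \<in> C \<Longrightarrow> w \<le> v \<Longrightarrow> v = w"
      using finite_has_minimal[OF less.prems(1) False] by blast
    have "\<exists>xs. sorted_wrt (<) xs \<and> set xs = C - {v}"
    proof (rule less.hyps)
      show "card (C - {v}) < card C" using card_Diff1_less[OF less.prems(1) v(1)] .
    qed (use less.prems in auto)
    then obtain xs where xs: "sorted_wrt (<) xs" "set xs = C - {v}" by blast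
    have "v < w" if "w \<in> set xs" for w
    proof -
      have "w \<in> C" "w \<noteq> v" using that xs by auto
      then show ?thesis using less.prems(2)[OF v(1) \<open>w \<in> C\<close>] v(2)[of w] by auto
    qed
    then have "sorted_wrt (<) (v # xs) \<and> set (v # xs) = C"
      using xs v(1) by auto
    then show ?thesis by blast
  qed auto
qed

lemma sorted_wrt_hd_le_last:
  fixes xs :: "'a::order list"
  assumes "sorted_wrt (<) xs" "y \<in> set xs"
  shows "hd xs \<le> y" "y \<le> last xs"
proof -
  show "hd xs \<le> y" using assms by (cases xs) auto
  show "y \<le> last xs" using assms by (cases xs rule: rev_cases) (auto simp: sorted_wrt_append)
qed

lemma set_delete_nth_distinct:
  assumes "distinct xs" "i < length xs"
  shows "set (delete_nth i xs) = set xs - {xs ! i}"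
proof -
  have "xs = take i xs @ xs ! i # drop (Suc i) xs" using assms id_take_nth_drop by blast
  then have "distinct (take i xs @ xs ! i # drop (Suc i) xs)" "set xs = set (take i xs @ xs ! i # drop (Suc i) xs)"
    using assms(1) by metis+
  then show ?thesis unfolding delete_nth_def by auto
qed

lemma delete_nth_append_middle:
  assumes "j < length xs"
  shows "delete_nth (length lo + j) (lo @ xs @ hi) = lo @ delete_nth j xs @ hi"
  using assms by (simp add: delete_nth_def)

lemma sorted_wrt_less_distinct: "sorted_wrt (<) xs \<Longrightarrow> distinct (xs :: 'a::order list)"
  by (induction xs) auto

section \<open>Maximal chains, covers and ranks\<close>

locale ranked_poset =
  fixes P :: "'a::order set" and r :: "'a \<Rightarrow> nat" and rk :: nat
  assumes graded: "graded_poset P rk" and rank: "rank_function P r"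
begin

lemma finite_P: "finite P"
  using graded by (simp add: graded_poset_def)

lemma order_complex_simplicial: "simplicial_complex (order_complex P)"
  unfolding simplicial_complex_def
proof (intro conjI ballI)
  have "order_complex P \<subseteq> Pow P" by (auto simp: order_complex_def pred_on_chain_less_iff)
  then show "finite (order_complex P)" using finite_P finite_subset by blast
  fix s assume s: "s \<in> order_complex P"
  then have "s \<subseteq> P" by (simp add: order_complex_def pred_on_chain_less_iff)
  then show "finite s" using finite_P by (rule finite_subset)
  show "Pow s \<subseteq> order_complex P"
    using s unfolding order_complex_def pred_on_chain_less_iff by blast
qed

lemma order_complex_total: "s \<in> order_complex P \<Longrightarrow> x \<in> s \<Longrightarrow> y \<in> s \<Longrightarrow> x \<le> y \<or> y \<le> x"
  by (auto simp: order_complex_def pred_on_chain_less_iff)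

lemma maxchain_card:
  assumes "C \<in> order_complex P" "\<And>y. y \<in> P \<Longrightarrow> (\<And>x. x \<in> C \<Longrightarrow> x \<le> y \<or> y \<le> x) \<Longrightarrow> y \<in> C"
  shows "card C = rk + 1"
proof -
  have "pred_on.maxchain P (<) C"
    unfolding pred_on.maxchain_def
  proof (intro conjI notI)
    show "pred_on.chain P (<) C" using assms(1) by (simp add: order_complex_def)
    assume "\<exists>S. pred_on.chain P (<) S \<and> C \<subset> S"
    then obtain S y where "S \<subseteq> P" "\<forall>x\<in>S. \<forall>y\<in>S. x \<le> y \<or> y \<le> x" "C \<subset> S" "y \<in> S" "y \<notin> C"
      unfolding pred_on_chain_less_iff by blast
    then show False using assms(2)[of y] by blast
  qed
  then show ?thesis using graded by (simp add: graded_poset_def)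
qed

lemma order_complex_insert:
  assumes "C \<in> order_complex P" "y \<in> P" "\<And>x. x \<in> C \<Longrightarrow> x \<le> y \<or> y \<le> x"
  shows "insert y C \<in> order_complex P"
proof -
  have "u \<le> v \<or> v \<le> u" if "u \<in> insert y C" "v \<in> insert y C" for u v
    using that assms(3) order_complex_total[OF assms(1)] by blast
  moreover have "C \<subseteq> P" using assms(1) by (simp add: order_complex_def pred_on_chain_less_iff)
  ultimately show ?thesis
    using assms(2) by (simp add: order_complex_def pred_on_chain_less_iff)
qed

text \<open>Extension to a maximal chain. The bound on the dimension of the order complex later
  excludes boundaries in the top degree.\<close>

lemma order_complex_card_le:
  assumes "C \<in> order_complex P"
  shows "card C \<le> rk + 1"
proof -
  have fin: "finite (order_complex P)"
    using order_complex_simplicial by (simp add: simplicial_complex_def)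
  obtain M where M: "M \<in> order_complex P" "C \<subseteq> M"
      "\<forall>S\<in>order_complex P. M \<subseteq> S \<longrightarrow> M = S"
    using finite_has_maximal2[OF fin assms] by (elim bexE conjE) (rule that)
  have "card M = rk + 1"
  proof (rule maxchain_card[OF M(1)])
    fix y assume y: "y \<in> P" "\<And>x. x \<in> M \<Longrightarrow> x \<le> y \<or> y \<le> x"
    have "M = insert y M"
      using M(3) order_complex_insert[OF M(1) y] by blast
    then show "y \<in> M" by blast
  qed
  moreover have "finite M" using M(1) order_complex_simplicial by (simp add: simplicial_complex_def)
  ultimately show ?thesis using card_mono[OF _ M(2)] by simp
qed

text \<open>In an empty poset the empty chain would be maximal, with 0 instead of
  \<open>rk + 1\<close> elements.\<close>

lemma P_nonempty: "P \<noteq> {}"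
proof
  assume "P = {}"
  then have "{} \<in> order_complex P" "card {} = rk + 1"
    using maxchain_card[of "{}"] by (auto simp: order_complex_def pred_on_chain_less_iff)
  then show False by simp
qed

lemma cover_below:
  assumes "x \<in> P" "y \<in> P" "x < y"
  obtains z where "covered_by P x z" "z \<le> y"
proof -
  have fin: "finite {z \<in> P. x < z \<and> z \<le> y}" using finite_P by simp
  moreover have "{z \<in> P. x < z \<and> z \<le> y} \<noteq> {}" using assms by blast
  ultimately obtain z where z: "z \<in> P" "x < z" "z \<le> y"
      "\<And>w. w \<in> P \<Longrightarrow> x < w \<Longrightarrow> w \<le> y \<Longrightarrow> w \<le> z \<Longrightarrow> z = w"
    using finite_has_minimal[OF fin] by blast
  have "\<not> (\<exists>w\<in>P. x < w \<and> w < z)"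
  proof
    assume "\<exists>w\<in>P. x < w \<and> w < z"
    then obtain w where w: "w \<in> P" "x < w" "w < z" by blast
    then have "w \<le> y" using z(3) by (meson less_imp_le order.trans)
    then have "z = w" using z(4) w by simp
    then show False using w by simp
  qed
  then have "covered_by P x z" using assms z by (simp add: covered_by_def)
  then show ?thesis using that z by blast
qed

lemma rank_cover: "covered_by P x y \<Longrightarrow> r y = r x + 1"
  using rank by (simp add: rank_function_def)

text \<open>The decreasing measure for inductions that climb along covers.\<close>

lemma card_above_cover:
  assumes "covered_by P x z"
  shows "card {w \<in> P. z < w} < card {w \<in> P. x < w}"
proof (rule psubset_card_mono)
  have "x < z" "z \<in> P" using assms by (auto simp: covered_by_def)
  moreover have "x < w" if "z < w" for w
    using \<open>x < z\<close> that by (rule less_trans)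
  ultimately have "{w \<in> P. z < w} \<subseteq> {w \<in> P. x < w}" "z \<in> {w \<in> P. x < w}" "z \<notin> {w \<in> P. z < w}"
    by auto
  then show "{w \<in> P. z < w} \<subset> {w \<in> P. x < w}" by blast
qed (use finite_P in simp)

lemma rank_strict_mono:
  assumes "x \<in> P" "y \<in> P" "x < y"
  shows "r x < r y"
  using assms
proof (induction "card {w \<in> P. x < w}" arbitrary: x rule: less_induct)
  case less
  obtain z where z: "covered_by P x z" "z \<le> y" using cover_below[OF less.prems] .
  show ?case
  proof (cases "z = y")
    case False
    then have "r z < r y"
      using less.hyps[OF card_above_cover[OF z(1)]] z less.prems by (simp add: covered_by_def)
    then show ?thesis using rank_cover[OF z(1)] by simp
  qed (use rank_cover[OF z(1)] in simp)
qed

lemma rank_mono: "x \<in> P \<Longrightarrow> y \<in> P \<Longrightarrow> x \<le> y \<Longrightarrow> r x \<le> r y"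
  using rank_strict_mono[of x y] by (auto simp: le_less)

section \<open>Magnitude tuples with fixed end points\<close>

definition tuples :: "'a \<Rightarrow> 'a \<Rightarrow> nat \<Rightarrow> 'a list set" where
  "tuples a b m =
     {xs. sorted_wrt (<) xs \<and> length xs = Suc m \<and> set xs \<subseteq> P \<and> hd xs = a \<and> last xs = b}"

lemma tuples_between:
  assumes "xs \<in> tuples a b m" "y \<in> set xs"
  shows "y \<in> P" "a \<le> y" "y \<le> b"
  using assms sorted_wrt_hd_le_last[of xs y] by (auto simp: tuples_def)

lemma tuples_ends:
  assumes "xs \<in> tuples a b m"
  shows "a \<in> set xs" "b \<in> set xs" "a \<in> P" "b \<in> P" "a \<le> b"
proof -
  have "xs \<noteq> []" using assms by (auto simp: tuples_def)
  then show "a \<in> set xs" "b \<in> set xs" using assms by (auto simp: tuples_def)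
  then show "a \<in> P" "b \<in> P" "a \<le> b" using tuples_between[OF assms] by auto
qed

text \<open>Each step of the list raises the rank by at least one.\<close>

lemma length_le_rank:
  assumes "sorted_wrt (<) xs" "set xs \<subseteq> P" "xs \<noteq> []"
  shows "r (hd xs) + length xs \<le> Suc (r (last xs))"
  using assms
proof (induction xs)
  case (Cons x xs)
  show ?case
  proof (cases xs)
    case (Cons y ys)
    then have "r x < r y" using Cons.prems by (intro rank_strict_mono) auto
    then show ?thesis using Cons.IH Cons.prems Cons by auto
  qed simp
qed simp

lemma tuples_rank: "xs \<in> tuples a b m \<Longrightarrow> r a + m \<le> r b"
  using length_le_rank[of xs] by (force simp: tuples_def)

text \<open>Climbing from \<open>a\<close> along covers raises the rank by exactly one per
  step.\<close>

lemma saturated_tuple: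
  assumes "a \<in> P" "b \<in> P" "a \<le> b"
  shows "\<exists>xs. xs \<in> tuples a b (r b - r a)"
  using assms
proof (induction "card {w \<in> P. a < w}" arbitrary: a rule: less_induct)
  case less
  show ?case
  proof (cases "a = b")
    case True
    then have "[a] \<in> tuples a b (r b - r a)" using less.prems by (simp add: tuples_def)
    then show ?thesis by blast
  next
    case False
    then have "a < b" using less.prems by simp
    then obtain z where z: "covered_by P a z" "z \<le> b"
      using cover_below[OF less.prems(1,2)] by metis
    then obtain xs where xs: "xs \<in> tuples z b (r b - r z)"
      using less.hyps[OF card_above_cover[OF z(1)]] less.prems by (auto simp: covered_by_def)
    have "a < y" if "y \<in> set xs" for y
      using tuples_between[OF xs that] z(1) by (auto simp: covered_by_def)
    moreover have "r z \<le> r b" using z less.prems by (intro rank_mono) (auto simp: covered_by_def)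
    moreover have "xs \<noteq> []" using xs by (auto simp: tuples_def)
    ultimately have "a # xs \<in> tuples a b (r b - r a)"
      using xs less.prems rank_cover[OF z(1)] by (auto simp: tuples_def)
    then show ?thesis by blast
  qed
qed

lemma mag_length_Cons:
  "xs \<noteq> [] \<Longrightarrow> mag_length r (x # xs) = mag_dist r x (hd xs) + mag_length r xs"
  unfolding mag_length_def
  by (cases xs) (simp_all add: sum.lessThan_Suc_shift del: sum.lessThan_Suc)

text \<open>The distances telescope; monotonicity of \<open>r\<close> keeps the truncated
  subtractions exact.\<close>

lemma mag_length_sorted:
  assumes "sorted_wrt (<) xs" "set xs \<subseteq> P" "xs \<noteq> []"
  shows "mag_length r xs = enat (r (last xs) - r (hd xs))"
  using assms
proof (induction xs)
  case (Cons x xs)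
  show ?case
  proof (cases "xs = []")
    case True
    then show ?thesis by (simp add: mag_length_def zero_enat_def)
  next
    case False
    have in_xs: "hd xs \<in> set xs" "last xs \<in> set xs" using False by auto
    then have "x < hd xs" "x \<in> P" "hd xs \<in> P" "last xs \<in> P" using Cons.prems by auto
    moreover have "hd xs \<le> last xs"
      using sorted_wrt_hd_le_last(1)[of xs "last xs"] Cons.prems in_xs by auto
    ultimately have "r x \<le> r (hd xs)" "r (hd xs) \<le> r (last xs)"
      using rank_mono by (simp_all add: less_imp_le)
    then show ?thesis
      using Cons.IH Cons.prems False in_xs by (simp add: mag_length_Cons mag_dist_def less_imp_le)
  qed
qed simp

text \<open>A finite sum has no infinite term, so consecutive entries are comparable, and being
  distinct they increase strictly.\<close>

lemma mag_tuples_iff: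
  "xs \<in> mag_tuples P r k m \<longleftrightarrow>
     sorted_wrt (<) xs \<and> length xs = Suc m \<and> set xs \<subseteq> P \<and> r (last xs) - r (hd xs) = k"
    (is "?l \<longleftrightarrow> ?r")
proof
  assume l: ?l
  then have len: "length xs = Suc m" and P: "set xs \<subseteq> P" and neq: "\<And>i. i < m \<Longrightarrow> xs ! i \<noteq> xs ! Suc i"
    and k: "mag_length r xs = enat k"
    by (auto simp: mag_tuples_def)
  have "xs ! i < xs ! Suc i" if i: "i < m" for i
  proof -
    have "mag_dist r (xs ! i) (xs ! Suc i) \<le> (\<Sum>i<length xs - 1. mag_dist r (xs ! i) (xs ! Suc i))"
      using i len by (intro member_le_sum) auto
    also have "\<dots> = enat k" using k by (simp add: mag_length_def)
    finally have "xs ! i \<le> xs ! Suc i" by (auto simp: mag_dist_def split: if_splits)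
    then show ?thesis using neq[OF i] by simp
  qed
  then have "sorted_wrt (<) xs"
    using len by (subst sorted_wrt_iff_nth_Suc_transp) auto
  moreover have "xs \<noteq> []" using len by auto
  ultimately show ?r
    using mag_length_sorted[of xs] P len k by auto
next
  assume r: ?r
  then have "xs \<noteq> []" by auto
  moreover have "xs ! i \<noteq> xs ! Suc i" if "i < m" for i
    using sorted_wrt_nth_less[of "(<)" xs i "Suc i"] r that by auto
  ultimately show ?l
    using r mag_length_sorted[of xs] by (simp add: mag_tuples_def)
qed

lemma mag_tuples_tuples:
  "xs \<in> mag_tuples P r k m \<longleftrightarrow>
     xs \<in> tuples (hd xs) (last xs) m \<and> r (last xs) - r (hd xs) = k"
  by (auto simp: mag_tuples_iff tuples_def)

lemma tuples_mag_tuples: "xs \<in> tuples a b m \<Longrightarrow> xs \<in> mag_tuples P r (r b - r a) m"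
  by (auto simp: mag_tuples_iff tuples_def)

lemma delete_nth_tuples:
  assumes xs: "xs \<in> tuples a b m" and j: "0 < j" "j < m"
  shows "delete_nth j xs \<in> tuples a b (m - 1)"
proof -
  have len: "length xs = Suc m" using xs by (simp add: tuples_def)
  have "take j xs \<noteq> []" "drop (Suc j) xs \<noteq> []" using j len by auto
  then have "hd (delete_nth j xs) = hd xs" "last (delete_nth j xs) = last xs"
    using j len by (auto simp: delete_nth_def hd_append last_append last_drop)
  then show ?thesis
    using xs j set_delete_nth[of j xs] sorted_wrt_delete_nth[of "(<)" xs j]
    by (auto simp: tuples_def)
qed

text \<open>Dropping an interior entry changes neither end, hence not the length; dropping an end
  loses length because \<open>r\<close> is strictly monotone.\<close>

lemma mag_face_tuples:
  assumes xs: "xs \<in> tuples a b m" and j: "j \<le> m"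
  shows "mag_face r (r b - r a) j xs = (if 0 < j \<and> j < m then frag_of (delete_nth j xs) else 0)"
proof (cases "delete_nth j xs = []")
  \<comment> \<open>This happens only for \<open>m = 0\<close>, where no \<open>j\<close> satisfies
    \<open>0 < j\<close> and \<open>j < m\<close>.\<close>
  case True
  have "length (delete_nth j xs) = m" using xs j by (simp add: tuples_def)
  then show ?thesis using True by (auto simp: mag_face_def)
next
  case False
  let ?ys = "delete_nth j xs"
  have len: "length xs = Suc m" and sorted: "sorted_wrt (<) xs" using xs by (auto simp: tuples_def)
  have "length ?ys = m" using len j by simp
  have m: "m > 0" using False \<open>length ?ys = m\<close> by auto
  have ysP: "set ?ys \<subseteq> P" using set_delete_nth[of j xs] xs by (auto simp: tuples_def)
  have lys: "mag_length r ?ys = enat (r (last ?ys) - r (hd ?ys))"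
    by (rule mag_length_sorted[OF sorted_wrt_delete_nth[OF sorted] ysP False])
  have set: "set ?ys = set xs - {xs ! j}"
    using set_delete_nth_distinct[OF sorted_wrt_less_distinct[OF sorted]] j len by simp
  have ends: "last ?ys \<in> set xs - {xs ! j}" "hd ?ys \<in> set xs - {xs ! j}"
    using False set by (metis last_in_set, metis hd_in_set)
  have le: "a \<le> hd ?ys" "last ?ys \<le> b" "hd ?ys \<le> last ?ys"
    using ends tuples_between[OF xs] sorted_wrt_hd_le_last(1)[OF sorted_wrt_delete_nth[OF sorted] last_in_set[OF False]]
    by auto
  consider "j = 0" | "j = m" | "0 < j" "j < m" using j by linarith
  then show ?thesis
  proof cases
    case 1
    have "xs \<noteq> []" using len by auto
    then have "xs ! j = a" using 1 xs by (simp add: tuples_def hd_conv_nth)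
    then have "a < hd ?ys" using le ends by auto
    then have "r a < r (hd ?ys)" using tuples_ends[OF xs] ends tuples_between(1)[OF xs]
      by (intro rank_strict_mono) auto
    moreover have "r (hd ?ys) \<le> r (last ?ys)" "r (last ?ys) \<le> r b"
      using le ends tuples_ends[OF xs] tuples_between(1)[OF xs] by (auto intro!: rank_mono)
    ultimately have "r (last ?ys) - r (hd ?ys) \<noteq> r b - r a" by linarith
    then show ?thesis using 1 lys by (simp add: mag_face_def)
  next
    case 2
    have "xs \<noteq> []" using len by auto
    then have "xs ! j = b" using 2 xs len by (simp add: tuples_def last_conv_nth)
    then have "last ?ys < b" using le ends by auto
    then have "r (last ?ys) < r b" using tuples_ends[OF xs] ends tuples_between(1)[OF xs]
      by (intro rank_strict_mono) auto
    moreover have "r (hd ?ys) \<le> r (last ?ys)" "r a \<le> r (hd ?ys)"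
      using le ends tuples_ends[OF xs] tuples_between(1)[OF xs] by (auto intro!: rank_mono)
    ultimately have "r (last ?ys) - r (hd ?ys) \<noteq> r b - r a" by linarith
    then show ?thesis using 2 lys by (simp add: mag_face_def)
  next
    case 3
    then have "mag_length r ?ys = enat (r b - r a)"
      using delete_nth_tuples[OF xs 3] lys by (auto simp: tuples_def)
    then show ?thesis using 3 False by (simp add: mag_face_def)
  qed
qed

lemma mag_boundary_tuples:
  assumes xs: "xs \<in> tuples a b m"
  shows "mag_boundary r (r b - r a) (frag_of xs) =
     (\<Sum>j\<in>{0<..<m}. frag_cmul ((-1) ^ j) (frag_of (delete_nth j xs)))"
proof -
  have len: "length xs = Suc m" using xs by (simp add: tuples_def)
  have "mag_boundary r (r b - r a) (frag_of xs) =
      (\<Sum>j<Suc m. frag_cmul ((-1) ^ j) (mag_face r (r b - r a) j xs))"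
    by (simp add: mag_boundary_def len)
  also have "\<dots> = (\<Sum>j\<in>{0<..<m}. frag_cmul ((-1) ^ j) (frag_of (delete_nth j xs)))"
    by (rule sum.mono_neutral_cong_right) (auto simp: mag_face_tuples[OF xs] less_Suc_eq_le)
  finally show ?thesis .
qed

lemma mag_boundary_diff: "mag_boundary r k (c - d) = mag_boundary r k c - mag_boundary r k d"
  by (simp add: mag_boundary_def frag_extend_diff)

lemma mag_boundary_sum:
  "finite I \<Longrightarrow> mag_boundary r k (sum f I) = (\<Sum>i\<in>I. mag_boundary r k (f i))"
  by (simp add: mag_boundary_def frag_extend_sum o_def)

lemma mag_boundary_cmul: "mag_boundary r k (frag_cmul j c) = frag_cmul j (mag_boundary r k c)"
  by (simp add: mag_boundary_def frag_extend_cmul)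

lemma mag_boundary_keys:
  assumes "Poly_Mapping.keys c \<subseteq> tuples a b m"
  shows "Poly_Mapping.keys (mag_boundary r (r b - r a) c) \<subseteq> tuples a b (m - 1)"
  using assms
proof (induction c rule: frag_induction)
  case zero
  then show ?case by (simp add: mag_boundary_def)
next
  case (one xs)
  show ?case
    unfolding mag_boundary_tuples[OF one]
    by (rule keys_sum_cmul_frag_of) (use delete_nth_tuples[OF one] in auto)
next
  case (diff c d)
  then show ?case
    using keys_diff[of "mag_boundary r (r b - r a) c" "mag_boundary r (r b - r a) d"]
    unfolding mag_boundary_diff by auto
qed

end

section \<open>Magnitude chains between two fixed elements\<close>

context ranked_poset
begin

lemma maximal_chain_list:
  assumes "A \<subseteq> P"
  shows "\<exists>xs. sorted_wrt (<) xs \<and> set xs \<subseteq> A \<and>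
    (\<forall>y\<in>A. (\<forall>x\<in>set xs. x \<le> y \<or> y \<le> x) \<longrightarrow> y \<in> set xs)"
proof -
  define F where "F = {C. C \<subseteq> A \<and> (\<forall>x\<in>C. \<forall>y\<in>C. x \<le> y \<or> y \<le> x)}"
  have finA: "finite A" using assms finite_P finite_subset by blast
  have "F \<subseteq> Pow A" by (auto simp: F_def)
  then have "finite F" using finA by (metis finite_Pow_iff finite_subset)
  moreover have "F \<noteq> {}" by (auto simp: F_def)
  ultimately obtain M where M: "M \<in> F" "\<And>C. C \<in> F \<Longrightarrow> M \<subseteq> C \<Longrightarrow> M = C"
    using finite_has_maximal[of F] by blast
  have MA: "M \<subseteq> A" and Mc: "\<And>x y. x \<in> M \<Longrightarrow> y \<in> M \<Longrightarrow> x \<le> y \<or> y \<le> x"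
    using M(1) by (auto simp: F_def)
  obtain xs where xs: "sorted_wrt (<) xs" "set xs = M"
    using sorted_list_of_chain[OF finite_subset[OF MA finA] Mc] by blast
  have "y \<in> M" if y: "y \<in> A" "\<forall>x\<in>M. x \<le> y \<or> y \<le> x" for y
  proof -
    have "insert y M \<in> F"
      unfolding F_def using y MA Mc by auto
    then show ?thesis using M(2)[of "insert y M"] by blast
  qed
  then show ?thesis using xs MA by blast
qed

end

text \<open>
  The chain \<open>lo\<close>, \<open>a\<close>, \<open>b\<close>, \<open>hi\<close> is maximal outside the open interval from \<open>a\<close> to \<open>b\<close>, so the
  link of its simplex is the order complex of that interval.
\<close>

locale interval_chain = ranked_poset P r rk
  for P :: "'a::order set" and r :: "'a \<Rightarrow> nat" and rk :: nat +
  fixes a b :: 'a and lo hi :: "'a list"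
  assumes a: "a \<in> P" and b: "b \<in> P" and ab: "a \<le> b"
    and lo: "sorted_wrt (<) lo" "set lo \<subseteq> {x \<in> P. x < a}"
    and lo_max: "\<And>y. y \<in> P \<Longrightarrow> y < a \<Longrightarrow> \<forall>x\<in>set lo. x \<le> y \<or> y \<le> x \<Longrightarrow> y \<in> set lo"
    and hi: "sorted_wrt (<) hi" "set hi \<subseteq> {x \<in> P. b < x}"
    and hi_max: "\<And>y. y \<in> P \<Longrightarrow> b < y \<Longrightarrow> \<forall>x\<in>set hi. x \<le> y \<or> y \<le> x \<Longrightarrow> y \<in> set hi"
begin

definition \<sigma> where "\<sigma> = set lo \<union> {a, b} \<union> set hi"

text \<open>The degree shift from tuples to simplices. It is \<open>card \<sigma> - 2\<close> for
  \<open>a < b\<close> and \<open>card \<sigma> - 1\<close> for \<open>a = b\<close>, which spares a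
  case distinction.\<close>

definition q where "q = length lo + length hi"

abbreviation K where "K \<equiv> order_complex P"

definition L where "L = {s \<in> K. \<not> \<sigma> \<subseteq> s}"

definition extend :: "'a list \<Rightarrow> 'a list" where "extend xs = lo @ xs @ hi"

definition extend_chain where "extend_chain = frag_extend (frag_of \<circ> extend)"

text \<open>Simplices containing \<open>\<sigma>\<close> give a basis of the chains of
  \<open>K\<close> modulo those of \<open>L\<close>, so this projection picks canonical
  representatives of the quotient.\<close>

abbreviation link_part where "link_part \<equiv> frag_filter (\<lambda>ys. \<sigma> \<subseteq> set ys)"

abbreviation bd where "bd \<equiv> mag_boundary r (r b - r a)"

definition tuple_chains where "tuple_chains m = {c. Poly_Mapping.keys c \<subseteq> tuples a b m}"

lemma complex_K: "simplicial_complex K"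
  by (rule order_complex_simplicial)

lemma complex_L': "simplicial_complex L"
  using complex_K unfolding L_def simplicial_complex_def by (auto; blast)

lemma extend_sorted:
  assumes xs: "xs \<in> tuples a b m"
  shows "sorted_wrt (<) (extend xs)"
proof -
  have "x < y" if "x \<in> set lo" "y \<in> set xs" for x y
    using that lo(2) tuples_between(2)[OF xs, of y] by (auto intro: less_le_trans)
  moreover have "x < y" if "x \<in> set xs" "y \<in> set hi" for x y
    using that hi(2) tuples_between(3)[OF xs, of x] by (auto intro: le_less_trans)
  moreover have "x < y" if "x \<in> set lo" "y \<in> set hi" for x y
    using that hi(2) lo(2) ab by (force intro: less_trans less_le_trans)
  ultimately show ?thesis
    using lo(1) hi(1) xs by (auto simp: extend_def sorted_wrt_append tuples_def)
qed

lemma sorted_order_complex: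
  assumes "sorted_wrt (<) ys" "set ys \<subseteq> P"
  shows "set ys \<in> K"
  unfolding order_complex_def pred_on_chain_less_iff mem_Collect_eq
proof (intro conjI ballI)
  fix x y assume "x \<in> set ys" "y \<in> set ys"
  then show "x \<le> y \<or> y \<le> x"
    using assms(1) by (induction ys) (auto intro: less_imp_le)
qed (rule assms)

lemma extend_simplex:
  assumes xs: "xs \<in> tuples a b m"
  shows "extend xs \<in> ordered_simplices K (m + q)" "\<sigma> \<subseteq> set (extend xs)"
proof -
  have "set (extend xs) \<subseteq> P"
    using lo(2) hi(2) xs by (auto simp: extend_def tuples_def)
  then have "set (extend xs) \<in> K"
    using sorted_order_complex[OF extend_sorted[OF xs]] by blast
  then show "extend xs \<in> ordered_simplices K (m + q)"
    using extend_sorted[OF xs] xs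
    by (auto simp: ordered_simplices_def tuples_def extend_def q_def)
  show "\<sigma> \<subseteq> set (extend xs)"
    using tuples_ends[OF xs] by (auto simp: \<sigma>_def extend_def)
qed

text \<open>The tuple is the part of \<open>ys\<close> between \<open>a\<close> and
  \<open>b\<close>. An entry below \<open>a\<close> is comparable to all of \<open>lo\<close>, hence
  in \<open>lo\<close> by maximality, and likewise above \<open>b\<close>.\<close>

lemma simplex_extend:
  assumes ys: "ys \<in> ordered_simplices K (m + q)" "\<sigma> \<subseteq> set ys"
  obtains xs where "xs \<in> tuples a b m" "ys = extend xs"
proof -
  define xs where "xs = filter (\<lambda>y. a \<le> y \<and> y \<le> b) ys"
  have sorted: "sorted_wrt (<) ys" and K: "set ys \<in> K" and len: "length ys = Suc (m + q)"
    using ys by (auto simp: ordered_simplices_def)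
  have P: "set ys \<subseteq> P" using K by (auto simp: order_complex_def pred_on_chain_less_iff)
  have total: "x \<le> y \<or> y \<le> x" if "x \<in> set ys" "y \<in> set ys" for x y
    using order_complex_total[OF K] that by blast
  have \<sigma>: "a \<in> set ys" "b \<in> set ys" "set lo \<subseteq> set ys" "set hi \<subseteq> set ys"
    using ys(2) by (auto simp: \<sigma>_def)
  have sx: "sorted_wrt (<) xs" unfolding xs_def using sorted by (rule sorted_wrt_filter)
  have ax: "a \<in> set xs" and bx: "b \<in> set xs" using \<sigma> ab by (auto simp: xs_def)
  have "hd xs = a" "last xs = b"
  proof -
    have "xs \<noteq> []" using ax by auto
    then have "hd xs \<in> set xs" "last xs \<in> set xs" by auto
    then have "a \<le> hd xs" "last xs \<le> b" by (auto simp: xs_def)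
    then show "hd xs = a" "last xs = b"
      using sorted_wrt_hd_le_last[OF sx] ax bx by (auto intro: antisym)
  qed
  moreover have "set xs \<subseteq> P" using P by (auto simp: xs_def)
  ultimately have xs: "xs \<in> tuples a b (length xs - 1)"
    using sx ax by (cases xs) (auto simp: tuples_def)
  have "set ys = set (extend xs)"
  proof
    show "set (extend xs) \<subseteq> set ys" using \<sigma> by (auto simp: extend_def xs_def)
    show "set ys \<subseteq> set (extend xs)"
    proof
      fix y assume y: "y \<in> set ys"
      consider "y < a" | "b < y" | "a \<le> y" "y \<le> b"
        using total[OF y \<sigma>(1)] total[OF y \<sigma>(2)] by (auto simp: le_less)
      then show "y \<in> set (extend xs)"
      proof cases
        case 1
        then have "y \<in> set lo" using total y \<sigma>(3) P by (intro lo_max) auto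
        then show ?thesis by (simp add: extend_def)
      next
        case 2
        then have "y \<in> set hi" using total y \<sigma>(4) P by (intro hi_max) auto
        then show ?thesis by (simp add: extend_def)
      next
        case 3
        then show ?thesis using y by (simp add: extend_def xs_def)
      qed
    qed
  qed
  then have eq: "ys = extend xs"
    by (rule sorted_wrt_less_unique[OF sorted extend_sorted[OF xs]])
  then have "length xs - 1 = m" using len by (simp add: extend_def q_def)
  then show ?thesis using that xs eq by blast
qed

lemma extend_inj: "inj extend"
  by (rule injI) (simp add: extend_def)

lemma extend_chain_diff: "extend_chain (c - d) = extend_chain c - extend_chain d"
  by (simp add: extend_chain_def frag_extend_diff)

lemma extend_chain_cmul: "extend_chain (frag_cmul j c) = frag_cmul j (extend_chain c)"
  by (simp add: extend_chain_def frag_extend_cmul)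

lemma extend_chain_eq_iff: "extend_chain c = extend_chain d \<longleftrightarrow> c = d"
proof
  assume eq: "extend_chain c = extend_chain d"
  have "Poly_Mapping.lookup (extend_chain e) (extend x) = Poly_Mapping.lookup e x" for e x
    unfolding extend_chain_def using extend_inj by (rule lookup_frag_extend_inj) auto
  then show "c = d" using eq by (metis poly_mapping_eqI)
qed simp

lemma extend_chain_0 [simp]: "extend_chain 0 = 0"
  by (simp add: extend_chain_def)

lemma extend_chain_simp:
  assumes "c \<in> tuple_chains m"
  shows "extend_chain c \<in> simp K (m + q)" "link_part (extend_chain c) = extend_chain c"
proof -
  have c: "Poly_Mapping.keys c \<subseteq> tuples a b m" using assms by (simp add: tuple_chains_def)
  have "extend_chain c \<in> simp K (m + q) \<and> link_part (extend_chain c) = extend_chain c"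
    using c
  proof (induction c rule: frag_induction)
    case zero
    then show ?case by (simp add: simp_def)
  next
    case (one xs)
    then show ?case
      using extend_simplex[OF one] by (simp add: extend_chain_def simp_def frag_filter_of keys_frag_of)
  next
    case (diff c d)
    then show ?case
      using simp.subcomplex_diff[OF simp_subcomplex[OF complex_K]]
      by (simp add: extend_chain_diff frag_filter_diff)
  qed
  then show "extend_chain c \<in> simp K (m + q)" "link_part (extend_chain c) = extend_chain c"
    by auto
qed

text \<open>Linear extension of \<open>simplex_extend\<close>: modulo \<open>L\<close> every chain
  comes from tuples.\<close>

lemma link_part_extend_chain:
  assumes "c \<in> simp K (m + q)"
  obtains d where "d \<in> tuple_chains m" "link_part c = extend_chain d"
proof -
  have "Poly_Mapping.keys c \<subseteq> ordered_simplices K (m + q)" using assms by (simp add: simp_def)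
  then have "\<exists>d. d \<in> tuple_chains m \<and> link_part c = extend_chain d"
  proof (induction c rule: frag_induction)
    case zero
    then show ?case by (intro exI[of _ 0]) (simp add: tuple_chains_def)
  next
    case (one ys)
    show ?case
    proof (cases "\<sigma> \<subseteq> set ys")
      case True
      then obtain xs where "xs \<in> tuples a b m" "ys = extend xs" using simplex_extend[OF one] by blast
      then show ?thesis using True
        by (intro exI[of _ "frag_of xs"]) (simp add: tuple_chains_def extend_chain_def frag_filter_of keys_frag_of)
    qed (intro exI[of _ 0], simp add: tuple_chains_def frag_filter_of)
  next
    case (diff c c')
    then obtain d d' where "d \<in> tuple_chains m" "link_part c = extend_chain d"
        "d' \<in> tuple_chains m" "link_part c' = extend_chain d'" by blast
    then show ?case
      using keys_diff[of d d']
      by (intro exI[of _ "d - d'"]) (auto simp: tuple_chains_def frag_filter_diff extend_chain_diff)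
  qed
  then show ?thesis using that by blast
qed

lemma simp_L_iff:
  assumes "c \<in> simp K p"
  shows "c \<in> simp L p \<longleftrightarrow> link_part c = 0"
proof -
  have "link_part c = 0 \<longleftrightarrow> (\<forall>ys\<in>Poly_Mapping.keys c. \<not> \<sigma> \<subseteq> set ys)"
    unfolding keys_eq_empty[symmetric] keys_frag_filter by blast
  also have "\<dots> \<longleftrightarrow> c \<in> simp L p"
    using assms by (auto simp: simp_def L_def ordered_simplices_def)
  finally show ?thesis by blast
qed

lemma link_part_simp: "c \<in> simp K p \<Longrightarrow> link_part c \<in> simp K p"
  by (auto simp: simp_def keys_frag_filter)

text \<open>The part that the inner projection discards lies in \<open>L\<close>, and
  \<open>L\<close> is closed under boundaries, so the outer projection removes its contribution
  anyway.\<close>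

lemma link_part_boundary:
  assumes c: "c \<in> simp K p"
  shows "link_part (delete_boundary p c) = link_part (delete_boundary p (link_part c))"
proof -
  have lp: "link_part c \<in> simp K p" by (rule link_part_simp[OF c])
  have d: "c - link_part c \<in> simp K p"
    by (rule simp.subcomplex_diff[OF simp_subcomplex[OF complex_K] c lp])
  moreover have "link_part (c - link_part c) = 0"
    by (rule poly_mapping_eqI) (simp add: lookup_frag_filter lookup_minus)
  ultimately have "c - link_part c \<in> simp L p" using simp_L_iff by blast
  then have "delete_boundary p (c - link_part c) \<in> simp L (p - 1)"
    by (rule delete_boundary_simp[OF complex_L'])
  then have "link_part (delete_boundary p (c - link_part c)) = 0"
    using simp_L_iff[OF delete_boundary_simp[OF complex_K d]] by simp
  then show ?thesis by (simp add: simp.D_diff frag_filter_diff)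
qed

text \<open>\<open>\<sigma>\<close> survives exactly if the deleted vertex is outside it, and the
  vertices of \<open>lo @ xs @ hi\<close> outside \<open>\<sigma>\<close> are the interior entries
  of \<open>xs\<close>.\<close>

lemma delete_nth_extend:
  assumes xs: "xs \<in> tuples a b m" and i: "i \<le> m + q"
  shows "\<sigma> \<subseteq> set (delete_nth i (extend xs)) \<longleftrightarrow> length lo < i \<and> i < length lo + m"
proof -
  let ?l = "length lo"
  have len: "length xs = Suc m" and "xs \<noteq> []" and dx: "distinct xs"
    using xs sorted_wrt_less_distinct by (auto simp: tuples_def)
  have ends: "xs ! 0 = a" "xs ! m = b"
    using xs len \<open>xs \<noteq> []\<close> by (auto simp: tuples_def hd_conv_nth last_conv_nth)
  have "set (delete_nth i (extend xs)) = set (extend xs) - {extend xs ! i}"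
    using sorted_wrt_less_distinct[OF extend_sorted[OF xs]] i len
    by (intro set_delete_nth_distinct) (auto simp: extend_def q_def)
  then have "\<sigma> \<subseteq> set (delete_nth i (extend xs)) \<longleftrightarrow> extend xs ! i \<notin> \<sigma>"
    using extend_simplex(2)[OF xs] by blast
  also have "\<dots> \<longleftrightarrow> ?l < i \<and> i < ?l + m"
  proof -
    consider "i < ?l" | "i = ?l" | "?l < i" "i < ?l + m" | "i = ?l + m" | "?l + m < i" by linarith
    then show ?thesis
    proof cases
      case 1
      then show ?thesis by (simp add: extend_def nth_append \<sigma>_def)
    next
      case 2
      then show ?thesis using ends len by (simp add: extend_def nth_append \<sigma>_def)
    next
      case 3
      define j where "j = i - ?l"
      have j: "0 < j" "j < m" "i = ?l + j" using 3 by (auto simp: j_def)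
      have eq: "extend xs ! i = xs ! j" using j len by (simp add: extend_def nth_append)
      have neq: "xs ! j \<noteq> a" "xs ! j \<noteq> b"
        using ends j dx len nth_eq_iff_index_eq[OF dx, of j 0] nth_eq_iff_index_eq[OF dx, of j m] by auto
      have "xs ! j \<in> set xs" using j len by simp
      then have "a \<le> xs ! j" "xs ! j \<le> b" using tuples_between[OF xs] by auto
      then have "xs ! j \<notin> \<sigma>" using neq lo(2) hi(2) by (auto simp: \<sigma>_def)
      then show ?thesis using 3 eq by simp
    next
      case 4
      then show ?thesis using ends len by (simp add: extend_def nth_append \<sigma>_def)
    next
      case 5
      then have "extend xs ! i = hi ! (i - Suc (?l + m))" "i - Suc (?l + m) < length hi"
        using len i by (auto simp: extend_def nth_append q_def)
      then have "extend xs ! i \<in> \<sigma>" by (simp add: \<sigma>_def)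
      then show ?thesis using 5 by simp
    qed
  qed
  finally show ?thesis .
qed

text \<open>Deleting the interior entry \<open>j\<close> of \<open>xs\<close> deletes entry
  \<open>length lo + j\<close> of the simplex, which accounts for the sign; all other faces lie in
  \<open>L\<close>.\<close>

lemma link_part_boundary_extend_of:
  assumes xs: "xs \<in> tuples a b m"
  shows "link_part (delete_boundary (m + q) (frag_of (extend xs))) =
     frag_cmul ((-1) ^ length lo) (extend_chain (bd (frag_of xs)))"
proof (cases "m + q = 0")
  \<comment> \<open>In dimension 0 the boundary is cut off, and for \<open>m = 0\<close> there are
    no interior entries.\<close>
  case True
  then show ?thesis using mag_boundary_tuples[OF xs] by (simp add: simp.D_degree_0)
next
  case False
  let ?l = "length lo"
  have len: "length xs = Suc m" using xs by (simp add: tuples_def)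
  have "link_part (delete_boundary (m + q) (frag_of (extend xs))) =
      (\<Sum>i\<le>m + q. frag_cmul ((-1) ^ i) (link_part (frag_of (delete_nth i (extend xs)))))"
    using False unfolding delete_boundary_def
    by (simp only: if_False frag_extend_of frag_filter_sum[OF finite_atMost] frag_filter_cmul)
  also have "\<dots> = (\<Sum>i\<in>(+) ?l ` {0<..<m}. frag_cmul ((-1) ^ i) (frag_of (delete_nth i (extend xs))))"
  proof (rule sum.mono_neutral_cong_right)
    show "(+) ?l ` {0<..<m} \<subseteq> {..m + q}" by (auto simp: q_def)
    show "\<forall>i\<in>{..m + q} - (+) ?l ` {0<..<m}.
        frag_cmul ((-1) ^ i) (link_part (frag_of (delete_nth i (extend xs)))) = 0"
    proof
      fix i assume i: "i \<in> {..m + q} - (+) ?l ` {0<..<m}"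
      have "\<not> (?l < i \<and> i < ?l + m)"
      proof
        assume "?l < i \<and> i < ?l + m"
        then have "i = ?l + (i - ?l)" "i - ?l \<in> {0<..<m}" by auto
        then show False using i by blast
      qed
      then show "frag_cmul ((-1) ^ i) (link_part (frag_of (delete_nth i (extend xs)))) = 0"
        using delete_nth_extend[OF xs, of i] i by (simp add: frag_filter_of)
    qed
    fix i assume "i \<in> (+) ?l ` {0<..<m}"
    then have "i \<le> m + q" "?l < i" "i < ?l + m" by (auto simp: q_def)
    then show "frag_cmul ((-1) ^ i) (link_part (frag_of (delete_nth i (extend xs)))) =
        frag_cmul ((-1) ^ i) (frag_of (delete_nth i (extend xs)))"
      using delete_nth_extend[OF xs, of i] by (simp add: frag_filter_of)
  qed simp
  also have "\<dots> = (\<Sum>j\<in>{0<..<m}. frag_cmul ((-1) ^ (?l + j)) (frag_of (delete_nth (?l + j) (extend xs))))"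
    by (subst sum.reindex) (auto simp: o_def)
  also have "\<dots> = (\<Sum>j\<in>{0<..<m}. frag_cmul ((-1) ^ (?l + j)) (frag_of (extend (delete_nth j xs))))"
    using len by (intro sum.cong) (auto simp: extend_def delete_nth_append_middle)
  also have "\<dots> = frag_cmul ((-1) ^ ?l) (extend_chain (bd (frag_of xs)))"
    unfolding mag_boundary_tuples[OF xs] extend_chain_def
    by (simp add: frag_extend_sum frag_extend_cmul o_def frag_cmul_sum power_add)
  finally show ?thesis .
qed

lemma link_part_boundary_extend:
  assumes c: "c \<in> tuple_chains m"
  shows "link_part (delete_boundary (m + q) (extend_chain c)) =
     frag_cmul ((-1) ^ length lo) (extend_chain (bd c))"
proof -
  have "Poly_Mapping.keys c \<subseteq> tuples a b m" using c by (simp add: tuple_chains_def)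
  then show ?thesis
  proof (induction c rule: frag_induction)
    case zero
    then show ?case by (simp add: mag_boundary_def)
  next
    case (one xs)
    then show ?case
      using link_part_boundary_extend_of[OF one] by (simp add: extend_chain_def)
  next
    case (diff c d)
    then show ?case
      by (simp add: extend_chain_diff simp.D_diff frag_filter_diff mag_boundary_diff
          frag_cmul_diff_distrib2)
  qed
qed

lemma sign_cancel: "frag_cmul ((-1) ^ length lo) (frag_cmul ((-1) ^ length lo) c) = c"
  by (simp flip: power_add)

lemma bd_tuple_chains: "c \<in> tuple_chains m \<Longrightarrow> bd c \<in> tuple_chains (m - 1)"
  using mag_boundary_keys by (simp add: tuple_chains_def)

lemma extend_chain_bd:
  assumes "c \<in> tuple_chains m"
  shows "extend_chain (bd c) =
    frag_cmul ((-1) ^ length lo) (link_part (delete_boundary (m + q) (extend_chain c)))"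
  unfolding link_part_boundary_extend[OF assms] sign_cancel ..

lemma bd_degree_0:
  assumes "c \<in> tuple_chains 0"
  shows "bd c = 0"
proof -
  have "Poly_Mapping.keys c \<subseteq> tuples a b 0" using assms by (simp add: tuple_chains_def)
  then show ?thesis
  proof (induction c rule: frag_induction)
    case zero
    then show ?case by (simp add: mag_boundary_def)
  next
    case (one xs)
    then show ?case using mag_boundary_tuples[OF one] by simp
  qed (simp add: mag_boundary_diff)
qed

text \<open>Transported from the simplicial boundary along the injective
  \<open>extend_chain\<close>; the projection in between does no harm by
  \<open>link_part_boundary\<close>.\<close>

lemma bd_bd:
  assumes c: "c \<in> tuple_chains m"
  shows "bd (bd c) = 0"
proof (cases m)
  case 0
  then show ?thesis using bd_degree_0 c by (simp add: mag_boundary_def)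
next
  case (Suc m')
  let ?e = "delete_boundary (m + q) (extend_chain c)"
  have bc: "bd c \<in> tuple_chains m'" using bd_tuple_chains[OF c] Suc by simp
  have ec: "extend_chain c \<in> simp K (Suc (m' + q))" using extend_chain_simp(1)[OF c] Suc by simp
  have e: "?e \<in> simp K (m' + q)" using delete_boundary_simp[OF complex_K ec] Suc by simp
  have "link_part (delete_boundary (m' + q) (extend_chain (bd c))) =
      frag_cmul ((-1) ^ length lo) (link_part (delete_boundary (m' + q) (link_part ?e)))"
    unfolding extend_chain_bd[OF c] by (simp add: delete_boundary_def frag_extend_cmul frag_filter_cmul)
  also have "link_part (delete_boundary (m' + q) (link_part ?e)) = link_part (delete_boundary (m' + q) ?e)"
    by (rule link_part_boundary[OF e, symmetric])
  also have "delete_boundary (m' + q) ?e = 0"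
    using simp.subcomplex_DD[OF simp_subcomplex[OF complex_K] ec] Suc by simp
  finally have "extend_chain (bd (bd c)) = 0"
    unfolding extend_chain_bd[OF bc] by simp
  then show ?thesis using extend_chain_eq_iff[of "bd (bd c)" 0] by simp
qed

lemma extend_chain_relcycle:
  assumes c: "c \<in> tuple_chains m" and "bd c = 0"
  shows "delete_boundary (m + q) (extend_chain c) \<in> simp L (m + q - 1)"
proof -
  have "link_part (delete_boundary (m + q) (extend_chain c)) = 0"
    using link_part_boundary_extend[OF c] assms(2) by simp
  then show ?thesis
    using simp_L_iff[OF delete_boundary_simp[OF complex_K extend_chain_simp(1)[OF c]]] by blast
qed

text \<open>An element comparable to the whole chain lies in \<open>lo\<close> or \<open>hi\<close>
  by maximality, or between \<open>a\<close> and \<open>b\<close>. In the last case, if new, it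
  would lengthen a tuple that already has the largest length the ranks allow.\<close>

lemma saturated_simplex:
  assumes xs: "xs \<in> tuples a b (r b - r a)"
  shows "card (set (extend xs)) = rk + 1"
proof (rule maxchain_card)
  show "set (extend xs) \<in> order_complex P"
    using extend_simplex(1)[OF xs] by (simp add: ordered_simplices_def)
  fix y assume y: "y \<in> P" and cmp: "\<And>x. x \<in> set (extend xs) \<Longrightarrow> x \<le> y \<or> y \<le> x"
  have cmp_a: "a \<le> y \<or> y \<le> a" and cmp_b: "b \<le> y \<or> y \<le> b"
    using cmp tuples_ends[OF xs] by (auto simp: extend_def)
  then consider "y < a" | "b < y" | "a \<le> y" "y \<le> b" by (auto simp: le_less)
  then show "y \<in> set (extend xs)"
  proof cases
    case 1
    then have "y \<in> set lo" using cmp y by (intro lo_max) (auto simp: extend_def)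
    then show ?thesis by (simp add: extend_def)
  next
    case 2
    then have "y \<in> set hi" using cmp y by (intro hi_max) (auto simp: extend_def)
    then show ?thesis by (simp add: extend_def)
  next
    case 3
    show ?thesis
    proof (rule ccontr)
      assume notin: "y \<notin> set (extend xs)"
      have sx: "sorted_wrt (<) xs" "set xs \<subseteq> P" "length xs = Suc (r b - r a)"
        using xs by (auto simp: tuples_def)
      have tot: "x \<le> z \<or> z \<le> x" if "x \<in> insert y (set xs)" "z \<in> insert y (set xs)" for x z
        using that cmp order_complex_total[OF sorted_order_complex[OF sx(1,2)]] by (auto simp: extend_def)
      obtain zs where zs: "sorted_wrt (<) zs" "set zs = insert y (set xs)"
        using sorted_list_of_chain[of "insert y (set xs)", OF _ tot] by auto
      have "length zs = card (insert y (set xs))"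
        using distinct_card[OF sorted_wrt_less_distinct[OF zs(1)]] zs(2) by simp
      also have "\<dots> = Suc (length xs)"
        using notin distinct_card[OF sorted_wrt_less_distinct[OF sx(1)]] by (simp add: extend_def)
      finally have len: "length zs = Suc (length xs)" .
      have "zs \<noteq> []" using zs by auto
      then have ends: "hd zs \<in> insert y (set xs)" "last zs \<in> insert y (set xs)"
        using zs(2) hd_in_set last_in_set by blast+
      have "r (hd zs) + length zs \<le> Suc (r (last zs))"
        using zs sx y by (intro length_le_rank \<open>zs \<noteq> []\<close>) auto
      moreover have "r a \<le> r (hd zs)" "r (last zs) \<le> r b"
        using ends 3 tuples_between[OF xs] y a b by (auto intro!: rank_mono)
      ultimately show False using len sx(3) rank_mono[OF a b ab] by linarith
    qed
  qed
qed

text \<open>Counts the vertices of a saturated simplex, less one, in two ways. Thus degree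
  \<open>r b - r a\<close> of the tuples corresponds to the top dimension \<open>rk\<close>.\<close>

lemma rank_sum: "r b - r a + q = rk"
proof -
  obtain xs where xs: "xs \<in> tuples a b (r b - r a)" using saturated_tuple[OF a b ab] by blast
  have "length (extend xs) = rk + 1"
    using saturated_simplex[OF xs] distinct_card[OF sorted_wrt_less_distinct[OF extend_sorted[OF xs]]] by simp
  then show ?thesis using xs by (simp add: extend_def tuples_def q_def)
qed

end

section \<open>Transfer of local homology to tuples\<close>

locale interval_point = interval_chain +
  fixes x :: "'a \<Rightarrow> real"
  assumes x: "x \<in> realization_points (order_complex P)" and supp: "{v. x v \<noteq> 0} = \<sigma>"
begin

sublocale punctured_complex "order_complex P" x L
  by unfold_locales (auto simp: complex_K x supp L_def dest: order_complex_total)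

text \<open>A cycle of tuples extends to a relative cycle, which is the boundary of some
  \<open>e\<close> modulo \<open>L\<close>. The link part of \<open>e\<close> comes from tuples and,
  up to the sign \<open>(-1) ^ length lo\<close>, bounds the given cycle.\<close>

lemma tuple_cycle_is_boundary:
  assumes H: "trivial_group (relative_homology_group (int (m + q)) X V)"
    and c: "c \<in> tuple_chains m" "bd c = 0"
  obtains d where "d \<in> tuple_chains (Suc m)" "bd d = c"
proof -
  obtain e where e: "e \<in> simp K (Suc (m + q))"
      "extend_chain c - delete_boundary (Suc (m + q)) e \<in> simp L (m + q)"
    using local_homology_trivial[OF H extend_chain_simp(1)[OF c(1)] extend_chain_relcycle[OF c]] .
  have e': "e \<in> simp K (Suc m + q)" using e(1) by simp
  obtain d where d: "d \<in> tuple_chains (Suc m)" "link_part e = extend_chain d"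
    using link_part_extend_chain[OF e'] .
  have "extend_chain c - delete_boundary (Suc (m + q)) e \<in> simp K (m + q)"
    using e(2) simp_mono[OF L_subset] by blast
  then have "link_part (extend_chain c - delete_boundary (Suc (m + q)) e) = 0"
    using simp_L_iff e(2) by blast
  then have "extend_chain c = link_part (delete_boundary (Suc m + q) e)"
    using extend_chain_simp(2)[OF c(1)] by (simp add: frag_filter_diff)
  also have "\<dots> = link_part (delete_boundary (Suc m + q) (extend_chain d))"
    using link_part_boundary[OF e'] d(2) by simp
  also have "\<dots> = extend_chain (bd (frag_cmul ((-1) ^ length lo) d))"
    unfolding link_part_boundary_extend[OF d(1)] by (simp add: mag_boundary_cmul extend_chain_cmul)
  finally have "c = bd (frag_cmul ((-1) ^ length lo) d)"
    using extend_chain_eq_iff by blast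
  moreover have "frag_cmul ((-1) ^ length lo) d \<in> tuple_chains (Suc m)"
    using d(1) keys_cmul unfolding tuple_chains_def by blast
  ultimately show ?thesis using that by metis
qed

lemma simp_above_rank: "p > rk \<Longrightarrow> c \<in> simp K p \<Longrightarrow> c = 0"
proof -
  assume p: "p > rk" and c: "c \<in> simp K p"
  have False if ys: "ys \<in> ordered_simplices K p" for ys
  proof -
    have "card (set ys) \<le> rk + 1" using order_complex_card_le ys by (simp add: ordered_simplices_def)
    moreover have "card (set ys) = Suc p"
      using distinct_card[OF sorted_wrt_less_distinct[of ys]] ys by (simp add: ordered_simplices_def)
    ultimately show False using p by simp
  qed
  then have "Poly_Mapping.keys c = {}" using c unfolding simp_def by blast
  then show "c = 0" by simp
qed

text \<open>There are no simplices of dimension \<open>rk + 1\<close>, so modulo \<open>L\<close> a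
  top relative cycle equals a multiple of the generator \<open>y\<close>, not merely up to a
  boundary. The link part of \<open>y\<close> is the extension of \<open>z\<close>.\<close>

lemma tuple_cycle_generator:
  assumes H: "relative_homology_group (int rk) X V \<cong> integer_group"
  obtains z where "z \<in> tuple_chains (r b - r a)" "bd z = 0" "z \<noteq> 0"
    "\<And>c. c \<in> tuple_chains (r b - r a) \<Longrightarrow> bd c = 0 \<Longrightarrow> \<exists>j. c = frag_cmul j z"
proof -
  let ?k = "r b - r a"
  obtain y where y: "y \<in> simp K rk" "delete_boundary rk y \<in> simp L (rk - 1)"
    "\<And>c. c \<in> simp K rk \<Longrightarrow> delete_boundary rk c \<in> simp L (rk - 1) \<Longrightarrow>
       \<exists>j. \<exists>d\<in>simp K (Suc rk). c - frag_cmul j y - delete_boundary (Suc rk) d \<in> simp L rk"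
    "\<And>j d. d \<in> simp K (Suc rk) \<Longrightarrow> frag_cmul j y - delete_boundary (Suc rk) d \<in> simp L rk \<Longrightarrow> j = 0"
    using local_homology_generator[OF H] by metis
  have y': "y \<in> simp K (?k + q)" using y(1) rank_sum by simp
  obtain z where z: "z \<in> tuple_chains ?k" "link_part y = extend_chain z"
    using link_part_extend_chain[OF y'] .
  have "link_part (delete_boundary rk y) = 0"
    using simp_L_iff[OF delete_boundary_simp[OF complex_K y(1)]] y(2) by blast
  then have "link_part (delete_boundary (?k + q) (extend_chain z)) = 0"
    using link_part_boundary[OF y'] z(2) rank_sum by simp
  then have "extend_chain (bd z) = extend_chain 0"
    using extend_chain_bd[OF z(1)] by simp
  then have bz: "bd z = 0" using extend_chain_eq_iff by blast
  \<comment> \<open>Otherwise \<open>y\<close> itself would lie in \<open>L\<close>, contradicting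
    its infinite order at the multiple 1.\<close>
  have "z \<noteq> 0"
  proof
    assume "z = 0"
    then have "y \<in> simp L rk" using simp_L_iff[OF y(1)] z(2) by simp
    moreover have "(0::'a list \<Rightarrow>\<^sub>0 int) \<in> simp K (Suc rk)" by (simp add: simp_def)
    ultimately show False using y(4)[of 0 1] by simp
  qed
  moreover have "\<exists>j. c = frag_cmul j z" if c: "c \<in> tuple_chains ?k" "bd c = 0" for c
  proof -
    have ec: "extend_chain c \<in> simp K rk" "delete_boundary rk (extend_chain c) \<in> simp L (rk - 1)"
      using extend_chain_simp(1)[OF c(1)] extend_chain_relcycle[OF c] rank_sum by simp_all
    obtain j d where jd: "d \<in> simp K (Suc rk)"
        "extend_chain c - frag_cmul j y - delete_boundary (Suc rk) d \<in> simp L rk"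
      using y(3)[OF ec] by blast
    have "d = 0" using simp_above_rank[OF _ jd(1)] by simp
    then have L: "extend_chain c - frag_cmul j y \<in> simp L rk" using jd(2) by simp
    then have "extend_chain c - frag_cmul j y \<in> simp K rk"
      using simp_mono[OF L_subset] by blast
    then have "link_part (extend_chain c - frag_cmul j y) = 0"
      using simp_L_iff L by blast
    then have "extend_chain c = extend_chain (frag_cmul j z)"
      using extend_chain_simp(2)[OF c(1)] z(2)
      by (simp add: frag_filter_diff frag_filter_cmul extend_chain_cmul)
    then show ?thesis using extend_chain_eq_iff by blast
  qed
  ultimately show ?thesis using that z(1) bz by blast
qed

text \<open>For \<open>a = b\<close> the chain \<open>\<sigma>\<close> is maximal, so its simplex is a relative cycle that bounds nothing.\<close>

lemma top_local_homology_nontrivial: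
  assumes "a = b"
  shows "\<not> trivial_group (relative_homology_group (int rk) X V)"
proof
  assume H: "trivial_group (relative_homology_group (int rk) X V)"
  have q: "q = rk" using rank_sum assms by simp
  have t: "frag_of [a] \<in> tuple_chains 0"
    unfolding tuple_chains_def tuples_def using a assms by (simp add: keys_frag_of)
  obtain d where "d \<in> tuple_chains (Suc 0)" "bd d = frag_of [a]"
    using tuple_cycle_is_boundary[of 0, OF _ t bd_degree_0[OF t]] H q by auto
  moreover have "tuples a b (Suc 0) = {}"
    using tuples_rank[of _ a b "Suc 0"] assms by auto
  ultimately have "bd d = 0" unfolding tuple_chains_def by (simp add: mag_boundary_def)
  then show False using \<open>bd d = frag_of [a]\<close> by simp
qed

end

section \<open>Magnitude homology of a poset with manifold order complex\<close>

context ranked_poset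
begin

text \<open>The integer difference is the one in the final count; \<open>pairs_iff\<close> turns it
  into the truncated difference of \<open>mag_dist\<close>.\<close>

definition pairs :: "nat \<Rightarrow> ('a \<times> 'a) set" where
  "pairs k = {(x, y) \<in> P \<times> P. x \<le> y \<and> int (r y) - int (r x) = int k}"

abbreviation part :: "'a \<times> 'a \<Rightarrow> ('a list \<Rightarrow>\<^sub>0 int) \<Rightarrow> ('a list \<Rightarrow>\<^sub>0 int)" where
  "part e \<equiv> frag_filter (\<lambda>xs. (hd xs, last xs) = e)"

lemma pairs_iff: "(x, y) \<in> pairs k \<longleftrightarrow> x \<in> P \<and> y \<in> P \<and> x \<le> y \<and> r y - r x = k"
  using rank_mono[of x y] by (auto simp: pairs_def)

lemma finite_pairs: "finite (pairs k)"
  by (rule finite_subset[of _ "P \<times> P"]) (auto simp: pairs_def finite_P)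

lemma mag_tuples_pairs:
  assumes "xs \<in> mag_tuples P r k m"
  shows "(hd xs, last xs) \<in> pairs k"
  using assms tuples_ends[of xs "hd xs" "last xs" m] unfolding mag_tuples_tuples pairs_iff by auto

lemma tuples_subset_mag_tuples: "(a, b) \<in> pairs k \<Longrightarrow> tuples a b m \<subseteq> mag_tuples P r k m"
  using tuples_mag_tuples by (auto simp: pairs_iff)

lemma part_tuples:
  "Poly_Mapping.keys c \<subseteq> mag_tuples P r k m \<Longrightarrow> Poly_Mapping.keys (part (a, b) c) \<subseteq> tuples a b m"
  by (auto simp: keys_frag_filter mag_tuples_tuples)

lemma part_id:
  assumes "Poly_Mapping.keys c \<subseteq> tuples a b m"
  shows "part e c = (if e = (a, b) then c else 0)"
proof (rule poly_mapping_eqI)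
  fix xs
  have "hd xs = a \<and> last xs = b" if "Poly_Mapping.lookup c xs \<noteq> 0"
    using assms that by (auto simp: tuples_def in_keys_iff)
  then show "Poly_Mapping.lookup (part e c) xs = Poly_Mapping.lookup (if e = (a, b) then c else 0) xs"
    by (auto simp: lookup_frag_filter)
qed

text \<open>Nonzero faces keep both end points, so the boundary respects the splitting by end
  points.\<close>

lemma part_boundary:
  assumes "Poly_Mapping.keys c \<subseteq> mag_tuples P r k m"
  shows "mag_boundary r k (part e c) = part e (mag_boundary r k c)"
  using assms
proof (induction c rule: frag_induction)
  case zero
  then show ?case by (simp add: mag_boundary_def)
next
  case (one xs)
  have xs: "xs \<in> tuples (hd xs) (last xs) m" and k: "r (last xs) - r (hd xs) = k"
    using one by (auto simp: mag_tuples_tuples)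
  have "Poly_Mapping.keys (mag_boundary r k (frag_of xs)) \<subseteq> tuples (hd xs) (last xs) (m - 1)"
    using mag_boundary_keys[of "frag_of xs" "hd xs" "last xs" m] xs k by (simp add: keys_frag_of)
  then show ?case
    using part_id[of "mag_boundary r k (frag_of xs)" "hd xs" "last xs" "m - 1" e]
    by (auto simp: frag_filter_of mag_boundary_def)
next
  case (diff c d)
  then show ?case by (simp add: frag_filter_diff mag_boundary_diff)
qed

lemma sum_parts:
  assumes "Poly_Mapping.keys c \<subseteq> mag_tuples P r k m"
  shows "(\<Sum>e\<in>pairs k. part e c) = c"
proof (rule poly_mapping_eqI)
  fix xs
  have "Poly_Mapping.lookup (\<Sum>e\<in>pairs k. part e c) xs =
      (\<Sum>e\<in>pairs k. if e = (hd xs, last xs) then Poly_Mapping.lookup c xs else 0)"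
    unfolding lookup_sum by (intro sum.cong) (auto simp: lookup_frag_filter)
  also have "\<dots> = (if (hd xs, last xs) \<in> pairs k then Poly_Mapping.lookup c xs else 0)"
    by (simp add: finite_pairs)
  also have "\<dots> = Poly_Mapping.lookup c xs"
    using mag_tuples_pairs[of xs k m] assms by (auto simp: in_keys_iff)
  finally show "Poly_Mapping.lookup (\<Sum>e\<in>pairs k. part e c) xs = Poly_Mapping.lookup c xs" .
qed

lemma carrier_mag_chain_group:
  "carrier (mag_chain_group P r k m) = {c. Poly_Mapping.keys c \<subseteq> mag_tuples P r k m}"
  by (auto simp: mag_chain_group_def)

lemma keys_sum_subset:
  assumes "\<And>i. i \<in> I \<Longrightarrow> Poly_Mapping.keys (f i) \<subseteq> T"
  shows "Poly_Mapping.keys (sum f I) \<subseteq> T"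
  using keys_sum[of f I] assms by blast

lemma mag_boundary_keys_mag:
  assumes "Poly_Mapping.keys c \<subseteq> mag_tuples P r k m"
  shows "Poly_Mapping.keys (mag_boundary r k c) \<subseteq> mag_tuples P r k (m - 1)"
proof -
  have "Poly_Mapping.keys (mag_boundary r k (part e c)) \<subseteq> mag_tuples P r k (m - 1)" if "e \<in> pairs k" for e
  proof -
    obtain a b where e: "e = (a, b)" by force
    have "r b - r a = k" using that e by (simp add: pairs_iff)
    then have "Poly_Mapping.keys (mag_boundary r k (part e c)) \<subseteq> tuples a b (m - 1)"
      using mag_boundary_keys[OF part_tuples[OF assms, of a b]] e by simp
    then show ?thesis using tuples_subset_mag_tuples that e by blast
  qed
  then have "Poly_Mapping.keys (\<Sum>e\<in>pairs k. mag_boundary r k (part e c)) \<subseteq> mag_tuples P r k (m - 1)"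
    by (rule keys_sum_subset)
  then show ?thesis
    using mag_boundary_sum[OF finite_pairs, of k "\<lambda>e. part e c" k] sum_parts[OF assms] by simp
qed

lemma interval_chain_exists:
  assumes "a \<in> P" "b \<in> P" "a \<le> b"
  shows "\<exists>lo hi. interval_chain P r rk a b lo hi"
proof -
  obtain lo where "sorted_wrt (<) lo" "set lo \<subseteq> {x \<in> P. x < a}"
      "\<forall>y\<in>{x \<in> P. x < a}. (\<forall>x\<in>set lo. x \<le> y \<or> y \<le> x) \<longrightarrow> y \<in> set lo"
    using maximal_chain_list[of "{x \<in> P. x < a}"] by blast
  moreover obtain hi where "sorted_wrt (<) hi" "set hi \<subseteq> {x \<in> P. b < x}"
      "\<forall>y\<in>{x \<in> P. b < x}. (\<forall>x\<in>set hi. x \<le> y \<or> y \<le> x) \<longrightarrow> y \<in> set hi"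
    using maximal_chain_list[of "{x \<in> P. b < x}"] by blast
  ultimately have "interval_chain P r rk a b lo hi"
    using assms by unfold_locales auto
  then show ?thesis by blast
qed

text \<open>Splitting over pairs reduces this to \<open>bd_bd\<close> for an auxiliary
  \<open>interval_chain\<close>.\<close>

lemma mag_boundary_boundary:
  assumes "Poly_Mapping.keys c \<subseteq> mag_tuples P r k m"
  shows "mag_boundary r k (mag_boundary r k c) = 0"
proof -
  have "mag_boundary r k (mag_boundary r k (part e c)) = 0" if "e \<in> pairs k" for e
  proof -
    obtain a b where e: "e = (a, b)" by force
    have abk: "a \<in> P" "b \<in> P" "a \<le> b" "r b - r a = k" using that e by (auto simp: pairs_iff)
    obtain lo hi where "interval_chain P r rk a b lo hi" using interval_chain_exists[OF abk(1-3)] by blast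
    then interpret interval_chain P r rk a b lo hi .
    show ?thesis
      using bd_bd[of "part e c" m] part_tuples[OF assms, of a b] e abk(4) by (simp add: tuple_chains_def)
  qed
  then have "mag_boundary r k (mag_boundary r k (\<Sum>e\<in>pairs k. part e c)) = 0"
    by (simp add: mag_boundary_sum finite_pairs)
  then show ?thesis by (simp only: sum_parts[OF assms])
qed

lemma mag_tuples_empty: "m > k \<Longrightarrow> mag_tuples P r k m = {}"
  using tuples_rank[of _ _ _ m] by (fastforce simp: mag_tuples_tuples)

section \<open>Cycle groups and their quotients\<close>

abbreviation "cycle_group k m \<equiv> subgroup_generated (mag_chain_group P r k m) (mag_cycles P r k m)"

lemma mag_cycles_iff:
  "c \<in> mag_cycles P r k m \<longleftrightarrow> Poly_Mapping.keys c \<subseteq> mag_tuples P r k m \<and> mag_boundary r k c = 0"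
  by (auto simp: mag_cycles_def carrier_mag_chain_group)

lemma subgroup_mag_cycles: "subgroup (mag_cycles P r k m) (mag_chain_group P r k m)"
proof
  show "mag_cycles P r k m \<subseteq> carrier (mag_chain_group P r k m)" by (auto simp: mag_cycles_def)
  show "\<one>\<^bsub>mag_chain_group P r k m\<^esub> \<in> mag_cycles P r k m"
    by (simp add: mag_cycles_iff mag_chain_group_def mag_boundary_def)
  show "x \<otimes>\<^bsub>mag_chain_group P r k m\<^esub> y \<in> mag_cycles P r k m"
    if "x \<in> mag_cycles P r k m" "y \<in> mag_cycles P r k m" for x y
    using that keys_add[of x y]
    by (auto simp: mag_cycles_iff mag_chain_group_def mag_boundary_def frag_extend_add)
  show "inv\<^bsub>mag_chain_group P r k m\<^esub> x \<in> mag_cycles P r k m" if "x \<in> mag_cycles P r k m" for x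
    using that by (simp add: mag_cycles_iff mag_chain_group_def mag_boundary_def frag_extend_minus)
qed

lemma group_cycle_group: "group (cycle_group k m)"
  by (simp add: mag_chain_group_def group.group_subgroup_generated)

lemma comm_group_cycle_group: "comm_group (cycle_group k m)"
  by (rule group.group_comm_groupI[OF group_cycle_group])
    (simp add: mag_chain_group_def add.commute)

lemma carrier_cycle_group: "carrier (cycle_group k m) = mag_cycles P r k m"
  by (rule subgroup.carrier_subgroup_generated_subgroup[OF subgroup_mag_cycles])

lemma one_cycle_group: "\<one>\<^bsub>cycle_group k m\<^esub> = 0"
  by (simp add: mag_chain_group_def)

lemma mult_cycle_group: "c \<otimes>\<^bsub>cycle_group k m\<^esub> d = c + d"
  by (simp add: mag_chain_group_def)

lemma trivial_magnitude_homology: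
  assumes "mag_cycles P r k m = mag_boundaries P r k m"
  shows "trivial_group (magnitude_homology P r k m)"
proof -
  let ?G = "cycle_group k m"
  interpret group ?G by (rule group_cycle_group)
  have N: "carrier ?G \<lhd> ?G"
    using comm_group.normal_iff_subgroup[OF comm_group_cycle_group] subgroup_self by blast
  have "magnitude_homology P r k m = ?G Mod carrier ?G"
    by (simp add: magnitude_homology_def carrier_cycle_group assms[symmetric])
  moreover have "trivial_group (?G Mod carrier ?G)"
    unfolding trivial_group_def
  proof
    show "group (?G Mod carrier ?G)" by (rule normal.factorgroup_is_group[OF N])
    have "carrier ?G #>\<^bsub>?G\<^esub> c = carrier ?G" if "c \<in> carrier ?G" for c
      using coset_join2[OF that subgroup_self] that .
    then show "carrier (?G Mod carrier ?G) = {\<one>\<^bsub>?G Mod carrier ?G\<^esub>}"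
      using one_closed by (auto simp: FactGroup_def RCOSETS_def)
  qed
  ultimately show ?thesis by simp
qed

text \<open>The tuples of degree \<open>k + 1\<close> would need more rank than \<open>k\<close>, so
  degree \<open>k\<close> receives only the zero boundary.\<close>

lemma mag_boundaries_top: "mag_boundaries P r k k = {\<one>\<^bsub>cycle_group k k\<^esub>}"
  unfolding one_cycle_group mag_boundaries_def carrier_mag_chain_group
  by (auto simp: mag_tuples_empty mag_boundary_def)

lemma magnitude_homology_top: "magnitude_homology P r k k \<cong> cycle_group k k"
  unfolding magnitude_homology_def is_iso_def mag_boundaries_top
  using group.trivial_factor_iso[OF group_cycle_group, of k k] by auto

lemma torsion_free_cycle_group: "torsion_free_group (cycle_group k m)"
  unfolding torsion_free_group_def
proof (intro ballI allI impI)
  fix x and j :: nat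
  assume "0 < j" "x [^]\<^bsub>cycle_group k m\<^esub> j = \<one>\<^bsub>cycle_group k m\<^esub>"
  then have "frag_cmul (int j) x = 0"
    by (simp add: pow_subgroup_generated mag_chain_group_def)
  then show "x = \<one>\<^bsub>cycle_group k m\<^esub>"
    using \<open>0 < j\<close> by (simp add: mag_chain_group_def)
qed

end

lemma torsion_free_group_iso:
  assumes "group G" "group H" "G \<cong> H" "torsion_free_group H"
  shows "torsion_free_group G"
  unfolding torsion_free_group_def
proof (intro ballI allI impI)
  fix x and j :: nat
  assume x: "x \<in> carrier G" and j: "0 < j" "x [^]\<^bsub>G\<^esub> j = \<one>\<^bsub>G\<^esub>"
  obtain h where h: "h \<in> iso G H" using assms(3) by (auto simp: is_iso_def)
  then interpret group_hom G H h
    using assms by (simp add: group_hom_def group_hom_axioms_def iso_def)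
  have "h x [^]\<^bsub>H\<^esub> j = \<one>\<^bsub>H\<^esub>"
    using hom_nat_pow[OF x, of j] j(2) hom_one by simp
  then have "h x = h \<one>\<^bsub>G\<^esub>"
    using assms(4) j(1) hom_closed[OF x] by (simp add: torsion_free_group_def)
  then show "x = \<one>\<^bsub>G\<^esub>"
    using h x by (auto simp: iso_def bij_betw_def inj_on_def)
qed

section \<open>Consequences of the manifold condition\<close>

locale manifold_poset = ranked_poset P r rk
  for P :: "'a::order set" and r :: "'a \<Rightarrow> nat" and rk :: nat +
  fixes n :: nat
  assumes manifold: "homology_manifold n (geometric_realization (order_complex P))"
begin

lemma local_homology:
  assumes "x \<in> realization_points (order_complex P)"
  defines "W \<equiv> realization_points (order_complex P)"
  shows "i \<noteq> int n \<Longrightarrow>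
      trivial_group (relative_homology_group i (subtopology (powertop_real UNIV) W) (W - {x}))"
    and "relative_homology_group (int n) (subtopology (powertop_real UNIV) W) (W - {x}) \<cong> integer_group"
  using manifold assms(1)
  unfolding homology_manifold_def geometric_realization_eq W_def by auto

text \<open>The point is the barycenter of \<open>\<sigma>\<close>, which is a simplex because it is
  a face of an extended saturated tuple.\<close>

lemma interval_point_exists:
  assumes "a \<in> P" "b \<in> P" "a \<le> b"
  shows "\<exists>lo hi x. interval_point P r rk a b lo hi x"
proof -
  obtain lo hi where I: "interval_chain P r rk a b lo hi"
    using interval_chain_exists[OF assms] by blast
  interpret interval_chain P r rk a b lo hi by (rule I)
  obtain xs where xs: "xs \<in> tuples a b (r b - r a)" using saturated_tuple[OF assms] by blast
  have "set (extend xs) \<in> K" "\<sigma> \<subseteq> set (extend xs)"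
    using extend_simplex[OF xs] by (auto simp: ordered_simplices_def)
  then have "\<sigma> \<in> K" using complex_K by (auto simp: simplicial_complex_def)
  moreover have "finite \<sigma>" "\<sigma> \<noteq> {}" by (auto simp: \<sigma>_def)
  ultimately obtain x where "x \<in> realization_points K" "{v. x v \<noteq> 0} = \<sigma>"
    using realization_points_barycenter by metis
  then have "interval_point P r rk a b lo hi x"
    by unfold_locales
  then show ?thesis by blast
qed

text \<open>The choice \<open>a = b\<close> yields an interior point of a maximal simplex, where the
  local homology in degree \<open>rk\<close> is nonzero.\<close>

lemma dimension: "n = rk"
proof (rule ccontr)
  assume "n \<noteq> rk"
  obtain a where "a \<in> P" using P_nonempty by blast
  then obtain lo hi x where "interval_point P r rk a a lo hi x"
    using interval_point_exists[of a a] by auto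
  then interpret interval_point P r rk a a lo hi x .
  show False
    using top_local_homology_nontrivial local_homology(1)[OF x, of "int rk"] \<open>n \<noteq> rk\<close> by simp
qed

lemma tuple_exact:
  assumes ab: "(a, b) \<in> pairs k" and "m \<noteq> k"
    and c: "Poly_Mapping.keys c \<subseteq> tuples a b m" "mag_boundary r k c = 0"
  shows "\<exists>d. Poly_Mapping.keys d \<subseteq> tuples a b (Suc m) \<and> mag_boundary r k d = c"
proof -
  have ab': "a \<in> P" "b \<in> P" "a \<le> b" "r b - r a = k" using ab by (auto simp: pairs_iff)
  obtain lo hi x where "interval_point P r rk a b lo hi x"
    using interval_point_exists[OF ab'(1-3)] by blast
  then interpret interval_point P r rk a b lo hi x .
  \<comment> \<open>By \<open>rank_sum\<close>, \<open>m + q\<close> equals \<open>rk = n\<close>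
    only for \<open>m = k\<close>.\<close>
  have "int (m + q) \<noteq> int n" using rank_sum dimension ab'(4) \<open>m \<noteq> k\<close> by auto
  then have "trivial_group (relative_homology_group (int (m + q)) X V)"
    by (rule local_homology(1)[OF x])
  then obtain d where "d \<in> tuple_chains (Suc m)" "bd d = c"
    by (rule tuple_cycle_is_boundary) (use c ab'(4) in \<open>auto simp: tuple_chains_def\<close>)
  then show ?thesis using ab'(4) by (auto simp: tuple_chains_def)
qed

lemma tuple_generator:
  assumes ab: "(a, b) \<in> pairs k"
  shows "\<exists>z. Poly_Mapping.keys z \<subseteq> tuples a b k \<and> mag_boundary r k z = 0 \<and> z \<noteq> 0 \<and>
    (\<forall>c. Poly_Mapping.keys c \<subseteq> tuples a b k \<longrightarrow> mag_boundary r k c = 0 \<longrightarrow> (\<exists>j. c = frag_cmul j z))"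
proof -
  have ab': "a \<in> P" "b \<in> P" "a \<le> b" "r b - r a = k" using ab by (auto simp: pairs_iff)
  obtain lo hi x where "interval_point P r rk a b lo hi x"
    using interval_point_exists[OF ab'(1-3)] by blast
  then interpret interval_point P r rk a b lo hi x .
  have "relative_homology_group (int rk) X V \<cong> integer_group"
    using local_homology(2)[OF x] dimension by simp
  then obtain z where "z \<in> tuple_chains (r b - r a)" "bd z = 0" "z \<noteq> 0"
    "\<And>c. c \<in> tuple_chains (r b - r a) \<Longrightarrow> bd c = 0 \<Longrightarrow> \<exists>j. c = frag_cmul j z"
    using tuple_cycle_generator by metis
  then show ?thesis unfolding tuple_chains_def ab'(4) by blast
qed

text \<open>Primitives are found for the component of each pair and added up.\<close>

lemma mag_cycles_eq_boundaries:
  assumes "m \<noteq> k"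
  shows "mag_cycles P r k m = mag_boundaries P r k m"
proof
  show "mag_boundaries P r k m \<subseteq> mag_cycles P r k m"
    using mag_boundary_keys_mag[of _ k "Suc m"] mag_boundary_boundary[of _ k "Suc m"]
    by (auto simp: mag_boundaries_def carrier_mag_chain_group mag_cycles_iff)
  show "mag_cycles P r k m \<subseteq> mag_boundaries P r k m"
  proof
    fix c assume "c \<in> mag_cycles P r k m"
    then have c: "Poly_Mapping.keys c \<subseteq> mag_tuples P r k m" "mag_boundary r k c = 0"
      by (auto simp: mag_cycles_iff)
    have "\<exists>d. Poly_Mapping.keys d \<subseteq> mag_tuples P r k (Suc m) \<and> mag_boundary r k d = part e c"
      if e: "e \<in> pairs k" for e
    proof -
      obtain a b where ab: "e = (a, b)" by force
      have "mag_boundary r k (part e c) = 0"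
        using part_boundary[OF c(1)] c(2) by simp
      then show ?thesis
        using tuple_exact[OF _ assms part_tuples[OF c(1)], of a b] tuples_subset_mag_tuples[of a b k] e ab
        by blast
    qed
    then obtain d where d: "\<And>e. e \<in> pairs k \<Longrightarrow> Poly_Mapping.keys (d e) \<subseteq> mag_tuples P r k (Suc m)"
        "\<And>e. e \<in> pairs k \<Longrightarrow> mag_boundary r k (d e) = part e c"
      by metis
    have "mag_boundary r k (\<Sum>e\<in>pairs k. d e) = c"
      using d(2) sum_parts[OF c(1)] by (simp add: mag_boundary_sum finite_pairs)
    moreover have "Poly_Mapping.keys (\<Sum>e\<in>pairs k. d e) \<subseteq> mag_tuples P r k (Suc m)"
      by (rule keys_sum_subset[OF d(1)])
    ultimately show "c \<in> mag_boundaries P r k m"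
      by (force simp: mag_boundaries_def carrier_mag_chain_group)
  qed
qed

text \<open>One generator \<open>z\<close> per pair gives a basis of the cycles. Coefficients are
  recovered by projecting to the component of a pair, where the multiples of \<open>z\<close> are
  distinct because formal sums are torsion-free and \<open>z\<close> is nonzero.\<close>

lemma cycle_group_iso:
  "product_group {..<card (pairs k)} (\<lambda>_. integer_group) \<cong> cycle_group k k"
proof -
  let ?N = "card (pairs k)"
  obtain e where e: "bij_betw e {..<?N} (pairs k)"
    using ex_bij_betw_nat_finite[OF finite_pairs] by (auto simp: atLeast0LessThan)
  have "\<exists>z. Poly_Mapping.keys z \<subseteq> tuples (fst p) (snd p) k \<and> mag_boundary r k z = 0 \<and> z \<noteq> 0 \<and>
      (\<forall>c. Poly_Mapping.keys c \<subseteq> tuples (fst p) (snd p) k \<longrightarrow> mag_boundary r k c = 0 \<longrightarrow> (\<exists>j. c = frag_cmul j z))"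
    if "p \<in> pairs k" for p
    using tuple_generator[of "fst p" "snd p" k] that by simp
  then obtain z where zk: "\<And>p. p \<in> pairs k \<Longrightarrow> Poly_Mapping.keys (z p) \<subseteq> tuples (fst p) (snd p) k"
    and z0: "\<And>p. p \<in> pairs k \<Longrightarrow> mag_boundary r k (z p) = 0"
    and zn: "\<And>p. p \<in> pairs k \<Longrightarrow> z p \<noteq> 0"
    and zg: "\<And>p c. p \<in> pairs k \<Longrightarrow> Poly_Mapping.keys c \<subseteq> tuples (fst p) (snd p) k \<Longrightarrow>
        mag_boundary r k c = 0 \<Longrightarrow> \<exists>j. c = frag_cmul j (z p)"
    by metis
  define \<psi> where "\<psi> f = (\<Sum>i<?N. frag_cmul (f i) (z (e i)))" for f
  have eP: "e i \<in> pairs k" if "i < ?N" for i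
    using e that by (auto simp: bij_betw_def)
  have part_\<psi>: "part (e i) (\<psi> f) = frag_cmul (f i) (z (e i))" if i: "i < ?N" for i f
  proof -
    have "part (e i) (\<psi> f) = (\<Sum>i'<?N. frag_cmul (f i') (part (e i) (z (e i'))))"
      by (simp add: \<psi>_def frag_filter_sum frag_filter_cmul)
    also have "\<dots> = (\<Sum>i'<?N. if i' = i then frag_cmul (f i) (z (e i)) else 0)"
    proof (rule sum.cong)
      fix i' assume i': "i' \<in> {..<?N}"
      have "e i = e i' \<longleftrightarrow> i = i'"
        using e i i' by (auto simp: bij_betw_def inj_on_def)
      then show "frag_cmul (f i') (part (e i) (z (e i'))) =
          (if i' = i then frag_cmul (f i) (z (e i)) else 0)"
        using part_id[OF zk[OF eP[of i']], of "e i"] i' by auto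
    qed simp
    also have "\<dots> = frag_cmul (f i) (z (e i))" using i by simp
    finally show ?thesis .
  qed
  have cyc: "\<psi> f \<in> mag_cycles P r k k" for f
  proof -
    have "Poly_Mapping.keys (frag_cmul (f i) (z (e i))) \<subseteq> mag_tuples P r k k" if "i < ?N" for i
      using zk[OF eP[OF that]] tuples_subset_mag_tuples[of "fst (e i)" "snd (e i)" k k] eP[OF that]
        keys_cmul[of "f i" "z (e i)"] by auto
    then have "Poly_Mapping.keys (\<psi> f) \<subseteq> mag_tuples P r k k"
      unfolding \<psi>_def by (intro keys_sum_subset) auto
    moreover have "mag_boundary r k (\<psi> f) = 0"
      unfolding \<psi>_def by (simp add: mag_boundary_sum mag_boundary_cmul z0 eP)
    ultimately show ?thesis by (simp add: mag_cycles_iff)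
  qed
  have "\<psi> \<in> iso (product_group {..<?N} (\<lambda>_. integer_group)) (cycle_group k k)"
  proof (rule isoI)
    show "\<psi> \<in> hom (product_group {..<?N} (\<lambda>_. integer_group)) (cycle_group k k)"
    proof (rule homI)
      show "\<psi> f \<in> carrier (cycle_group k k)" for f
        using cyc by (simp add: carrier_cycle_group)
      fix f g
      have "\<psi> (\<lambda>i\<in>{..<?N}. f i + g i) = \<psi> f + \<psi> g"
        unfolding \<psi>_def sum.distrib[symmetric]
        by (intro sum.cong) (auto simp: frag_cmul_distrib)
      then show "\<psi> (f \<otimes>\<^bsub>product_group {..<?N} (\<lambda>_. integer_group)\<^esub> g) = \<psi> f \<otimes>\<^bsub>cycle_group k k\<^esub> \<psi> g"
        unfolding mult_cycle_group by simp
    qed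
    show "bij_betw \<psi> (carrier (product_group {..<?N} (\<lambda>_. integer_group))) (carrier (cycle_group k k))"
      unfolding bij_betw_def
    proof
      show "inj_on \<psi> (carrier (product_group {..<?N} (\<lambda>_. integer_group)))"
      proof (rule inj_onI)
        fix f g assume f: "f \<in> carrier (product_group {..<?N} (\<lambda>_. integer_group))"
          and g: "g \<in> carrier (product_group {..<?N} (\<lambda>_. integer_group))" and eq: "\<psi> f = \<psi> g"
        have "f i = g i" if i: "i < ?N" for i
        proof -
          have "frag_cmul (f i - g i) (z (e i)) = 0"
            using part_\<psi>[OF i, of f] part_\<psi>[OF i, of g] eq by (simp add: frag_cmul_diff_distrib)
          then show ?thesis using zn[OF eP[OF i]] by simp
        qed
        then show "f = g"
          using f g by (intro PiE_ext[of f "{..<?N}" "\<lambda>_. carrier integer_group" g]) auto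
      qed
      show "\<psi> ` carrier (product_group {..<?N} (\<lambda>_. integer_group)) = carrier (cycle_group k k)"
        unfolding carrier_cycle_group
      proof
        show "\<psi> ` carrier (product_group {..<?N} (\<lambda>_. integer_group)) \<subseteq> mag_cycles P r k k"
          using cyc by blast
        show "mag_cycles P r k k \<subseteq> \<psi> ` carrier (product_group {..<?N} (\<lambda>_. integer_group))"
        proof
          fix c assume "c \<in> mag_cycles P r k k"
          then have c: "Poly_Mapping.keys c \<subseteq> mag_tuples P r k k" "mag_boundary r k c = 0"
            by (auto simp: mag_cycles_iff)
          have "\<exists>j. part p c = frag_cmul j (z p)" if p: "p \<in> pairs k" for p
            using zg[OF p] part_tuples[OF c(1), of "fst p" "snd p"] part_boundary[OF c(1), of p] c(2) by simp
          then obtain j where j: "\<And>p. p \<in> pairs k \<Longrightarrow> part p c = frag_cmul (j p) (z p)" by metis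
          have "\<psi> (\<lambda>i\<in>{..<?N}. j (e i)) = (\<Sum>i<?N. part (e i) c)"
            unfolding \<psi>_def by (intro sum.cong) (auto simp: j eP)
          also have "\<dots> = (\<Sum>p\<in>pairs k. part p c)"
            by (rule sum.reindex_bij_betw[OF e])
          also have "\<dots> = c" by (rule sum_parts[OF c(1)])
          finally have "c = \<psi> (\<lambda>i\<in>{..<?N}. j (e i))" ..
          moreover have "(\<lambda>i\<in>{..<?N}. j (e i)) \<in> carrier (product_group {..<?N} (\<lambda>_. integer_group))"
            by simp
          ultimately show "c \<in> \<psi> ` carrier (product_group {..<?N} (\<lambda>_. integer_group))" by blast
        qed
      qed
    qed
  qed
  then show ?thesis by (auto simp: is_iso_def)
qed

lemma magnitude_homology_off_diagonal:
  "m \<noteq> k \<Longrightarrow> trivial_group (magnitude_homology P r k m)"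
  by (intro trivial_magnitude_homology mag_cycles_eq_boundaries)

lemma magnitude_homology_diagonal:
  "magnitude_homology P r k k \<cong> product_group {..<card (pairs k)} (\<lambda>_. integer_group)"
proof -
  have "group (product_group {..<card (pairs k)} (\<lambda>_. integer_group))" by simp
  then have "cycle_group k k \<cong> product_group {..<card (pairs k)} (\<lambda>_. integer_group)"
    using group.iso_sym cycle_group_iso by blast
  then show ?thesis using iso_trans magnitude_homology_top by blast
qed

lemma group_magnitude_homology_top: "group (magnitude_homology P r k k)"
  unfolding magnitude_homology_def mag_boundaries_top
  by (rule normal.factorgroup_is_group[OF group.one_is_normal[OF group_cycle_group]])

lemma torsion_free_magnitude_homology: "torsion_free_group (magnitude_homology P r k m)"
proof (cases "m = k")
  case True
  then show ?thesis
    using torsion_free_group_iso[OF group_magnitude_homology_top group_cycle_group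
        magnitude_homology_top torsion_free_cycle_group] by simp
next
  case False
  then show ?thesis
    using magnitude_homology_off_diagonal[OF False] by (simp add: torsion_free_group_def trivial_group_def)
qed

end

theorem proposition3p4:
  fixes P :: "'a::order set" and r :: "'a \<Rightarrow> nat" and rk n :: nat
  assumes "graded_poset P rk"
    and "rank_function P r"
    and "homology_manifold n (geometric_realization (order_complex P))"
  shows "diagonal_magnitude_homology P r \<and>
    (\<forall>k m. torsion_free_group (magnitude_homology P r k m)) \<and>
    (\<forall>k i. if i = k
       then magnitude_homology P r k i \<cong>
         product_group {..<card {(x, y) \<in> P \<times> P. x \<le> y \<and> int (r y) - int (r x) = int k}}
           (\<lambda>_. integer_group)
       else trivial_group (magnitude_homology P r k i))"
proof -
  interpret manifold_poset P r rk n
    using assms by unfold_locales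
  show ?thesis
    unfolding diagonal_magnitude_homology_def
    using magnitude_homology_off_diagonal torsion_free_magnitude_homology
      magnitude_homology_diagonal[unfolded pairs_def] by simp
qed

end
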